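(* Let $\mathbf{u}$ be a solution of the 2D Navier–Stokes equations $\frac{d\mathbf{u}}{dt}+\nu A\mathbf{u}+B(\mathbf{u},\mathbf{u})=\mathbf{f}$ on $[0,\infty)$, and let $I_h$ be a linear interpolant satisfying the approximation property $(\mathrm{I})$ of the context. Let $\tau>0$ and $N\in\mathbb{Z}^+$ be arbitrary, put $t_k=k\tau$ for $k\in\mathbb{N}$, and suppose $\beta>0$ and $h>0$ satisfy $c_0\beta h^2\le\nu$. Then, given $\mathbf{v}_{N,0}\in P_NH$, there exists a sequence $\{\mathbf{v}_N^k\}_{k\in\mathbb{N}}\subset P_NH$ with $\mathbf{v}_N^0=\mathbf{v}_{N,0}$ satisfying the fully implicit Euler scheme $$\frac{\mathbf{v}_N^{k+1}-\mathbf{v}_N^k}{\tau}+\nu A\mathbf{v}_N^{k+1}+P_NB(\mathbf{v}_N^{k+1},\mathbf{v}_N^{k+1})=P_N\mathbf{f}-\beta P_NP_\sigma I_h\big(\mathbf{v}_N^{k+1}-\mathbf{u}(t_{k+1})\big)\qquad\text{for all }k\in\mathbb{N}.$$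
   Context: Setting. $\Omega\subset\mathbb{R}^2$ is either (periodic case) $(0,L)\times(0,L)$, $L>0$, with periodic boundary conditions, or (no-slip case) an open, bounded, connected set with $C^2$ boundary, with no-slip Dirichlet boundary conditions. $\mathcal{V}$ denotes, in the periodic case, the divergence-free two-dimensional trigonometric polynomial vector fields with period $L$ in both directions and zero spatial average, and, in the no-slip case, the smooth compactly supported divergence-free vector fields on $\Omega$. $H$ and $V$ are the closures of $\mathcal{V}$ in $(L^2(\Omega))^2$ and $(H^1(\Omega))^2$. On $H$: $(\psi,\varphi)=\int_\Omega\psi\cdot\varphi\,dx$, with norm $|\cdot|$. On $V$: $((\psi,\varphi))=\int_\Omega\sum_{j=1}^2\partial_{x_j}\psi\cdot\partial_{x_j}\varphi\,dx$, with norm $\|\cdot\|$. $P_\sigma:(L^2(\Omega))^2\to H$ is the Leray–Helmholtz (orthogonal) projector; $A=-P_\sigma\Delta$ is the Stokes operator with domain $\mathcal{D}(A)=(H^2(\Omega))^2\cap V$; $B(\psi,\varphi)=P_\sigma((\psi\cdot\nabla)\varphi)$, extended continuously to $V\times V\to V'$. $A$ has an $H$-orthonormal basis of eigenvectors $\{\mathbf{w}_j\}$ with eigenvalues $0<\lambda_1\le\lambda_2\le\cdots\to\infty$, and $P_N$ is the orthogonal projector of $H$ onto $\mathrm{span}\{\mathbf{w}_1,\dots,\mathbf{w}_N\}$. $\nu>0$ is a constant, and $\mathbf{f}\in H$ is time independent. A solution of the Navier–Stokes equations on $[0,\infty)$ means $\mathbf{u}\in C([0,\infty);H)\cap L^2_{loc}(0,\infty;V)$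 with $d\mathbf{u}/dt\in L^2_{loc}(0,\infty;V')$ satisfying the displayed equation. $\mathbb{N}$ includes $0$. Property $(\mathrm{I})$: $I_h:(H^1(\Omega))^2\to(L^2(\Omega))^2$ is linear and $\|\varphi-I_h(\varphi)\|_{(L^2(\Omega))^2}\le c_0^{1/2}h\|\varphi\|_{(H^1(\Omega))^2}$ for all $\varphi\in(H^1(\Omega))^2$, where $c_0>0$ is an absolute constant; by convention, for $\varphi\in V$ the norm on the right is taken to be $\|\varphi\|$. *)

theory Defs
  imports "HOL-Analysis.Analysis"
begin

text \<open>
  Elements of the Lebesgue and Sobolev spaces over \<open>\<Omega>\<close> are represented by functions on the whole
  plane of which only the values on \<open>\<Omega>\<close>, up to Lebesgue null sets, are relevant. Equality in
  these spaces is therefore equality almost everywhere with respect to \<open>lebesgue_on \<Omega>\<close>.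
\<close>

type_synonym field = "real^2 \<Rightarrow> real^2"

datatype flow_setting = Periodic real | No_Slip "(real^2) set"

fun region :: "flow_setting \<Rightarrow> (real^2) set" where
  "region (Periodic L) = {x. \<forall>i. 0 < x $ i \<and> x $ i < L}"
| "region (No_Slip \<Omega>) = \<Omega>"


subsection \<open>Smooth functions and domains with $C^2$ boundary\<close>

fun Ck :: "nat \<Rightarrow> ('a::euclidean_space \<Rightarrow> 'b::real_normed_vector) \<Rightarrow> bool" where
  "Ck 0 f = continuous_on UNIV f"
| "Ck (Suc n) f = ((\<forall>x. f differentiable (at x)) \<and>
     (\<forall>b\<in>Basis. Ck n (\<lambda>x. frechet_derivative f (at x) b)))"

definition smooth :: "('a::euclidean_space \<Rightarrow> 'b::real_normed_vector) \<Rightarrow> bool" where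
  "smooth f \<longleftrightarrow> (\<forall>n. Ck n f)"

definition compact_support_in :: "('a::topological_space) set \<Rightarrow> ('a \<Rightarrow> 'b::zero) \<Rightarrow> bool" where
  "compact_support_in \<Omega> f \<longleftrightarrow> compact (closure {x. f x \<noteq> 0}) \<and> closure {x. f x \<noteq> 0} \<subseteq> \<Omega>"

definition pderiv_at :: "2 \<Rightarrow> (real^2 \<Rightarrow> 'b::real_normed_vector) \<Rightarrow> real^2 \<Rightarrow> 'b" where
  "pderiv_at i f x = frechet_derivative f (at x) (axis i 1)"

definition divergence :: "field \<Rightarrow> real^2 \<Rightarrow> real" where
  "divergence v x = (\<Sum>i\<in>UNIV. pderiv_at i v x $ i)"

text \<open>
  Near each boundary point, after a translation and an orthogonal change of coordinates, the
  domain is the set above the graph of a $C^2$ function.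
\<close>

definition C2_boundary :: "(real^2) set \<Rightarrow> bool" where
  "C2_boundary \<Omega> \<longleftrightarrow>
     (\<forall>p\<in>frontier \<Omega>. \<exists>r>0. \<exists>(T :: real^2 \<Rightarrow> real^2) (\<gamma> :: real \<Rightarrow> real).
        orthogonal_transformation T \<and> Ck 2 \<gamma> \<and>
        \<Omega> \<inter> ball p r = {x \<in> ball p r. \<gamma> (T (x - p) $ 1) < T (x - p) $ 2})"

fun admissible :: "flow_setting \<Rightarrow> bool" where
  "admissible (Periodic L) \<longleftrightarrow> L > 0"
| "admissible (No_Slip \<Omega>) \<longleftrightarrow>
     open \<Omega> \<and> bounded \<Omega> \<and> connected \<Omega> \<and> \<Omega> \<noteq> {} \<and> C2_boundary \<Omega>"


subsection \<open>Lebesgue and Sobolev spaces\<close>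

definition L2 :: "(real^2) set \<Rightarrow> field set" where
  "L2 \<Omega> = {u \<in> borel_measurable (lebesgue_on \<Omega>).
             integrable (lebesgue_on \<Omega>) (\<lambda>x. (norm (u x))\<^sup>2)}"

definition l2_inner :: "(real^2) set \<Rightarrow> field \<Rightarrow> field \<Rightarrow> real" where
  "l2_inner \<Omega> u v = (LINT x|lebesgue_on \<Omega>. u x \<bullet> v x)"

definition l2_norm :: "(real^2) set \<Rightarrow> field \<Rightarrow> real" where
  "l2_norm \<Omega> u = sqrt (l2_inner \<Omega> u u)"

definition test_functions :: "('a::euclidean_space) set \<Rightarrow> ('a \<Rightarrow> real) set" where
  "test_functions \<Omega> = {\<phi>. smooth \<phi> \<and> compact_support_in \<Omega> \<phi>}"

definition periodic_test_functions :: "real \<Rightarrow> (real^2 \<Rightarrow> real) set" where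
  "periodic_test_functions L = {\<phi>. smooth \<phi> \<and> (\<forall>i x. \<phi> (x + axis i L) = \<phi> x)}"

definition has_weak_pderiv ::
  "(real^2 \<Rightarrow> real) set \<Rightarrow> (real^2) set \<Rightarrow> 2 \<Rightarrow> field \<Rightarrow> field \<Rightarrow> bool" where
  "has_weak_pderiv \<T> \<Omega> i u g \<longleftrightarrow>
     (\<forall>\<phi>\<in>\<T>. (LINT x|lebesgue_on \<Omega>. pderiv_at i \<phi> x *\<^sub>R u x)
            = - (LINT x|lebesgue_on \<Omega>. \<phi> x *\<^sub>R g x))"

definition weak_pderiv :: "(real^2) set \<Rightarrow> 2 \<Rightarrow> field \<Rightarrow> field" where
  "weak_pderiv \<Omega> i u = (SOME g. g \<in> L2 \<Omega> \<and> has_weak_pderiv (test_functions \<Omega>) \<Omega> i u g)"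

definition H1 :: "(real^2) set \<Rightarrow> field set" where
  "H1 \<Omega> = {u \<in> L2 \<Omega>. \<forall>i. \<exists>g\<in>L2 \<Omega>. has_weak_pderiv (test_functions \<Omega>) \<Omega> i u g}"

text \<open>
  With \<open>\<T>\<close> the compactly supported test functions this is $H^2(\Omega)$. With the
  smooth periodic test functions the derivatives are those in the sense of distributions on
  the torus, and one gets the periodic space $H^2$, in which the traces of the function and
  of its first derivatives agree on opposite sides of the square.
\<close>

definition sobolev2 :: "(real^2 \<Rightarrow> real) set \<Rightarrow> (real^2) set \<Rightarrow> field set" where
  "sobolev2 \<T> \<Omega> = {u \<in> L2 \<Omega>. \<forall>i. \<exists>g\<in>L2 \<Omega>. has_weak_pderiv \<T> \<Omega> i u g \<and>
                      (\<forall>j. \<exists>k\<in>L2 \<Omega>. has_weak_pderiv \<T> \<Omega> j g k)}"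

fun H2 :: "flow_setting \<Rightarrow> field set" where
  "H2 (Periodic L) = sobolev2 (periodic_test_functions L) (region (Periodic L))"
| "H2 (No_Slip \<Omega>) = sobolev2 (test_functions \<Omega>) \<Omega>"

definition dirichlet_inner :: "(real^2) set \<Rightarrow> field \<Rightarrow> field \<Rightarrow> real" where
  "dirichlet_inner \<Omega> u v =
     (LINT x|lebesgue_on \<Omega>. (\<Sum>j\<in>UNIV. weak_pderiv \<Omega> j u x \<bullet> weak_pderiv \<Omega> j v x))"

definition dirichlet_norm :: "(real^2) set \<Rightarrow> field \<Rightarrow> real" where
  "dirichlet_norm \<Omega> u = sqrt (dirichlet_inner \<Omega> u u)"

definition h1_norm :: "(real^2) set \<Rightarrow> field \<Rightarrow> real" where
  "h1_norm \<Omega> u = sqrt ((l2_norm \<Omega> u)\<^sup>2 + (dirichlet_norm \<Omega> u)\<^sup>2)"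


subsection \<open>The spaces $H$, $V$ and $V'$\<close>

text \<open>Real trigonometric polynomials, written with real amplitudes of cosines and sines.\<close>

definition trig_poly :: "real \<Rightarrow> field \<Rightarrow> bool" where
  "trig_poly L v \<longleftrightarrow>
     (\<exists>(K :: (int \<times> int) set) a b. finite K \<and>
        v = (\<lambda>x. \<Sum>(m, n)\<in>K.
               cos (2 * pi * (of_int m * x $ 1 + of_int n * x $ 2) / L) *\<^sub>R a (m, n) +
               sin (2 * pi * (of_int m * x $ 1 + of_int n * x $ 2) / L) *\<^sub>R b (m, n)))"

fun test_fields :: "flow_setting \<Rightarrow> field set" where
  "test_fields (Periodic L) =
     {v. trig_poly L v \<and> (\<forall>x. divergence v x = 0) \<and>
         (LINT x|lebesgue_on (region (Periodic L)). v x) = 0}"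
| "test_fields (No_Slip \<Omega>) =
     {v. smooth v \<and> compact_support_in \<Omega> v \<and> (\<forall>x. divergence v x = 0)}"

definition H_space :: "flow_setting \<Rightarrow> field set" where
  "H_space S = {u \<in> L2 (region S).
     \<forall>e>0. \<exists>\<phi>\<in>test_fields S. l2_norm (region S) (\<lambda>x. u x - \<phi> x) < e}"

definition V_space :: "flow_setting \<Rightarrow> field set" where
  "V_space S = {u \<in> H1 (region S).
     \<forall>e>0. \<exists>\<phi>\<in>test_fields S. h1_norm (region S) (\<lambda>x. u x - \<phi> x) < e}"

definition V_dual :: "flow_setting \<Rightarrow> (field \<Rightarrow> real) set" where
  "V_dual S = {l.
     (\<forall>v\<in>V_space S. \<forall>w\<in>V_space S. \<forall>a b.
        l (\<lambda>x. a *\<^sub>R v x + b *\<^sub>R w x) = a * l v + b * l w) \<and>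
     (\<exists>C. \<forall>v\<in>V_space S. \<bar>l v\<bar> \<le> C * dirichlet_norm (region S) v)}"

definition V_dual_norm :: "flow_setting \<Rightarrow> (field \<Rightarrow> real) \<Rightarrow> real" where
  "V_dual_norm S l = (SUP w\<in>{w \<in> V_space S. dirichlet_norm (region S) w \<le> 1}. \<bar>l w\<bar>)"


subsection \<open>Leray projector, Stokes operator, nonlinearity\<close>

definition leray :: "flow_setting \<Rightarrow> field \<Rightarrow> field" where
  "leray S g = (SOME p. p \<in> H_space S \<and>
     (\<forall>\<phi>\<in>H_space S. l2_inner (region S) (\<lambda>x. g x - p x) \<phi> = 0))"

definition laplacian :: "(real^2) set \<Rightarrow> field \<Rightarrow> field" where
  "laplacian \<Omega> u = (\<lambda>x. \<Sum>j\<in>UNIV. weak_pderiv \<Omega> j (weak_pderiv \<Omega> j u) x)"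

definition stokes_domain :: "flow_setting \<Rightarrow> field set" where
  "stokes_domain S = H2 S \<inter> V_space S"

definition stokes :: "flow_setting \<Rightarrow> field \<Rightarrow> field" where
  "stokes S u = (\<lambda>x. - leray S (laplacian (region S) u) x)"

text \<open>
  The element $B(\psi,\varphi)$ of $V'$. For $\psi,\varphi \in \mathcal{V}$ and $w \in V$ the
  projector is dropped by orthogonality,
  $(P_\sigma((\psi\cdot\nabla)\varphi), w) = ((\psi\cdot\nabla)\varphi, w)$, and the
  right-hand side is the formula of the continuous extension to $V \times V$, because
  $H^1 \subset L^4$ in dimension two.
\<close>

definition B :: "flow_setting \<Rightarrow> field \<Rightarrow> field \<Rightarrow> (field \<Rightarrow> real)" where
  "B S \<psi> \<phi> = (\<lambda>w. l2_inner (region S)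
                 (\<lambda>x. \<Sum>j\<in>UNIV. \<psi> x $ j *\<^sub>R weak_pderiv (region S) j \<phi> x) w)"


subsection \<open>Eigenfunctions and Galerkin projections\<close>

text \<open>
  Eigenfunctions are numbered from \<open>1\<close>, and \<open>w 0\<close> is irrelevant. The projector is defined on
  functionals, which covers $V'$. An element \<open>g\<close> of $H$ is identified with \<open>l2_inner \<Omega> g\<close>.
\<close>

definition galerkin_dual :: "(nat \<Rightarrow> field) \<Rightarrow> nat \<Rightarrow> (field \<Rightarrow> real) \<Rightarrow> field" where
  "galerkin_dual w N l = (\<lambda>x. \<Sum>j=1..N. l (w j) *\<^sub>R w j x)"

definition galerkin :: "flow_setting \<Rightarrow> (nat \<Rightarrow> field) \<Rightarrow> nat \<Rightarrow> field \<Rightarrow> field" where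
  "galerkin S w N g = galerkin_dual w N (l2_inner (region S) g)"

definition galerkin_space :: "flow_setting \<Rightarrow> (nat \<Rightarrow> field) \<Rightarrow> nat \<Rightarrow> field set" where
  "galerkin_space S w N = {v \<in> H_space S. \<exists>g\<in>H_space S.
     AE x in lebesgue_on (region S). v x = galerkin S w N g x}"

definition stokes_eigenbasis :: "flow_setting \<Rightarrow> (nat \<Rightarrow> field) \<Rightarrow> (nat \<Rightarrow> real) \<Rightarrow> bool" where
  "stokes_eigenbasis S w lam \<longleftrightarrow>
     (\<forall>j\<ge>1. w j \<in> stokes_domain S \<and>
        (AE x in lebesgue_on (region S). stokes S (w j) x = lam j *\<^sub>R w j x)) \<and>
     (\<forall>i\<ge>1. \<forall>j\<ge>1. l2_inner (region S) (w i) (w j) = (if i = j then 1 else 0)) \<and>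
     (\<forall>g\<in>H_space S. (\<lambda>N. l2_norm (region S) (\<lambda>x. g x - galerkin S w N g x)) \<longlonglongrightarrow> 0) \<and>
     0 < lam 1 \<and> (\<forall>j\<ge>1. lam j \<le> lam (Suc j)) \<and> filterlim lam at_top sequentially"


subsection \<open>Solutions of the Navier--Stokes equations\<close>

text \<open>
  Weak measurability is used for functions of time with values in \<open>V\<close> or \<open>V'\<close>. These spaces
  are separable Hilbert spaces, so it agrees with strong measurability.
\<close>

definition L2_loc_V :: "flow_setting \<Rightarrow> (real \<Rightarrow> field) \<Rightarrow> bool" where
  "L2_loc_V S u \<longleftrightarrow>
     (AE t in lebesgue_on {0<..}. u t \<in> V_space S) \<and>
     (\<forall>w\<in>V_space S. (\<lambda>t. dirichlet_inner (region S) (u t) w)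
                       \<in> borel_measurable (lebesgue_on {0<..})) \<and>
     (\<forall>a b. 0 < a \<and> a < b \<longrightarrow>
        integrable (lebesgue_on {a..b}) (\<lambda>t. (dirichlet_norm (region S) (u t))\<^sup>2))"

definition L2_loc_V_dual :: "flow_setting \<Rightarrow> (real \<Rightarrow> field \<Rightarrow> real) \<Rightarrow> bool" where
  "L2_loc_V_dual S g \<longleftrightarrow>
     (AE t in lebesgue_on {0<..}. g t \<in> V_dual S) \<and>
     (\<forall>w\<in>V_space S. (\<lambda>t. g t w) \<in> borel_measurable (lebesgue_on {0<..})) \<and>
     (\<forall>a b. 0 < a \<and> a < b \<longrightarrow>
        integrable (lebesgue_on {a..b}) (\<lambda>t. (V_dual_norm S (g t))\<^sup>2))"

text \<open>\<open>g\<close> is the distributional time derivative of \<open>u\<close> on $(0,\infty)$ with values in $V'$.\<close>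

definition has_time_derivative ::
  "flow_setting \<Rightarrow> (real \<Rightarrow> field) \<Rightarrow> (real \<Rightarrow> field \<Rightarrow> real) \<Rightarrow> bool" where
  "has_time_derivative S u g \<longleftrightarrow>
     (\<forall>\<theta>\<in>test_functions {0<..}. \<forall>w\<in>V_space S.
        (LINT t|lebesgue_on {0<..}. deriv \<theta> t * l2_inner (region S) (u t) w)
          = - (LINT t|lebesgue_on {0<..}. \<theta> t * g t w))"

text \<open>
  The equation is an identity in $V'$ for almost every time, and \<open>A\<close> acts on \<open>V\<close> through
  $\langle A v, w\rangle = ((v, w))$.
\<close>

definition navier_stokes_solution ::
  "flow_setting \<Rightarrow> real \<Rightarrow> field \<Rightarrow> (real \<Rightarrow> field) \<Rightarrow> bool" where
  "navier_stokes_solution S \<nu> f u \<longleftrightarrow>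
     (\<forall>t\<ge>0. u t \<in> H_space S) \<and>
     (\<forall>s\<ge>0. ((\<lambda>t. l2_norm (region S) (\<lambda>x. u t x - u s x)) \<longlongrightarrow> 0) (at s within {0..})) \<and>
     L2_loc_V S u \<and>
     (\<exists>g. L2_loc_V_dual S g \<and> has_time_derivative S u g \<and>
        (AE t in lebesgue_on {0<..}. \<forall>w\<in>V_space S.
           g t w + \<nu> * dirichlet_inner (region S) (u t) w + B S (u t) (u t) w
             = l2_inner (region S) f w))"


subsection \<open>Interpolants\<close>

text \<open>
  \<open>I\<close> is a function with domain $H^1$, so in the style of \<open>HOL-Library.FuncSet\<close> it takes the
  value \<open>undefined\<close> at arguments outside $H^1$.
\<close>

definition interpolant :: "flow_setting \<Rightarrow> real \<Rightarrow> real \<Rightarrow> (field \<Rightarrow> field) \<Rightarrow> bool" where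
  "interpolant S c\<^sub>0 h I \<longleftrightarrow>
     I \<in> H1 (region S) \<rightarrow>\<^sub>E L2 (region S) \<and>
     (\<forall>\<phi>\<in>H1 (region S). \<forall>\<psi>\<in>H1 (region S). \<forall>a b.
        AE x in lebesgue_on (region S).
          I (\<lambda>y. a *\<^sub>R \<phi> y + b *\<^sub>R \<psi> y) x = a *\<^sub>R I \<phi> x + b *\<^sub>R I \<psi> x) \<and>
     (\<forall>\<phi>\<in>H1 (region S).
        l2_norm (region S) (\<lambda>x. \<phi> x - I \<phi> x)
          \<le> sqrt c\<^sub>0 * h * (if \<phi> \<in> V_space S then dirichlet_norm (region S) \<phi>
                            else h1_norm (region S) \<phi>))"

end

theory Submission
  imports Defs "HOL-Homology.Homology"
begin

text \<open>
  In coordinates with respect to the first \<open>N\<close> eigenvectors, one step of the scheme asks for a zero of a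
  polynomial map \<open>G\<close> of \<open>\<real>\<^sup>N\<close>. Pairing \<open>G a\<close> with \<open>a\<close>, the nonlinear term drops out because
  \<open>\<langle>B(v, v), v\<rangle> = 0\<close>, and the condition \<open>c\<^sub>0 \<beta> h\<^sup>2 \<le> \<nu>\<close> lets the viscous term absorb the interpolation
  error in the feedback term, so that \<open>G a \<bullet> a \<ge> |a|\<^sup>2 / \<tau> - C |a|\<close>. Such a map has a zero, since
  otherwise it would contract a sphere.
\<close>

subsection \<open>Smooth functions\<close>

text \<open>The identity \<open>B S v v v = 0\<close> is an integration by parts on test fields. It
  passes to V only if the trilinear form is continuous in the H1 norm, which rests on the embedding
  of V into L4: Ladyzhenskaya's inequality is proved for smooth functions on a box and carried to V
  by Fatou's lemma. The second obstacle is that \<open>weak_pderiv\<close> and \<open>leray\<close>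
  are choices, determined only up to null sets. Uniqueness of weak derivatives comes from the
  fundamental lemma of the calculus of variations; existence of the Leray projection comes from the
  eigenbasis itself, as an orthogonal series. Only then is \<open>stokes\<close> known to act on
  combinations of eigenvectors by multiplying their coefficients with the eigenvalues, so that the
  viscous term yields exactly \<nu> times the squared Dirichlet norm, the norm in which the
  interpolation error is measured on V. Both boundary conditions are treated together through a
  class of scalar tests whose derivatives integrate to 0 over \<Omega>. That spheres are not
  contractible is taken from homology.\<close>

lemma Ck_SucI:
  assumes "\<And>x. (f has_derivative F x) (at x)" and "\<And>b. b \<in> Basis \<Longrightarrow> Ck n (\<lambda>x. F x b)"
  shows "Ck (Suc n) f"
proof -
  have "frechet_derivative f (at x) = F x" for x
    using assms(1)[of x] frechet_derivative_at by metis
  then show ?thesis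
    using assms by (auto simp: differentiable_def)
qed

text \<open>\<open>Ck\<close> speaks of \<open>frechet_derivative\<close>. This rule and its
  converse exchange it for an arbitrary family \<open>F\<close> of derivatives, so that each closure
  property below can be proved by naming the derivative.\<close>

lemma Ck_SucE:
  assumes "Ck (Suc n) f"
  obtains F where "\<And>x. (f has_derivative F x) (at x)" and "\<And>b. b \<in> Basis \<Longrightarrow> Ck n (\<lambda>x. F x b)"
proof
  show "(f has_derivative frechet_derivative f (at x)) (at x)" for x
    using assms by (simp flip: frechet_derivative_works)
qed (use assms in auto)

text \<open>The product rule leaves undifferentiated factors. They are assumed to be
  \<open>Ck (Suc n)\<close> but enter the induction step as \<open>Ck n\<close> functions.\<close>

lemma Ck_SucD: "Ck (Suc n) f \<Longrightarrow> Ck n f"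
proof (induction n arbitrary: f)
  case 0
  then show ?case
    by (auto intro!: continuous_at_imp_continuous_on differentiable_imp_continuous_within)
qed auto

lemma Ck_const: "Ck n (\<lambda>x. c)"
proof (induction n arbitrary: c)
  case (Suc n)
  show ?case by (rule Ck_SucI[where F = "\<lambda>_ _. 0"]) (use Suc in auto)
qed auto

lemma Ck_add: "Ck n f \<Longrightarrow> Ck n g \<Longrightarrow> Ck n (\<lambda>x. f x + g x)"
proof (induction n arbitrary: f g)
  case 0
  then show ?case by (auto intro: continuous_intros)
next
  case (Suc n)
  obtain F where F: "\<And>x. (f has_derivative F x) (at x)" "\<And>b. b \<in> Basis \<Longrightarrow> Ck n (\<lambda>x. F x b)"
    using Suc.prems(1) by (rule Ck_SucE) blast
  obtain G where G: "\<And>x. (g has_derivative G x) (at x)" "\<And>b. b \<in> Basis \<Longrightarrow> Ck n (\<lambda>x. G x b)"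
    using Suc.prems(2) by (rule Ck_SucE) blast
  show ?case
    by (rule Ck_SucI[where F = "\<lambda>x h. F x h + G x h"]) (auto intro!: F G has_derivative_add Suc.IH)
qed

lemma Ck_sum: "(\<And>i. i \<in> I \<Longrightarrow> Ck n (f i)) \<Longrightarrow> Ck n (\<lambda>x. \<Sum>i\<in>I. f i x)"
  by (induction I rule: infinite_finite_induct) (auto intro: Ck_const Ck_add)

lemma Ck_bilinear:
  assumes p: "bounded_bilinear p"
  shows "Ck n f \<Longrightarrow> Ck n g \<Longrightarrow> Ck n (\<lambda>x. p (f x) (g x))"
proof (induction n arbitrary: f g)
  case 0
  then show ?case using bounded_bilinear.continuous_on[OF p] by auto
next
  case (Suc n)
  obtain F where F: "\<And>x. (f has_derivative F x) (at x)" "\<And>b. b \<in> Basis \<Longrightarrow> Ck n (\<lambda>x. F x b)"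
    using Suc.prems(1) by (rule Ck_SucE) blast
  obtain G where G: "\<And>x. (g has_derivative G x) (at x)" "\<And>b. b \<in> Basis \<Longrightarrow> Ck n (\<lambda>x. G x b)"
    using Suc.prems(2) by (rule Ck_SucE) blast
  show ?case
    by (rule Ck_SucI[where F = "\<lambda>x h. p (f x) (G x h) + p (F x h) (g x)"])
      (auto intro!: F G bounded_bilinear.FDERIV[OF p] Ck_add Suc.IH Ck_SucD[OF Suc.prems(1)] Ck_SucD[OF Suc.prems(2)])
qed

lemma Ck_compose_affine:
  fixes f :: "'b::euclidean_space \<Rightarrow> 'c::real_normed_vector" and l :: "'a::euclidean_space \<Rightarrow> 'b"
  assumes l: "bounded_linear l"
  shows "Ck n f \<Longrightarrow> Ck n (\<lambda>x. f (l x + c))"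
proof (induction n arbitrary: f)
  case 0
  then have "continuous_on UNIV f" by simp
  then show ?case
    using continuous_on_compose2[of UNIV f UNIV "\<lambda>x. l x + c"]
      continuous_on_add[OF linear_continuous_on[OF l] continuous_on_const]
    by simp
next
  case (Suc n)
  obtain F where F: "\<And>x. (f has_derivative F x) (at x)" "\<And>b. b \<in> Basis \<Longrightarrow> Ck n (\<lambda>x. F x b)"
    using Suc.prems(1) by (rule Ck_SucE) blast
  \<comment> \<open>Only the partial derivatives of \<open>f\<close> along basis vectors are known
    to be \<open>Ck n\<close>; expanding \<open>l h\<close> in the basis reduces every direction to
    these.\<close>
  have e: "F (l x + c) (l h) = (\<Sum>b\<in>Basis. (l h \<bullet> b) *\<^sub>R F (l x + c) b)" for x h
  proof -
    interpret bounded_linear "F (l x + c)" using F(1) by (rule has_derivative_bounded_linear)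
    have "F (l x + c) (l h) = F (l x + c) (\<Sum>b\<in>Basis. (l h \<bullet> b) *\<^sub>R b)"
      by (simp add: euclidean_representation)
    then show ?thesis by (simp add: sum scaleR)
  qed
  show ?case
  proof (rule Ck_SucI[where F = "\<lambda>x h. F (l x + c) (l h)"])
    fix x
    have "((\<lambda>x. l x + c) has_derivative l) (at x)"
      using has_derivative_add_const[OF bounded_linear.has_derivative[OF l has_derivative_ident]] .
    from has_derivative_compose[OF this F(1)]
    show "((\<lambda>x. f (l x + c)) has_derivative (\<lambda>h. F (l x + c) (l h))) (at x)" .
  next
    fix b :: 'a
    show "Ck n (\<lambda>x. F (l x + c) (l b))"
      unfolding e by (intro Ck_sum Ck_bilinear[OF bounded_bilinear_scaleR] Ck_const Suc.IH F(2))
  qed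
qed

lemma Ck_bounded_linear:
  assumes l: "bounded_linear l"
  shows "Ck n f \<Longrightarrow> Ck n (\<lambda>x. l (f x))"
proof (induction n arbitrary: f)
  case 0
  then show ?case using bounded_linear.continuous_on[OF l] by auto
next
  case (Suc n)
  obtain F where F: "\<And>x. (f has_derivative F x) (at x)" "\<And>b. b \<in> Basis \<Longrightarrow> Ck n (\<lambda>x. F x b)"
    using Suc.prems(1) by (rule Ck_SucE) blast
  show ?case
    by (rule Ck_SucI[where F = "\<lambda>x h. l (F x h)"])
      (auto intro!: F bounded_linear.has_derivative[OF l] Suc.IH)
qed

lemma Ck_local:
  assumes "\<And>x. \<exists>U g. open U \<and> x \<in> U \<and> Ck n g \<and> (\<forall>y\<in>U. f y = g y)"
  shows "Ck n f"
  using assms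
proof (induction n arbitrary: f)
  case 0
  have "isCont f x" for x
  proof -
    obtain U g where U: "open U" "x \<in> U" "Ck 0 g" "\<forall>y\<in>U. f y = g y"
      using 0[of x] by blast
    then have "isCont g x" by (simp add: continuous_on_eq_continuous_at)
    moreover have "eventually (\<lambda>y. f y = g y) (nhds x)"
      using U by (auto simp: eventually_nhds)
    ultimately show ?thesis using isCont_cong by metis
  qed
  then show ?case by (simp add: continuous_at_imp_continuous_on)
next
  case (Suc n)
  \<comment> \<open>The derivatives must agree on all of \<open>U\<close>, not only at
    \<open>x\<close>: the induction hypothesis is applied to a partial derivative and asks again for
    local agreement.\<close>
  have *: "\<exists>U g. open U \<and> x \<in> U \<and> Ck (Suc n) g \<and> (\<forall>y\<in>U. f y = g y) \<and>
      (\<forall>y\<in>U. (f has_derivative frechet_derivative g (at y)) (at y) \<and>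
         frechet_derivative f (at y) = frechet_derivative g (at y))" for x
  proof -
    obtain U g where U: "open U" "x \<in> U" "Ck (Suc n) g" "\<forall>y\<in>U. f y = g y"
      using Suc.prems[of x] by blast
    have "(f has_derivative frechet_derivative g (at y)) (at y)" if "y \<in> U" for y
    proof (rule has_derivative_transform_within_open[where f = g and s = U])
      show "(g has_derivative frechet_derivative g (at y)) (at y)"
        using U(3) by (simp flip: frechet_derivative_works)
    qed (use U that in auto)
    then have "\<forall>y\<in>U. (f has_derivative frechet_derivative g (at y)) (at y) \<and>
         frechet_derivative f (at y) = frechet_derivative g (at y)"
      using frechet_derivative_at by metis
    then show ?thesis using U by blast
  qed
  show ?case
    unfolding Ck.simps
  proof (intro conjI allI ballI)
    show "f differentiable at x" for x
      using *[of x] by (auto simp: differentiable_def)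
    fix b :: 'a assume b: "b \<in> Basis"
    show "Ck n (\<lambda>x. frechet_derivative f (at x) b)"
    proof (rule Suc.IH)
      fix x
      obtain U g where U: "open U" "x \<in> U" "Ck (Suc n) g"
        and eq: "\<forall>y\<in>U. (f has_derivative frechet_derivative g (at y)) (at y) \<and>
           frechet_derivative f (at y) = frechet_derivative g (at y)"
        using *[of x] by (elim exE conjE)
      have "Ck n (\<lambda>y. frechet_derivative g (at y) b)"
        using U(3) b unfolding Ck.simps by blast
      moreover have "\<forall>y\<in>U. frechet_derivative f (at y) b = frechet_derivative g (at y) b"
        using eq by metis
      ultimately show "\<exists>U g. open U \<and> x \<in> U \<and> Ck n g \<and> (\<forall>y\<in>U. frechet_derivative f (at y) b = g y)"
        using U by (intro exI conjI)
    qed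
  qed
qed

lemma smooth_const: "smooth (\<lambda>x. c)"
  by (simp add: smooth_def Ck_const)

lemma smooth_add: "smooth f \<Longrightarrow> smooth g \<Longrightarrow> smooth (\<lambda>x. f x + g x)"
  using Ck_add[of _ f g] unfolding smooth_def by blast

lemma smooth_sum: "(\<And>i. i \<in> I \<Longrightarrow> smooth (f i)) \<Longrightarrow> smooth (\<lambda>x. \<Sum>i\<in>I. f i x)"
  using Ck_sum[of I _ f] unfolding smooth_def by blast

lemma smooth_bilinear: "bounded_bilinear p \<Longrightarrow> smooth f \<Longrightarrow> smooth g \<Longrightarrow> smooth (\<lambda>x. p (f x) (g x))"
  using Ck_bilinear[of p _ f g] unfolding smooth_def by blast

lemmas smooth_scaleR = smooth_bilinear[OF bounded_bilinear_scaleR]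
lemmas smooth_mult = smooth_bilinear[OF bounded_bilinear_mult]

lemma smooth_bounded_linear: "bounded_linear l \<Longrightarrow> smooth f \<Longrightarrow> smooth (\<lambda>x. l (f x))"
  using Ck_bounded_linear[of l _ f] unfolding smooth_def by blast

lemma smooth_vec_nth: "smooth f \<Longrightarrow> smooth (\<lambda>x. f x $ i)"
  by (rule smooth_bounded_linear[OF bounded_linear_vec_nth])

lemma smooth_compose_affine:
  fixes f :: "'b::euclidean_space \<Rightarrow> 'c::real_normed_vector" and l :: "'a::euclidean_space \<Rightarrow> 'b"
  shows "smooth f \<Longrightarrow> bounded_linear l \<Longrightarrow> smooth (\<lambda>x. f (l x + c))"
  using Ck_compose_affine[of l _ f c] unfolding smooth_def by blast

lemma smooth_local:
  assumes "\<And>x. \<exists>U g. open U \<and> x \<in> U \<and> smooth g \<and> (\<forall>y\<in>U. f y = g y)"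
  shows "smooth f"
  unfolding smooth_def
proof
  fix n
  show "Ck n f"
  proof (rule Ck_local)
    show "\<exists>U g. open U \<and> x \<in> U \<and> Ck n g \<and> (\<forall>y\<in>U. f y = g y)" for x
      using assms[of x] unfolding smooth_def by metis
  qed
qed

lemma smooth_prod:
  fixes f :: "'i \<Rightarrow> 'a::euclidean_space \<Rightarrow> real"
  shows "(\<And>i. i \<in> I \<Longrightarrow> smooth (f i)) \<Longrightarrow> smooth (\<lambda>x. \<Prod>i\<in>I. f i x)"
  by (induction I rule: infinite_finite_induct) (auto intro: smooth_const smooth_mult)

lemma smooth_imp_has_derivative: "smooth f \<Longrightarrow> (f has_derivative frechet_derivative f (at x)) (at x)"
  unfolding smooth_def using Ck.simps(2)[of 0 f] frechet_derivative_works by blast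

lemma smooth_imp_continuous_on: "smooth f \<Longrightarrow> continuous_on A f"
  unfolding smooth_def using Ck.simps(1)[of f] continuous_on_subset by blast

lemma smooth_pderiv_at: "smooth f \<Longrightarrow> smooth (pderiv_at i f)"
  unfolding smooth_def
proof
  fix n assume "\<forall>n. Ck n f"
  then have "Ck (Suc n) f" by blast
  then show "Ck n (pderiv_at i f)"
    by (auto simp: pderiv_at_def[abs_def] axis_in_Basis_iff)
qed

section \<open>Cutoffs in one variable and bump functions on boxes\<close>

lemma smooth_real_coinduct:
  fixes f :: "real \<Rightarrow> real"
  assumes "P f" and step: "\<And>f. P f \<Longrightarrow> \<exists>f'. P f' \<and> (\<forall>x. (f has_real_derivative f' x) (at x))"
  shows "smooth f"
proof -
  have "Ck n f" if "P f" for n f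
    using that
  proof (induction n arbitrary: f)
    case 0
    then obtain f' where "\<forall>x. (f has_real_derivative f' x) (at x)" using step by blast
    then show ?case
      by (auto intro!: continuous_at_imp_continuous_on DERIV_isCont)
  next
    case (Suc n)
    then obtain f' where f': "P f'" "\<forall>x. (f has_real_derivative f' x) (at x)" using step by blast
    show ?case
      by (rule Ck_SucI[where F = "\<lambda>x h. f' x * h"])
        (use f' Suc.IH in \<open>auto simp: has_field_derivative_def\<close>)
  qed
  then show ?thesis using \<open>P f\<close> by (simp add: smooth_def)
qed

lemma smooth_cos_sin: "smooth (\<lambda>x::real. a * cos x + b * sin x)"
proof (rule smooth_real_coinduct[where P = "\<lambda>f. \<exists>a b. f = (\<lambda>x. a * cos x + b * sin x)"])
  fix f :: "real \<Rightarrow> real" assume "\<exists>a b. f = (\<lambda>x. a * cos x + b * sin x)"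
  then obtain a b where f: "f = (\<lambda>x. a * cos x + b * sin x)" by blast
  show "\<exists>f'. (\<exists>a b. f' = (\<lambda>x. a * cos x + b * sin x)) \<and> (\<forall>x. (f has_real_derivative f' x) (at x))"
  proof (intro exI conjI)
    show "\<forall>x. (f has_real_derivative b * cos x + (- a) * sin x) (at x)"
      unfolding f by (auto intro!: derivative_eq_intros)
  qed (rule refl)
qed auto

text \<open>The classical flat function with a scale parameter: as \<open>s\<close> decreases to 0
  the values increase to the indicator of the positive reals, which is how bumps will approximate
  indicators of boxes.\<close>

definition exp_cutoff :: "real \<Rightarrow> real \<Rightarrow> real" where
  "exp_cutoff s t = (if t > 0 then exp (- s / t) else 0)"

text \<open>Substituting x = 1/t turns this into the decay of polynomials times exp(-s x) at
  infinity.\<close>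

lemma tendsto_poly_exp_inverse:
  fixes p :: "real poly" and s :: real
  assumes s: "s > 0"
  shows "((\<lambda>t. poly p (1 / t) * exp (- s / t)) \<longlongrightarrow> 0) (at_right 0)"
proof -
  have "((\<lambda>x. x ^ k * exp (- s * x)) \<longlongrightarrow> 0) at_top" for k
  proof -
    have "filterlim (\<lambda>x. s * x) at_top at_top"
      using s by (rule filterlim_tendsto_pos_mult_at_top[OF tendsto_const _ filterlim_ident])
    from filterlim_compose[OF tendsto_power_div_exp_0[of k] this]
    have "((\<lambda>x. (1 / s ^ k) * ((s * x) ^ k / exp (s * x))) \<longlongrightarrow> (1 / s ^ k) * 0) at_top"
      by (intro tendsto_mult tendsto_const)
    then show ?thesis
      using s by (simp add: power_mult_distrib exp_minus field_simps)
  qed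
  then have "((\<lambda>x. Polynomial.coeff p k * (x ^ k * exp (- s * x))) \<longlongrightarrow> 0) at_top" for k
    by (rule tendsto_mult_right_zero)
  then have "((\<lambda>x. \<Sum>k\<le>Polynomial.degree p. Polynomial.coeff p k * (x ^ k * exp (- s * x))) \<longlongrightarrow> 0) at_top"
    by (rule tendsto_null_sum)
  then have *: "((\<lambda>x. poly p x * exp (- s * x)) \<longlongrightarrow> 0) at_top"
    by (simp add: poly_altdef sum_distrib_right mult.assoc)
  show ?thesis
    using filterlim_compose[OF * filterlim_inverse_at_top_right] by (simp add: field_simps)
qed

text \<open>The functions p(1/t) exp(-s/t), continued by 0 to t \<le> 0, form a class closed under
  differentiation, and the cutoff is the member with p = 1.\<close>

lemma smooth_exp_cutoff:
  assumes s: "s > 0"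
  shows "smooth (exp_cutoff s)"
proof (rule smooth_real_coinduct[where P = "\<lambda>f. \<exists>p. f = (\<lambda>t. if t > 0 then poly p (1 / t) * exp (- s / t) else 0)"])
  show "\<exists>p. exp_cutoff s = (\<lambda>t. if t > 0 then poly p (1 / t) * exp (- s / t) else 0)"
    by (rule exI[of _ 1]) (auto simp: exp_cutoff_def)
next
  fix f :: "real \<Rightarrow> real"
  assume "\<exists>p. f = (\<lambda>t. if t > 0 then poly p (1 / t) * exp (- s / t) else 0)"
  then obtain p where f: "f = (\<lambda>t. if t > 0 then poly p (1 / t) * exp (- s / t) else 0)" by blast
  \<comment> \<open>The derivative of p(1/t) exp(-s/t) is t^(-2) (s p(1/t) - p'(1/t)) exp(-s/t), and
    t^(-2) is the polynomial x^2 at x = 1/t.\<close>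
  define q where "q = [:0, 0, 1:] * ([:s:] * p - pderiv p)"
  define f' where "f' = (\<lambda>t. if t > 0 then poly q (1 / t) * exp (- s / t) else 0)"
  have "(f has_real_derivative f' t) (at t)" for t
  proof -
    consider "t > 0" | "t < 0" | "t = 0" by linarith
    then show ?thesis
    proof cases
      case 1
      have "((\<lambda>t. poly p (1 / t) * exp (- s / t)) has_real_derivative f' t) (at t)"
        using 1 by (auto intro!: derivative_eq_intros simp: f'_def q_def field_simps power2_eq_square)
      then show ?thesis
        by (rule has_field_derivative_transform_within_open[of _ _ _ "{0<..}"]) (use 1 in \<open>auto simp: f\<close>)
    next
      case 2
      have "((\<lambda>t. 0) has_real_derivative f' t) (at t)"
        using 2 by (auto simp: f'_def)
      then show ?thesis
        by (rule has_field_derivative_transform_within_open[of _ _ _ "{..<0}"]) (use 2 in \<open>auto simp: f\<close>)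
    next
      case 3
      \<comment> \<open>At 0 the difference quotient has the same shape again: the factor 1/h
        replaces p by x p.\<close>
      have "((\<lambda>h. f h / h) \<longlongrightarrow> 0) (at_right 0)"
      proof (rule Lim_transform_eventually[OF tendsto_poly_exp_inverse[OF s, of "[:0, 1:] * p"]])
        show "\<forall>\<^sub>F t in at_right 0. poly ([:0, 1:] * p) (1 / t) * exp (- s / t) = f t / t"
          by (auto simp: eventually_at_filter f)
      qed
      moreover have "((\<lambda>h. f h / h) \<longlongrightarrow> 0) (at_left 0)"
        by (rule Lim_transform_eventually[OF tendsto_const]) (auto simp: eventually_at_filter f)
      ultimately have "((\<lambda>h. f h / h) \<longlongrightarrow> 0) (at 0)"
        by (simp add: filterlim_split_at)
      then show ?thesis using 3 by (simp add: has_field_derivative_iff f f'_def)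
    qed
  qed
  then show "\<exists>f'. (\<exists>p. f' = (\<lambda>t. if t > 0 then poly p (1 / t) * exp (- s / t) else 0)) \<and>
      (\<forall>x. (f has_real_derivative f' x) (at x))"
    by (intro exI[of _ f']) (auto simp: f'_def)
qed

text \<open>Boxes rather than balls, because they are stable under intersection and generate the
  Borel sets, which the fundamental lemma below exploits.\<close>

definition box_bump :: "real \<Rightarrow> real^2 \<Rightarrow> real^2 \<Rightarrow> real^2 \<Rightarrow> real" where
  "box_bump s a b x = (\<Prod>i\<in>UNIV. exp_cutoff s (x $ i - a $ i) * exp_cutoff s (b $ i - x $ i))"

lemma smooth_box_bump:
  assumes "s > 0" shows "smooth (box_bump s a b)"
proof -
  have "smooth (\<lambda>x::real^2. exp_cutoff s (x $ i + (- a $ i)))"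
    and "smooth (\<lambda>x::real^2. exp_cutoff s (- x $ i + b $ i))" for i
    by (intro smooth_compose_affine smooth_exp_cutoff assms bounded_linear_vec_nth bounded_linear_minus)+
  then show ?thesis
    unfolding box_bump_def[abs_def] by (auto intro!: smooth_prod smooth_mult)
qed

lemma exp_cutoff_bounds: "s > 0 \<Longrightarrow> 0 \<le> exp_cutoff s t \<and> exp_cutoff s t \<le> 1"
  by (auto simp: exp_cutoff_def)

lemma box_bump_bounds: "s > 0 \<Longrightarrow> 0 \<le> box_bump s a b x \<and> box_bump s a b x \<le> 1"
  unfolding box_bump_def
  by (auto intro!: prod_nonneg prod_le_1 mult_nonneg_nonneg mult_le_one simp: exp_cutoff_bounds)

lemma box_bump_eq_0_iff: "box_bump s a b x = 0 \<longleftrightarrow> x \<notin> box a b"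
  by (auto simp: box_bump_def exp_cutoff_def mem_box_cart)

lemma box_bump_test_function:
  assumes "s > 0" "cbox a b \<subseteq> \<Omega>"
  shows "box_bump s a b \<in> test_functions \<Omega>"
proof -
  have "closure {x. box_bump s a b x \<noteq> 0} \<subseteq> cbox a b"
    by (rule closure_minimal) (auto simp: box_bump_eq_0_iff closed_cbox box_subset_cbox[THEN subsetD])
  then show ?thesis
    using assms bounded_subset[OF bounded_cbox]
    by (auto simp: test_functions_def compact_support_in_def smooth_box_bump compact_eq_bounded_closed)
qed

lemma box_bump_tendsto_indicator: "(\<lambda>n. box_bump (1 / Suc n) a b x) \<longlonglongrightarrow> indicator (box a b) x"
proof (cases "x \<in> box a b")
  case True
  have "(\<lambda>n. exp_cutoff (1 / Suc n) t) \<longlonglongrightarrow> 1" if "t > 0" for t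
  proof -
    have "(\<lambda>n. (- (1 / Suc n)) / t) \<longlonglongrightarrow> - 0 / t"
      using that by (intro tendsto_intros LIMSEQ_Suc[OF lim_1_over_n]) auto
    from tendsto_exp[OF this] show ?thesis using that by (simp add: exp_cutoff_def)
  qed
  then have "(\<lambda>n. box_bump (1 / Suc n) a b x) \<longlonglongrightarrow> (\<Prod>i\<in>(UNIV::2 set). 1 * 1)"
    unfolding box_bump_def using True
    by (intro tendsto_prod tendsto_mult) (auto simp: mem_box_cart)
  then show ?thesis using True by simp
next
  case False
  then have "box_bump s a b x = 0" for s by (simp add: box_bump_eq_0_iff)
  then show ?thesis using False by simp
qed

subsection \<open>Integration over boxes in the plane\<close>

text \<open>Here \<open>i\<close> names the direction of the line on which \<open>s\<close> runs,
  and \<open>t\<close> is the other coordinate. With the direction as a parameter, each argument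
  along coordinate lines is made once for both axes.\<close>

definition pt :: "2 \<Rightarrow> real \<Rightarrow> real \<Rightarrow> real^2" where
  "pt i s t = (\<chi> j. if j = i then s else t)"

lemma two_UNIV: "(i::2) \<noteq> j \<Longrightarrow> UNIV = {i, j}"
  using exhaust_2[of i] exhaust_2[of j] by (auto simp: UNIV_2)

lemma two_all:
  assumes "(i::2) \<noteq> j"
  shows "(\<forall>k. P k) \<longleftrightarrow> P i \<and> P j"
proof -
  have "k = i \<or> k = j" for k
    using assms exhaust_2[of i] exhaust_2[of j] exhaust_2[of k] by auto
  then show ?thesis by metis
qed

lemma two_other: obtains j :: 2 where "j \<noteq> i"
  using that[of "if i = 1 then 2 else 1"] by (auto split: if_splits)

lemma pt_swap: "pt 1 s t = pt 2 t s"
  by (simp add: pt_def vec_eq_iff forall_2)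

lemma pt_eq: "pt i s t = s *\<^sub>R axis i 1 + pt i 0 t"
  by (simp add: pt_def vec_eq_iff axis_def)

lemma continuous_on_pt: "continuous_on UNIV (\<lambda>(s, t). pt i s t)"
proof -
  have "continuous_on UNIV (\<lambda>p. pt i (fst p) (snd p))"
    unfolding pt_def by (intro continuous_on_vec_lambda, rename_tac k, case_tac "k = i") (auto intro!: continuous_intros)
  then show ?thesis by (simp add: case_prod_beta)
qed

lemma measurable_pt [measurable]: "(\<lambda>(s, t). pt i s t) \<in> borel_measurable (borel \<Otimes>\<^sub>M borel)"
  using borel_measurable_continuous_onI[OF continuous_on_pt] by (simp add: borel_prod)

text \<open>Volumes of boxes determine Lebesgue measure, and the preimage of a box under
  \<open>pt i\<close> is a product of intervals. This makes Fubini available with the inner integral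
  along either axis.\<close>

lemma lborel_pt: "lborel = distr (lborel \<Otimes>\<^sub>M lborel) borel (\<lambda>(s, t). pt i s t)"
proof (rule lborel_eqI)
  fix l u :: "real^2"
  assume le: "\<And>b. b \<in> Basis \<Longrightarrow> l \<bullet> b \<le> u \<bullet> b"
  obtain j where j: "j \<noteq> i" by (rule two_other)
  have lek: "l $ k \<le> u $ k" for k
    using le[of "axis k 1"] by (simp add: inner_axis axis_in_Basis_iff)
  have "(\<lambda>(s, t). pt i s t) -` box l u = {l $ i<..<u $ i} \<times> {l $ j<..<u $ j}"
    using j by (auto simp: mem_box_cart pt_def two_all[OF j])
  then have "emeasure (distr (lborel \<Otimes>\<^sub>M lborel) borel (\<lambda>(s, t). pt i s t)) (box l u)
      = emeasure (lborel \<Otimes>\<^sub>M lborel) ({l $ i<..<u $ i} \<times> {l $ j<..<u $ j})"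
    by (subst emeasure_distr) (auto simp: space_pair_measure)
  also have "\<dots> = ennreal ((u $ i - l $ i) * (u $ j - l $ j))"
    using lek by (simp add: lborel.emeasure_pair_measure_Times ennreal_mult)
  also have "(u $ i - l $ i) * (u $ j - l $ j) = (\<Prod>k\<in>UNIV. u $ k - l $ k)"
    using j by (simp add: two_UNIV[OF j])
  also have "\<dots> = (\<Prod>b\<in>Basis. (u - l) \<bullet> b)"
    by (simp add: Basis_vec_def inner_axis axis_eq_axis prod.UNION_disjoint)
  finally show "emeasure (distr (lborel \<Otimes>\<^sub>M lborel) borel (\<lambda>(s, t). pt i s t)) (box l u)
      = (\<Prod>b\<in>Basis. (u - l) \<bullet> b)" .
qed simp

lemma nn_integral_pt:
  assumes [measurable]: "F \<in> borel_measurable borel"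
  shows "(\<integral>\<^sup>+x. F x \<partial>lborel) = (\<integral>\<^sup>+t. \<integral>\<^sup>+s. F (pt i s t) \<partial>lborel \<partial>lborel)"
proof -
  have "(\<integral>\<^sup>+x. F x \<partial>lborel) = (\<integral>\<^sup>+p. F (case p of (s, t) \<Rightarrow> pt i s t) \<partial>(lborel \<Otimes>\<^sub>M lborel))"
    by (subst lborel_pt[of i], subst nn_integral_distr) auto
  also have "\<dots> = (\<integral>\<^sup>+t. \<integral>\<^sup>+s. F (pt i s t) \<partial>lborel \<partial>lborel)"
    by (subst lborel_pair.nn_integral_snd[symmetric]) auto
  finally show ?thesis .
qed

lemma integral_pt:
  fixes F :: "real^2 \<Rightarrow> real"
  assumes F: "integrable lborel F"
  shows "(LINT x|lborel. F x) = (LINT t|lborel. LINT s|lborel. F (pt i s t))"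
proof -
  have [measurable]: "F \<in> borel_measurable borel" using F by auto
  have *: "integrable (lborel \<Otimes>\<^sub>M lborel) (\<lambda>p. F (case p of (s, t) \<Rightarrow> pt i s t))"
    using F by (subst (asm) lborel_pt[of i], subst (asm) integrable_distr_eq) auto
  have "(LINT x|lborel. F x) = (LINT p|(lborel \<Otimes>\<^sub>M lborel). F (case p of (s, t) \<Rightarrow> pt i s t))"
    by (subst lborel_pt[of i], subst integral_distr) auto
  also have "\<dots> = (LINT t|lborel. LINT s|lborel. F (pt i s t))"
    using lborel_pair.integral_snd[of "\<lambda>s t. F (pt i s t)"] * by (simp add: case_prod_beta')
  finally show ?thesis .
qed

lemma has_real_derivative_pt:
  assumes "smooth (g :: real^2 \<Rightarrow> real)"
  shows "((\<lambda>s. g (pt i s t)) has_real_derivative pderiv_at i g (pt i s t)) (at s)"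
proof -
  let ?D = "frechet_derivative g (at (pt i s t))"
  have g: "(g has_derivative ?D) (at (pt i s t))"
    using assms by (rule smooth_imp_has_derivative)
  have "((\<lambda>s. pt i s t) has_derivative (\<lambda>h. h *\<^sub>R axis i 1)) (at s)"
    by (subst pt_eq) (auto intro!: derivative_eq_intros)
  from has_derivative_compose[OF this g]
  have "((\<lambda>s. g (pt i s t)) has_derivative (\<lambda>h. ?D (h *\<^sub>R axis i 1))) (at s)" .
  moreover have "?D (h *\<^sub>R axis i 1) = pderiv_at i g (pt i s t) * h" for h
    using linear_scale[OF has_derivative_linear[OF g]] by (simp add: pderiv_at_def)
  ultimately show ?thesis by (simp add: has_field_derivative_def)
qed

lemma continuous_on_pt_fst: "continuous_on UNIV g \<Longrightarrow> continuous_on A (\<lambda>s. g (pt i s t))"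
  by (rule continuous_on_compose2[of UNIV g], assumption, subst pt_eq) (auto intro!: continuous_intros)

lemma integral_lebesgue_on_eq_lborel:
  fixes F :: "'a::euclidean_space \<Rightarrow> 'b::{banach, second_countable_topology}"
  assumes [measurable]: "F \<in> borel_measurable borel" "A \<in> sets borel"
  shows "(LINT x|lebesgue_on A. F x) = (LINT x|lborel. indicator A x *\<^sub>R F x)"
  by (simp add: integral_restrict_space integral_completion)

lemma integrable_continuous_box:
  fixes F :: "real^2 \<Rightarrow> 'b::{banach, second_countable_topology}"
  assumes F: "continuous_on UNIV F"
  shows "integrable lborel (\<lambda>x. indicator (box lo hi) x *\<^sub>R F x)"
proof -
  have [measurable]: "F \<in> borel_measurable borel" using F by (rule borel_measurable_continuous_onI)
  have "integrable lborel (\<lambda>x. indicator (cbox lo hi) x *\<^sub>R F x)"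
    using continuous_on_subset[OF F] by (intro borel_integrable_compact) auto
  then show ?thesis
    by (rule Bochner_Integration.integrable_bound)
      (use box_subset_cbox[of lo hi] in \<open>auto simp: indicator_def intro!: AE_I2\<close>)
qed

text \<open>Fubini with the inner integral in direction \<open>i\<close>, and the fundamental
  theorem of calculus on each line. Equality on opposite faces covers periodic functions and
  functions vanishing on the faces alike.\<close>

lemma integral_pderiv_box_eq_0:
  fixes \<psi> :: "real^2 \<Rightarrow> real"
  assumes \<psi>: "smooth \<psi>" and le: "\<And>k. lo $ k \<le> hi $ k"
    and faces: "\<And>t. \<psi> (pt i (lo $ i) t) = \<psi> (pt i (hi $ i) t)"
  shows "(LINT x|lebesgue_on (box lo hi). pderiv_at i \<psi> x) = 0"
proof -
  obtain j where j: "j \<noteq> i" by (rule two_other)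
  let ?g = "pderiv_at i \<psi>"
  have cont: "continuous_on UNIV ?g"
    by (intro smooth_imp_continuous_on smooth_pderiv_at \<psi>)
  then have [measurable]: "?g \<in> borel_measurable borel" by (rule borel_measurable_continuous_onI)
  have inner: "(LINT s|lborel. indicator (box lo hi) (pt i s t) *\<^sub>R ?g (pt i s t)) = 0" for t
  proof (cases "lo $ j < t \<and> t < hi $ j")
    case True
    have [measurable]: "(\<lambda>s. ?g (pt i s t)) \<in> borel_measurable borel"
      by (rule borel_measurable_continuous_onI[OF continuous_on_pt_fst[OF cont]])
    have "indicator (box lo hi) (pt i s t) = (indicator {lo $ i<..<hi $ i} s :: real)" for s
      using True j by (auto simp: mem_box_cart pt_def indicator_def two_all[OF j])
    then have "(LINT s|lborel. indicator (box lo hi) (pt i s t) *\<^sub>R ?g (pt i s t)) =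
        (LINT s|lborel. indicator {lo $ i<..<hi $ i} s *\<^sub>R ?g (pt i s t))" by simp
    also have "\<dots> = (LINT s|lborel. indicator {lo $ i..hi $ i} s *\<^sub>R ?g (pt i s t))"
    proof (rule integral_cong_AE)
      show "AE s in lborel. indicator {lo $ i<..<hi $ i} s *\<^sub>R ?g (pt i s t) =
          indicator {lo $ i..hi $ i} s *\<^sub>R ?g (pt i s t)"
        using AE_lborel_singleton[of "lo $ i"] AE_lborel_singleton[of "hi $ i"]
        by eventually_elim (auto simp: indicator_def)
    qed auto
    also have "\<dots> = \<psi> (pt i (hi $ i) t) - \<psi> (pt i (lo $ i) t)"
      using has_real_derivative_pt[OF \<psi>] le
      by (intro integral_FTC_atLeastAtMost continuous_on_pt_fst cont)
        (auto simp flip: has_real_derivative_iff_has_vector_derivative intro: DERIV_subset)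
    finally show ?thesis using faces by simp
  next
    case False
    then have "pt i s t \<notin> box lo hi" for s
      using j by (auto simp: mem_box_cart pt_def intro!: exI[of _ j])
    then show ?thesis by simp
  qed
  have "(LINT x|lebesgue_on (box lo hi). ?g x) = (LINT x|lborel. indicator (box lo hi) x *\<^sub>R ?g x)"
    by (rule integral_lebesgue_on_eq_lborel) auto
  also have "\<dots> = (LINT t|lborel. LINT s|lborel. indicator (box lo hi) (pt i s t) *\<^sub>R ?g (pt i s t))"
    by (rule integral_pt[OF integrable_continuous_box[OF cont]])
  also have "\<dots> = 0" by (simp only: inner) simp
  finally show ?thesis .
qed

text \<open>\<open>\<phi> s\<close> exceeds \<open>\<phi> r\<close> by at most the integral of
  \<open>\<bar>\<phi>'\<bar>\<close>. Averaging this over \<open>r\<close> gives the bound, written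
  as one integral so that it can be integrated once more over the other coordinate.\<close>

lemma le_integral_average_plus_variation:
  fixes \<phi> \<phi>' :: "real \<Rightarrow> real"
  assumes ab: "a < b" and s: "s \<in> {a..b}"
    and der: "\<And>x. (\<phi> has_real_derivative \<phi>' x) (at x)" and cont: "continuous_on UNIV \<phi>'"
  shows "\<phi> s \<le> integral {a..b} (\<lambda>r. \<phi> r / (b - a) + \<bar>\<phi>' r\<bar>)"
proof -
  define D where "D = integral {a..b} (\<lambda>r. \<bar>\<phi>' r\<bar>)"
  have int: "(\<lambda>r. \<bar>\<phi>' r\<bar>) integrable_on {c..d}" "\<phi>' integrable_on {c..d}" for c d
    by (intro integrable_continuous_real continuous_intros continuous_on_subset[OF cont] subset_UNIV)+
  have cont\<phi>: "continuous_on A \<phi>" for A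
    using der DERIV_isCont by (blast intro: continuous_at_imp_continuous_on)
  have *: "\<bar>\<phi> d - \<phi> c\<bar> \<le> D" if "a \<le> c" "c \<le> d" "d \<le> b" for c d
  proof -
    have "(\<phi>' has_integral (\<phi> d - \<phi> c)) {c..d}"
      using that(2) der
      by (intro fundamental_theorem_of_calculus)
        (auto simp flip: has_real_derivative_iff_has_vector_derivative intro: DERIV_subset)
    then have "\<bar>\<phi> d - \<phi> c\<bar> = \<bar>integral {c..d} \<phi>'\<bar>" by (simp add: integral_unique)
    also have "\<dots> \<le> integral {c..d} (\<lambda>r. \<bar>\<phi>' r\<bar>)"
      using integral_norm_bound_integral[of \<phi>' "{c..d}" "\<lambda>r. \<bar>\<phi>' r\<bar>"] int by auto
    also have "\<dots> \<le> D"
      unfolding D_def using that int by (intro integral_subset_le) auto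
    finally show ?thesis .
  qed
  have "\<phi> s \<le> \<phi> r + D" if "r \<in> {a..b}" for r
    using *[of s r] *[of r s] s that by (cases "s \<le> r") auto
  then have "integral {a..b} (\<lambda>r. \<phi> s) \<le> integral {a..b} (\<lambda>r. \<phi> r + D)"
    by (intro integral_le integrable_continuous_real continuous_intros cont\<phi>)
  also have "\<dots> = integral {a..b} \<phi> + (b - a) * D"
    using ab by (subst integral_add) (auto intro!: integrable_continuous_real cont\<phi>)
  finally have "\<phi> s \<le> integral {a..b} \<phi> / (b - a) + D"
    using ab by (simp add: field_simps)
  also have "\<dots> = integral {a..b} (\<lambda>r. \<phi> r / (b - a)) + D" by simp
  also have "\<dots> = integral {a..b} (\<lambda>r. \<phi> r / (b - a) + \<bar>\<phi>' r\<bar>)"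
    unfolding D_def using ab
    by (intro integral_add[symmetric] int integrable_continuous_real continuous_intros cont\<phi>) auto
  finally show ?thesis .
qed

text \<open>
  Ladyzhenskaya's argument: \<open>g\<close> is bounded on each coordinate line by its average plus its variation
  there, and the product of the two bounds separates the variables.
\<close>

lemma nn_integral_square_box_le:
  fixes g :: "real^2 \<Rightarrow> real"
  assumes g: "smooth g" and nonneg: "\<And>x. 0 \<le> g x" and less: "\<And>k. lo $ k < hi $ k"
  defines "K \<equiv> \<lambda>i. \<integral>\<^sup>+x. ennreal (g x / (hi $ i - lo $ i) + \<bar>pderiv_at i g x\<bar>) * indicator (box lo hi) x \<partial>lborel"
  shows "(\<integral>\<^sup>+x. ennreal ((g x)\<^sup>2) * indicator (box lo hi) x \<partial>lborel) \<le> K 1 * K 2"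
proof -
  define F where "F i x = ennreal (g x / (hi $ i - lo $ i) + \<bar>pderiv_at i g x\<bar>) * indicator (box lo hi) x" for i x
  define A where "A i t = (\<integral>\<^sup>+s. F i (pt i s t) \<partial>lborel)" for i t
  have cg: "continuous_on UNIV g" by (intro smooth_imp_continuous_on g)
  have cd: "continuous_on UNIV (pderiv_at i g)" for i by (intro smooth_imp_continuous_on smooth_pderiv_at g)
  have [measurable]: "g \<in> borel_measurable borel" "pderiv_at i g \<in> borel_measurable borel" for i
    using cg cd by (auto intro: borel_measurable_continuous_onI)
  have F[measurable]: "F i \<in> borel_measurable borel" for i
    unfolding F_def[abs_def] by measurable
  have [measurable]: "A i \<in> borel_measurable lborel" for i
    unfolding A_def[abs_def]
  proof (rule lborel.borel_measurable_nn_integral)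
    have "(\<lambda>p. F i ((\<lambda>(s, t). pt i s t) (snd p, fst p))) \<in> borel_measurable (lborel \<Otimes>\<^sub>M lborel)"
      by measurable
    then show "(\<lambda>(x, y). F i (pt i y x)) \<in> borel_measurable (lborel \<Otimes>\<^sub>M lborel)"
      by (simp add: case_prod_beta)
  qed
  have K: "K i = (\<integral>\<^sup>+t. A i t \<partial>lborel)" for i
    unfolding K_def A_def using nn_integral_pt[OF F, of i i] by (simp add: F_def)
  have gA: "ennreal (g (pt i s t)) \<le> A i t" if box: "pt i s t \<in> box lo hi" for i s t
  proof -
    obtain j where j: "j \<noteq> i" by (rule two_other)
    define f where "f s = g (pt i s t) / (hi $ i - lo $ i) + \<bar>pderiv_at i g (pt i s t)\<bar>" for s
    have t: "lo $ j < t" "t < hi $ j" and s: "s \<in> {lo $ i..hi $ i}"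
      using box j by (auto simp: mem_box_cart pt_def two_all[OF j])
    have cf: "continuous_on X f" for X
      unfolding f_def using less[of i]
      by (intro continuous_intros continuous_on_pt_fst cg cd) auto
    have F: "F i (pt i r t) = ennreal (f r) * indicator {lo $ i<..<hi $ i} r" for r
    proof -
      have "pt i r t \<in> box lo hi \<longleftrightarrow> r \<in> {lo $ i<..<hi $ i}"
        using t j by (auto simp: mem_box_cart pt_def two_all[OF j])
      then show ?thesis by (simp add: F_def f_def indicator_def)
    qed
    have "g (pt i s t) \<le> integral {lo $ i..hi $ i} f"
      unfolding f_def
      by (rule le_integral_average_plus_variation[OF less s has_real_derivative_pt[OF g] continuous_on_pt_fst[OF cd]])
    moreover have "A i t = ennreal (integral {lo $ i..hi $ i} f)"
      unfolding A_def F
    proof (rule nn_integral_has_integral_lebesgue')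
      have "f integrable_on {lo $ i..hi $ i}" by (intro integrable_continuous_real cf)
      then show "(f has_integral integral {lo $ i..hi $ i} f) {lo $ i<..<hi $ i}"
        by (simp add: has_integral_Icc_iff_Ioo[symmetric] integrable_integral)
    qed (use nonneg less[of i] in \<open>auto simp: f_def intro!: add_nonneg_nonneg divide_nonneg_pos\<close>)
    ultimately show ?thesis by (simp add: ennreal_leI)
  qed
  have "(\<integral>\<^sup>+x. ennreal ((g x)\<^sup>2) * indicator (box lo hi) x \<partial>lborel) =
      (\<integral>\<^sup>+t. \<integral>\<^sup>+s. ennreal ((g (pt 1 s t))\<^sup>2) * indicator (box lo hi) (pt 1 s t) \<partial>lborel \<partial>lborel)"
    by (rule nn_integral_pt) measurable
  also have "\<dots> \<le> (\<integral>\<^sup>+t. \<integral>\<^sup>+s. A 1 t * A 2 s \<partial>lborel \<partial>lborel)"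
  proof (intro nn_integral_mono)
    fix t s
    show "ennreal ((g (pt 1 s t))\<^sup>2) * indicator (box lo hi) (pt 1 s t) \<le> A 1 t * A 2 s"
    proof (cases "pt 1 s t \<in> box lo hi")
      case True
      have "ennreal ((g (pt 1 s t))\<^sup>2) = ennreal (g (pt 1 s t)) * ennreal (g (pt 2 t s))"
        using nonneg by (simp add: power2_eq_square ennreal_mult pt_swap)
      also have "\<dots> \<le> A 1 t * A 2 s"
        using True by (intro mult_mono gA) (auto simp: pt_swap)
      finally show ?thesis using True by simp
    qed simp
  qed
  also have "\<dots> = (\<integral>\<^sup>+t. A 1 t \<partial>lborel) * (\<integral>\<^sup>+s. A 2 s \<partial>lborel)"
    by (simp add: nn_integral_cmult nn_integral_multc)
  finally show ?thesis by (simp add: K)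
qed

subsection \<open>The fundamental lemma of the calculus of variations\<close>

lemma sigma_finite_lebesgue: "sigma_finite_measure (lebesgue :: 'a::euclidean_space measure)"
proof
  let ?Q = "\<lambda>n::nat. box (- (real n *\<^sub>R One)) (real n *\<^sub>R One :: 'a)"
  show "\<exists>A. countable A \<and> A \<subseteq> sets (lebesgue :: 'a measure) \<and> \<Union> A = space lebesgue \<and> (\<forall>a\<in>A. emeasure lebesgue a \<noteq> \<infinity>)"
    by (rule exI[of _ "range ?Q"]) (auto simp: UN_box_eq_UNIV)
qed

text \<open>Boxes are stable under intersection, so a Dynkin class argument carries the vanishing of
  integrals from boxes to Borel sets. Lebesgue sets differ from Borel sets by null sets.\<close>

lemma AE_eq_0_of_box_integrals:
  fixes f :: "'a::euclidean_space \<Rightarrow> 'b::{banach, second_countable_topology}"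
  assumes f: "integrable lebesgue f"
    and box: "\<And>a b. (LINT x|lebesgue. indicator (box a b) x *\<^sub>R f x) = 0"
  shows "AE x in lebesgue. f x = 0"
proof (rule sigma_finite_measure.density_zero[OF sigma_finite_lebesgue f])
  have [measurable]: "f \<in> borel_measurable lebesgue" using f by auto
  have int: "integrable lebesgue (\<lambda>x. indicator A x *\<^sub>R f x)" if "A \<in> sets lebesgue" for A
    using f that by (rule integrable_mult_indicator[rotated])
  define E where "E = range (\<lambda>(a, b). box a b :: 'a set)"
  have E: "sigma_sets UNIV E = sets borel" by (simp add: E_def borel_eq_box)
  have stable: "Int_stable E" by (auto simp: E_def Int_stable_def box_Int_box)
  have subset_Pow: "E \<subseteq> Pow UNIV" by simp
  \<comment> \<open>Complements in the induction over generated sets require the integral over the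
    whole space, which is not a box but an increasing union of boxes.\<close>
  have whole: "(LINT x|lebesgue. f x) = 0"
  proof -
    define Q where "Q n = box (- (real n *\<^sub>R One)) (real n *\<^sub>R One :: 'a)" for n
    have "(\<lambda>n. LINT x|lebesgue. indicator (Q n) x *\<^sub>R f x) \<longlonglongrightarrow> (LINT x|lebesgue. f x)"
    proof (rule integral_dominated_convergence[where w = "\<lambda>x. norm (f x)"])
      show "AE x in lebesgue. (\<lambda>n. indicator (Q n) x *\<^sub>R f x) \<longlonglongrightarrow> f x"
      proof (intro AE_I2 tendsto_eventually)
        fix x :: 'a
        have "x \<in> (\<Union>n. Q n)" unfolding Q_def UN_box_eq_UNIV by simp
        then obtain m where m: "x \<in> Q m" by blast
        have "Q m \<subseteq> Q n" if "m \<le> n" for n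
          unfolding Q_def using that by (intro subset_box_imp) auto
        then have "x \<in> Q n" if "m \<le> n" for n using m that by blast
        then show "\<forall>\<^sub>F n in sequentially. indicator (Q n) x *\<^sub>R f x = f x"
          by (auto simp: eventually_sequentially intro!: exI[of _ m])
      qed
      show "(\<lambda>x. indicator (Q i) x *\<^sub>R f x) \<in> borel_measurable lebesgue" for i
        unfolding Q_def using int[of "box (- (real i *\<^sub>R One)) (real i *\<^sub>R One :: 'a)"] by auto
    qed (use f in \<open>auto simp: indicator_def\<close>)
    then show ?thesis by (simp add: Q_def box LIMSEQ_const_iff)
  qed
  have borel: "(LINT x|lebesgue. indicator A x *\<^sub>R f x) = 0" if "A \<in> sets borel" for A
    using stable subset_Pow that[folded E]
  proof (induction rule: sigma_sets_induct_disjoint)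
    case (basic A)
    then show ?case using box by (auto simp: E_def)
  next
    case (compl A)
    have "(\<lambda>x. indicator (UNIV - A) x *\<^sub>R f x) = (\<lambda>x. f x - indicator A x *\<^sub>R f x)"
      by (auto simp: indicator_def)
    moreover have "A \<in> sets lebesgue" using compl by (simp add: E)
    ultimately show ?case
      using f int compl whole by simp
  next
    case (union A)
    then have A': "A i \<in> sets lebesgue" for i by (auto simp: E)
    have "(LINT x:(\<Union>i. A i)|lebesgue. f x) = suminf (\<lambda>i. LINT x:(A i)|lebesgue. f x)"
      using A' union(1) int[of "\<Union>i. A i"]
      by (intro lebesgue_integral_countable_add) (auto simp: disjoint_family_on_def set_integrable_def)
    then show ?case using union(3) by (simp add: set_lebesgue_integral_def)
  qed simp
  fix A :: "'a set" assume "A \<in> sets lebesgue"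
  then obtain T N N' where A: "A = T \<union> N" "N \<subseteq> N'" "N' \<in> null_sets lborel" "T \<in> sets lborel"
    by (rule sets_completionE)
  have "AE x in lebesgue. x \<notin> N'"
    using A(3) by (intro AE_not_in null_sets_completionI)
  then have "AE x in lebesgue. indicator A x *\<^sub>R f x = indicator T x *\<^sub>R f x"
    using A(1,2) by (auto simp: indicator_def elim!: eventually_mono)
  then have "(LINT x|lebesgue. indicator A x *\<^sub>R f x) = (LINT x|lebesgue. indicator T x *\<^sub>R f x)"
    using int[OF \<open>A \<in> sets lebesgue\<close>] int[of T] A(4) by (intro integral_cong_AE) auto
  then show "set_lebesgue_integral lebesgue A f = 0"
    using borel[of T] A(4) by (simp add: set_lebesgue_integral_def)
qed

text \<open>Bumps converge boundedly to the indicator of a box, so \<open>g\<close> integrates to 0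
  over every box whose closed box lies in \<open>\<Omega>\<close>. Hence \<open>g\<close> vanishes
  almost everywhere on each such closed box, and countably many of these cover
  \<open>\<Omega>\<close>.\<close>

lemma fundamental_lemma_calculus_of_variations:
  fixes g :: "real^2 \<Rightarrow> 'b::{banach, second_countable_topology}"
  assumes \<Omega>: "open \<Omega>" and g: "integrable (lebesgue_on \<Omega>) g"
    and test: "\<And>\<phi>. \<phi> \<in> test_functions \<Omega> \<Longrightarrow> (LINT x|lebesgue_on \<Omega>. \<phi> x *\<^sub>R g x) = 0"
  shows "AE x in lebesgue_on \<Omega>. g x = 0"
proof -
  have \<Omega>s: "\<Omega> \<in> sets lebesgue" using \<Omega> by auto
  have [measurable]: "g \<in> borel_measurable (lebesgue_on \<Omega>)" using g by auto
  have box: "(LINT x|lebesgue_on \<Omega>. indicator (box a b) x *\<^sub>R g x) = 0" if "cbox a b \<subseteq> \<Omega>" for a b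
  proof -
    have [measurable]: "box_bump (1 / Suc n) a b \<in> borel_measurable borel" for n
      by (intro borel_measurable_continuous_onI smooth_imp_continuous_on smooth_box_bump) auto
    then have [measurable]: "box_bump (1 / Suc n) a b \<in> borel_measurable (lebesgue_on \<Omega>)" for n
      by (intro measurable_restrict_space1 measurable_completion) auto
    have [measurable]: "(indicator (box a b) :: real^2 \<Rightarrow> real) \<in> borel_measurable (lebesgue_on \<Omega>)"
      by (intro measurable_restrict_space1 measurable_completion) auto
    have "(\<lambda>n. LINT x|lebesgue_on \<Omega>. box_bump (1 / Suc n) a b x *\<^sub>R g x) \<longlonglongrightarrow>
        (LINT x|lebesgue_on \<Omega>. indicator (box a b) x *\<^sub>R g x)"
    proof (rule integral_dominated_convergence[where w = "\<lambda>x. norm (g x)"])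
      show "AE x in lebesgue_on \<Omega>. (\<lambda>n. box_bump (1 / Suc n) a b x *\<^sub>R g x) \<longlonglongrightarrow> indicator (box a b) x *\<^sub>R g x"
        by (intro AE_I2 tendsto_scaleR tendsto_const box_bump_tendsto_indicator)
      show "AE x in lebesgue_on \<Omega>. norm (box_bump (1 / Suc n) a b x *\<^sub>R g x) \<le> norm (g x)" for n
        using box_bump_bounds[of "1 / Suc n" a b]
        by (intro AE_I2) (auto intro!: mult_left_le_one_le)
      show "(\<lambda>x. indicator (box a b) x *\<^sub>R g x) \<in> borel_measurable (lebesgue_on \<Omega>)"
        by measurable
      show "(\<lambda>x. box_bump (1 / Suc n) a b x *\<^sub>R g x) \<in> borel_measurable (lebesgue_on \<Omega>)" for n
        by measurable
    qed (use g in auto)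
    moreover have "(LINT x|lebesgue_on \<Omega>. box_bump (1 / Suc n) a b x *\<^sub>R g x) = 0" for n
      by (intro test box_bump_test_function that) auto
    ultimately show ?thesis by (simp add: LIMSEQ_const_iff)
  qed
  have cbox: "AE x in lebesgue. x \<in> cbox a b \<longrightarrow> g x = 0" if ab: "cbox a b \<subseteq> \<Omega>" for a b
  proof -
    have box\<Omega>: "box a b \<subseteq> \<Omega>" using ab box_subset_cbox[of a b] by (rule order.trans[rotated])
    have "integrable lebesgue (\<lambda>x. indicator \<Omega> x *\<^sub>R g x)"
      using g integrable_restrict_space[of \<Omega> lebesgue g] \<Omega>s by simp
    then have "integrable lebesgue (\<lambda>x. indicator (box a b) x *\<^sub>R indicator \<Omega> x *\<^sub>R g x)"
      by (rule integrable_mult_indicator[rotated]) simp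
    moreover have "indicator (box a b) x *\<^sub>R indicator \<Omega> x *\<^sub>R g x = indicator (box a b) x *\<^sub>R g x" for x
      using subsetD[OF box\<Omega>, of x] by (cases "x \<in> box a b") (simp_all add: indicator_def)
    ultimately have int: "integrable lebesgue (\<lambda>x. indicator (box a b) x *\<^sub>R g x)"
      by (simp only:)
    have "AE x in lebesgue. indicator (box a b) x *\<^sub>R g x = 0"
    proof (rule AE_eq_0_of_box_integrals[OF int])
      fix c d :: "real^2"
      obtain p q where pq: "box a b \<inter> box c d = box p q" unfolding box_Int_box by blast
      \<comment> \<open>A nonempty box has \<open>cbox p q\<close> as its closure. If the
        intersection is empty, its corners may lie far from \<open>\<Omega>\<close>, but the
        integral over it is 0 anyway.\<close>
      have "cbox p q \<subseteq> \<Omega>" if "box p q \<noteq> {}"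
      proof -
        have "closure (box p q) \<subseteq> cbox a b"
          using pq box_subset_cbox[of a b] by (intro closure_minimal) auto
        then show ?thesis using ab closure_box[OF that] by simp
      qed
      moreover have "(LINT x|lebesgue. indicator (box c d) x *\<^sub>R indicator (box a b) x *\<^sub>R g x) =
          (LINT x|lebesgue_on \<Omega>. indicator (box p q) x *\<^sub>R g x)"
        using \<Omega>s box\<Omega> unfolding pq[symmetric]
        by (subst integral_restrict_space) (auto simp: indicator_def intro!: Bochner_Integration.integral_cong)
      ultimately show "(LINT x|lebesgue. indicator (box c d) x *\<^sub>R indicator (box a b) x *\<^sub>R g x) = 0"
        using box[of p q] by (cases "box p q = {}") auto
    qed
    moreover have "AE x in lebesgue. x \<notin> cbox a b - box a b"
      using negligible_frontier_interval[of a b] by (intro AE_not_in) (simp add: negligible_iff_null_sets)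
    ultimately show ?thesis
      by eventually_elim (auto simp: indicator_def split: if_splits)
  qed
  obtain \<D> where \<D>: "countable \<D>" "\<D> \<subseteq> Pow \<Omega>" "\<And>X. X \<in> \<D> \<Longrightarrow> \<exists>a b. X = cbox a b" "\<Union>\<D> = \<Omega>"
    using open_countable_Union_open_cbox[OF \<Omega>] by metis
  have "AE x in lebesgue. \<forall>X\<in>\<D>. x \<in> X \<longrightarrow> g x = 0"
    using \<D>(1) by (subst AE_ball_countable) (use \<D>(2,3) cbox in blast)+
  then have "AE x in lebesgue. x \<in> \<Omega> \<longrightarrow> g x = 0"
    by eventually_elim (use \<D>(4) in blast)
  then show ?thesis using \<Omega>s by (simp add: AE_restrict_space_iff)
qed

subsection \<open>Square integrable fields and weak derivatives on a bounded domain\<close>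

lemma integral_Cauchy_Schwarz:
  fixes f g :: "'a \<Rightarrow> real"
  assumes [measurable]: "f \<in> borel_measurable M" "g \<in> borel_measurable M"
    and f: "integrable M (\<lambda>x. (f x)\<^sup>2)" and g: "integrable M (\<lambda>x. (g x)\<^sup>2)"
  shows "integrable M (\<lambda>x. f x * g x)"
    and "\<bar>LINT x|M. f x * g x\<bar> \<le> sqrt (LINT x|M. (f x)\<^sup>2) * sqrt (LINT x|M. (g x)\<^sup>2)"
proof -
  have fg: "integrable M (\<lambda>x. f x * g x)"
  proof (rule Bochner_Integration.integrable_bound)
    show "integrable M (\<lambda>x. (f x)\<^sup>2 + (g x)\<^sup>2)" using f g by simp
    show "AE x in M. norm (f x * g x) \<le> norm ((f x)\<^sup>2 + (g x)\<^sup>2)"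
    proof (intro AE_I2)
      fix x
      have "2 * (\<bar>f x\<bar> * \<bar>g x\<bar>) \<le> (f x)\<^sup>2 + (g x)\<^sup>2"
        using sum_squares_bound[of "\<bar>f x\<bar>" "\<bar>g x\<bar>"] by simp
      moreover have "0 \<le> \<bar>f x\<bar> * \<bar>g x\<bar>" by simp
      ultimately have "\<bar>f x\<bar> * \<bar>g x\<bar> \<le> (f x)\<^sup>2 + (g x)\<^sup>2" by linarith
      then show "norm (f x * g x) \<le> norm ((f x)\<^sup>2 + (g x)\<^sup>2)"
        by (simp add: abs_mult)
    qed
  qed simp
  then show "integrable M (\<lambda>x. f x * g x)" .
  define a b c where "a = (LINT x|M. (f x)\<^sup>2)" and "b = (LINT x|M. f x * g x)" and "c = (LINT x|M. (g x)\<^sup>2)"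
  have q: "0 \<le> a * t\<^sup>2 + 2 * b * t * s + c * s\<^sup>2" for t s
  proof -
    have "0 \<le> (LINT x|M. (t * f x + s * g x)\<^sup>2)" by simp
    also have "\<dots> = (LINT x|M. t\<^sup>2 * (f x)\<^sup>2 + (2 * t * s) * (f x * g x) + s\<^sup>2 * (g x)\<^sup>2)"
      by (intro Bochner_Integration.integral_cong) (auto simp: power2_eq_square algebra_simps)
    also have "\<dots> = t\<^sup>2 * a + (2 * t * s) * b + s\<^sup>2 * c"
      using f g fg by (simp add: a_def b_def c_def)
    finally show ?thesis by (simp add: algebra_simps)
  qed
  have "b\<^sup>2 \<le> a * c"
  proof (cases "a = 0")
    case True
    have "0 \<le> c" by (simp add: c_def)
    \<comment> \<open>For a = 0 the form at t = -(c + 1), s = b equals -(c + 2) b^2 with c + 2 > 0,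
      which forces b = 0.\<close>
    have "0 \<le> 2 * b * (- (c + 1) * b) + c * b\<^sup>2 "
      using q[of "- (c + 1)" b] True by (simp add: power2_eq_square algebra_simps)
    then have "(c + 2) * b\<^sup>2 \<le> 0" by (simp add: power2_eq_square algebra_simps)
    then show ?thesis using True \<open>0 \<le> c\<close> by (simp add: mult_le_0_iff)
  next
    case False
    moreover have "0 \<le> a" by (simp add: a_def)
    ultimately have a: "a > 0" by simp
    \<comment> \<open>At t = -b, s = a the form factors as a (a c - b^2).\<close>
    have "0 \<le> a * b\<^sup>2 + 2 * b * (-b) * a + c * a\<^sup>2"
      using q[of "- b" a] by simp
    then have "0 \<le> a * (a * c - b\<^sup>2)" by (simp add: power2_eq_square algebra_simps)
    then show ?thesis using a by (simp add: zero_le_mult_iff)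
  qed
  then have "sqrt (b\<^sup>2) \<le> sqrt (a * c)" by (rule real_sqrt_le_mono)
  then show "\<bar>LINT x|M. f x * g x\<bar> \<le> sqrt (LINT x|M. (f x)\<^sup>2) * sqrt (LINT x|M. (g x)\<^sup>2)"
    by (simp add: a_def b_def c_def real_sqrt_mult)
qed

text \<open>Fatou's lemma yields integrability of the limit together with the bound. The bounds
  \<open>c n\<close> may vary because the L4 estimate along an approximating sequence involves H1
  norms that merely converge.\<close>

lemma integrable_Fatou:
  fixes f :: "nat \<Rightarrow> 'a \<Rightarrow> real"
  assumes f: "\<And>n. integrable M (f n)" "\<And>n x. 0 \<le> f n x"
    and [measurable]: "F \<in> borel_measurable M" and lim: "AE x in M. (\<lambda>n. f n x) \<longlonglongrightarrow> F x"
    and le: "\<And>n. (LINT x|M. f n x) \<le> c n" and c: "c \<longlonglongrightarrow> C"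
  shows "integrable M F" and "(LINT x|M. F x) \<le> C"
proof -
  have [measurable]: "f n \<in> borel_measurable M" for n using f(1) by auto
  have nonneg: "AE x in M. 0 \<le> F x"
    using lim by eventually_elim (rule LIMSEQ_le_const, use f(2) in auto)
  have c0: "0 \<le> c n" for n using le[of n] f(2) Bochner_Integration.integral_nonneg[of M "f n"] by (meson order.trans)
  have C0: "0 \<le> C" using c by (rule LIMSEQ_le_const) (use c0 in auto)
  have "(\<integral>\<^sup>+x. ennreal (F x) \<partial>M) = (\<integral>\<^sup>+x. liminf (\<lambda>n. ennreal (f n x)) \<partial>M)"
    using lim by (intro nn_integral_cong_AE, eventually_elim)
      (metis lim_imp_Liminf sequentially_bot tendsto_ennrealI)
  also have "\<dots> \<le> liminf (\<lambda>n. \<integral>\<^sup>+x. ennreal (f n x) \<partial>M)"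
    by (rule nn_integral_liminf) measurable
  also have "\<dots> \<le> liminf (\<lambda>n. ennreal (c n))"
    using le f by (intro Liminf_mono always_eventually allI) (simp add: nn_integral_eq_integral ennreal_leI)
  also have "\<dots> = ennreal C"
    by (intro lim_imp_Liminf tendsto_ennrealI c) simp
  finally have *: "(\<integral>\<^sup>+x. ennreal (F x) \<partial>M) \<le> ennreal C" .
  show "integrable M F"
    using * nonneg by (intro integrableI_nonneg) (auto simp: less_top[symmetric] top_unique)
  then show "(LINT x|M. F x) \<le> C"
    using * nonneg C0 by (simp add: nn_integral_eq_integral)
qed

text \<open>Both flow settings live on a bounded open set, and the theory of \<open>L2\<close> and
  of weak derivatives can be developed from that alone. The boundary conditions enter later, through
  the test fields.\<close>

locale bounded_domain =
  fixes \<Omega> :: "(real^2) set"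
  assumes \<Omega>_open: "open \<Omega>" and \<Omega>_bounded: "bounded \<Omega>"
begin

abbreviation "M \<equiv> lebesgue_on \<Omega>"

lemma \<Omega>_sets [measurable, simp]: "\<Omega> \<in> sets lebesgue" "\<Omega> \<in> sets borel"
  using \<Omega>_open by auto

lemma finite_M: "finite_measure M"
  using \<Omega>_bounded by (intro finite_measure_lebesgue_on lmeasurable_open \<Omega>_open)

lemma borel_imp_measurable: "f \<in> borel_measurable borel \<Longrightarrow> f \<in> borel_measurable M"
  by (intro measurable_restrict_space1 measurable_completion) auto

lemma continuous_imp_measurable:
  fixes f :: "real^2 \<Rightarrow> 'b::topological_space"
  shows "continuous_on UNIV f \<Longrightarrow> f \<in> borel_measurable M"
  by (intro borel_imp_measurable borel_measurable_continuous_onI)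

lemma continuous_imp_bounded:
  fixes f :: "real^2 \<Rightarrow> 'b::real_normed_vector"
  assumes "continuous_on UNIV f"
  obtains C where "C \<ge> 0" "\<And>x. x \<in> \<Omega> \<Longrightarrow> norm (f x) \<le> C"
proof -
  have "compact (f ` closure \<Omega>)"
    using assms \<Omega>_bounded by (intro compact_continuous_image) (auto intro: continuous_on_subset)
  then obtain C where C: "\<forall>x\<in>closure \<Omega>. norm (f x) \<le> C"
    by (auto dest!: compact_imp_bounded simp: bounded_iff)
  show ?thesis
  proof (rule that[of "max C 0"])
    show "norm (f x) \<le> max C 0" if "x \<in> \<Omega>" for x
      using C subsetD[OF closure_subset that] by fastforce
  qed simp
qed

lemma L2_measurable [measurable_dest]: "u \<in> L2 \<Omega> \<Longrightarrow> u \<in> borel_measurable M"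
  by (simp add: L2_def)

lemma L2_integrable: "u \<in> L2 \<Omega> \<Longrightarrow> integrable M (\<lambda>x. (norm (u x))\<^sup>2)"
  by (simp add: L2_def)

lemma L2_bounded:
  assumes "u \<in> borel_measurable M" "\<And>x. x \<in> \<Omega> \<Longrightarrow> norm (u x) \<le> C"
  shows "u \<in> L2 \<Omega>"
proof -
  interpret finite_measure M by (rule finite_M)
  have "integrable M (\<lambda>x. (norm (u x))\<^sup>2)"
    using assms by (intro integrable_const_bound[where B = "C\<^sup>2"] AE_I2) (auto intro: power_mono)
  then show ?thesis using assms by (simp add: L2_def)
qed

lemma continuous_imp_L2: "continuous_on UNIV u \<Longrightarrow> u \<in> L2 \<Omega>"
  by (metis L2_bounded continuous_imp_bounded continuous_imp_measurable)

lemma L2_norm_mult: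
  assumes "u \<in> L2 \<Omega>" "v \<in> L2 \<Omega>"
  shows "integrable M (\<lambda>x. norm (u x) * norm (v x))"
    and "(LINT x|M. norm (u x) * norm (v x)) \<le> l2_norm \<Omega> u * l2_norm \<Omega> v"
proof -
  have [measurable]: "u \<in> borel_measurable M" "v \<in> borel_measurable M" using assms by (auto simp: L2_def)
  show "integrable M (\<lambda>x. norm (u x) * norm (v x))"
    using assms by (intro integral_Cauchy_Schwarz(1)) (auto simp: L2_def)
  have "\<bar>LINT x|M. norm (u x) * norm (v x)\<bar> \<le> l2_norm \<Omega> u * l2_norm \<Omega> v"
    using assms unfolding l2_norm_def l2_inner_def power2_norm_eq_inner[symmetric]
    by (intro integral_Cauchy_Schwarz(2)) (auto simp: L2_def)
  then show "(LINT x|M. norm (u x) * norm (v x)) \<le> l2_norm \<Omega> u * l2_norm \<Omega> v" by simp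
qed

lemma L2_inner_integrable:
  assumes "u \<in> L2 \<Omega>" "v \<in> L2 \<Omega>"
  shows "integrable M (\<lambda>x. u x \<bullet> v x)"
proof -
  have [measurable]: "u \<in> borel_measurable M" "v \<in> borel_measurable M" using assms by (auto simp: L2_def)
  show ?thesis
    by (rule Bochner_Integration.integrable_bound[OF L2_norm_mult(1)[OF assms]])
      (auto intro!: AE_I2 Cauchy_Schwarz_ineq2)
qed

lemma L2_add:
  assumes "u \<in> L2 \<Omega>" "v \<in> L2 \<Omega>" shows "(\<lambda>x. u x + v x) \<in> L2 \<Omega>"
proof -
  have [measurable]: "u \<in> borel_measurable M" "v \<in> borel_measurable M" using assms by (auto simp: L2_def)
  have "integrable M (\<lambda>x. (norm (u x))\<^sup>2 + 2 * (u x \<bullet> v x) + (norm (v x))\<^sup>2)"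
    using assms L2_inner_integrable[OF assms] by (auto simp: L2_def)
  then have "integrable M (\<lambda>x. (norm (u x + v x))\<^sup>2)"
    by (simp add: power2_norm_eq_inner inner_add inner_commute algebra_simps)
  then show ?thesis by (simp add: L2_def)
qed

lemma L2_scaleR: "u \<in> L2 \<Omega> \<Longrightarrow> (\<lambda>x. c *\<^sub>R u x) \<in> L2 \<Omega>"
  by (auto simp: L2_def power_mult_distrib)

lemma L2_zero: "(\<lambda>x. 0) \<in> L2 \<Omega>"
  by (simp add: L2_def)

lemma L2_diff: "u \<in> L2 \<Omega> \<Longrightarrow> v \<in> L2 \<Omega> \<Longrightarrow> (\<lambda>x. u x - v x) \<in> L2 \<Omega>"
  using L2_add[of u "\<lambda>x. (-1) *\<^sub>R v x"] L2_scaleR[of v "-1"] by simp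

lemma L2_sum: "(\<And>i. i \<in> A \<Longrightarrow> u i \<in> L2 \<Omega>) \<Longrightarrow> (\<lambda>x. \<Sum>i\<in>A. u i x) \<in> L2 \<Omega>"
  by (induction A rule: infinite_finite_induct) (auto intro: L2_zero L2_add)

lemma L2_lincomb: "u \<in> L2 \<Omega> \<Longrightarrow> v \<in> L2 \<Omega> \<Longrightarrow> (\<lambda>x. a *\<^sub>R u x + b *\<^sub>R v x) \<in> L2 \<Omega>"
  by (intro L2_add L2_scaleR)

lemma l2_inner_commute: "l2_inner \<Omega> u v = l2_inner \<Omega> v u"
  by (simp add: l2_inner_def inner_commute)

lemma l2_inner_add_left:
  "u \<in> L2 \<Omega> \<Longrightarrow> v \<in> L2 \<Omega> \<Longrightarrow> w \<in> L2 \<Omega> \<Longrightarrow> l2_inner \<Omega> (\<lambda>x. u x + v x) w = l2_inner \<Omega> u w + l2_inner \<Omega> v w"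
  by (simp add: l2_inner_def inner_add_left L2_inner_integrable)

lemma l2_inner_scaleR_left: "l2_inner \<Omega> (\<lambda>x. c *\<^sub>R u x) w = c * l2_inner \<Omega> u w"
  by (simp add: l2_inner_def)

lemma l2_inner_minus_left: "l2_inner \<Omega> (\<lambda>x. - u x) w = - l2_inner \<Omega> u w"
  by (simp add: l2_inner_def)

lemma l2_inner_diff_left:
  "u \<in> L2 \<Omega> \<Longrightarrow> v \<in> L2 \<Omega> \<Longrightarrow> w \<in> L2 \<Omega> \<Longrightarrow> l2_inner \<Omega> (\<lambda>x. u x - v x) w = l2_inner \<Omega> u w - l2_inner \<Omega> v w"
  by (simp add: l2_inner_def inner_diff_left L2_inner_integrable)

lemma l2_inner_lincomb_left:
  "u \<in> L2 \<Omega> \<Longrightarrow> v \<in> L2 \<Omega> \<Longrightarrow> w \<in> L2 \<Omega> \<Longrightarrow>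
    l2_inner \<Omega> (\<lambda>x. a *\<^sub>R u x + b *\<^sub>R v x) w = a * l2_inner \<Omega> u w + b * l2_inner \<Omega> v w"
  by (simp add: l2_inner_add_left L2_scaleR l2_inner_scaleR_left)

lemma l2_inner_sum_left:
  "finite A \<Longrightarrow> (\<And>i. i \<in> A \<Longrightarrow> u i \<in> L2 \<Omega>) \<Longrightarrow> w \<in> L2 \<Omega> \<Longrightarrow>
    l2_inner \<Omega> (\<lambda>x. \<Sum>i\<in>A. c i *\<^sub>R u i x) w = (\<Sum>i\<in>A. c i * l2_inner \<Omega> (u i) w)"
  by (simp add: l2_inner_def inner_sum_left L2_inner_integrable)

lemma l2_inner_sum_right:
  "finite A \<Longrightarrow> (\<And>i. i \<in> A \<Longrightarrow> u i \<in> L2 \<Omega>) \<Longrightarrow> w \<in> L2 \<Omega> \<Longrightarrow>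
    l2_inner \<Omega> w (\<lambda>x. \<Sum>i\<in>A. c i *\<^sub>R u i x) = (\<Sum>i\<in>A. c i * l2_inner \<Omega> w (u i))"
  by (simp add: l2_inner_commute[of w] l2_inner_sum_left)

lemma l2_inner_add_right:
  "u \<in> L2 \<Omega> \<Longrightarrow> v \<in> L2 \<Omega> \<Longrightarrow> w \<in> L2 \<Omega> \<Longrightarrow> l2_inner \<Omega> w (\<lambda>x. u x + v x) = l2_inner \<Omega> w u + l2_inner \<Omega> w v"
  by (simp add: l2_inner_commute[of w] l2_inner_add_left)

lemma l2_inner_diff_right:
  "u \<in> L2 \<Omega> \<Longrightarrow> v \<in> L2 \<Omega> \<Longrightarrow> w \<in> L2 \<Omega> \<Longrightarrow> l2_inner \<Omega> w (\<lambda>x. u x - v x) = l2_inner \<Omega> w u - l2_inner \<Omega> w v"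
  by (simp add: l2_inner_commute[of w] l2_inner_diff_left)

lemma l2_inner_cong_AE:
  assumes [measurable_dest]: "u \<in> L2 \<Omega>" "u' \<in> L2 \<Omega>" "w \<in> L2 \<Omega>" and "AE x in M. u x = u' x"
  shows "l2_inner \<Omega> u w = l2_inner \<Omega> u' w"
proof -
  have [measurable]: "u \<in> borel_measurable M" "u' \<in> borel_measurable M" "w \<in> borel_measurable M"
    using assms by (auto simp: L2_def)
  show ?thesis
    unfolding l2_inner_def using assms(4) by (intro integral_cong_AE) auto
qed

lemma l2_norm_power2: "(l2_norm \<Omega> u)\<^sup>2 = l2_inner \<Omega> u u"
  by (simp add: l2_norm_def l2_inner_def)

lemma l2_norm_nonneg [simp]: "0 \<le> l2_norm \<Omega> u"
  by (simp add: l2_norm_def l2_inner_def)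

lemma l2_norm_square_integral: "(l2_norm \<Omega> u)\<^sup>2 = (LINT x|M. (norm (u x))\<^sup>2)"
  by (simp add: l2_norm_power2 l2_inner_def power2_norm_eq_inner)

lemma l2_norm_cong_AE:
  assumes "u \<in> L2 \<Omega>" "u' \<in> L2 \<Omega>" "AE x in M. u x = u' x"
  shows "l2_norm \<Omega> u = l2_norm \<Omega> u'"
  using l2_inner_cong_AE[OF assms(1,2,1,3)] l2_inner_cong_AE[OF assms(1,2,2,3)]
  by (simp add: l2_norm_def l2_inner_commute)

lemma l2_Cauchy_Schwarz:
  assumes "u \<in> L2 \<Omega>" "v \<in> L2 \<Omega>"
  shows "\<bar>l2_inner \<Omega> u v\<bar> \<le> l2_norm \<Omega> u * l2_norm \<Omega> v"
proof -
  have "\<bar>l2_inner \<Omega> u v\<bar> \<le> (LINT x|M. \<bar>u x \<bullet> v x\<bar>)"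
    unfolding l2_inner_def using integral_norm_bound[of M "\<lambda>x. u x \<bullet> v x"] by simp
  also have "\<dots> \<le> (LINT x|M. norm (u x) * norm (v x))"
    using L2_norm_mult(1)[OF assms] L2_inner_integrable[OF assms]
    by (intro integral_mono) (auto intro: Cauchy_Schwarz_ineq2)
  also have "\<dots> \<le> l2_norm \<Omega> u * l2_norm \<Omega> v" by (rule L2_norm_mult(2)[OF assms])
  finally show ?thesis .
qed

lemma l2_norm_triangle:
  assumes "u \<in> L2 \<Omega>" "v \<in> L2 \<Omega>"
  shows "l2_norm \<Omega> (\<lambda>x. u x + v x) \<le> l2_norm \<Omega> u + l2_norm \<Omega> v"
proof (rule power2_le_imp_le)
  have "(l2_norm \<Omega> (\<lambda>x. u x + v x))\<^sup>2 = l2_inner \<Omega> u u + 2 * l2_inner \<Omega> u v + l2_inner \<Omega> v v"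
    using assms by (simp add: l2_norm_power2 l2_inner_add_left l2_inner_add_right L2_add l2_inner_commute[of v u])
  also have "\<dots> \<le> (l2_norm \<Omega> u + l2_norm \<Omega> v)\<^sup>2"
    using l2_Cauchy_Schwarz[OF assms] by (simp add: power2_sum l2_norm_power2)
  finally show "(l2_norm \<Omega> (\<lambda>x. u x + v x))\<^sup>2 \<le> (l2_norm \<Omega> u + l2_norm \<Omega> v)\<^sup>2" .
qed simp

lemma l2_norm_scaleR: "l2_norm \<Omega> (\<lambda>x. c *\<^sub>R u x) = \<bar>c\<bar> * l2_norm \<Omega> u"
proof -
  have "l2_inner \<Omega> (\<lambda>x. c *\<^sub>R u x) (\<lambda>x. c *\<^sub>R u x) = c\<^sup>2 * l2_inner \<Omega> u u"
    by (simp add: l2_inner_def power2_eq_square mult.assoc)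
  then show ?thesis by (simp add: l2_norm_def real_sqrt_mult)
qed

lemma l2_norm_minus_commute: "l2_norm \<Omega> (\<lambda>x. u x - v x) = l2_norm \<Omega> (\<lambda>x. v x - u x)"
  using l2_norm_scaleR[of "-1" "\<lambda>x. u x - v x"] by simp

lemma l2_norm_diff_triangle:
  assumes "u \<in> L2 \<Omega>" "v \<in> L2 \<Omega>"
  shows "\<bar>l2_norm \<Omega> u - l2_norm \<Omega> v\<bar> \<le> l2_norm \<Omega> (\<lambda>x. u x - v x)"
  using l2_norm_triangle[OF L2_diff[OF assms] assms(2)] l2_norm_triangle[OF L2_diff[OF assms(2,1)] assms(1)]
    l2_norm_minus_commute[of u v] by simp

lemma l2_norm_eq_0_imp_AE:
  assumes "u \<in> L2 \<Omega>" "l2_norm \<Omega> u = 0" shows "AE x in M. u x = 0"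
proof -
  have "(LINT x|M. (norm (u x))\<^sup>2) = 0" using assms(2) l2_norm_square_integral[of u] by simp
  then show ?thesis using integral_nonneg_eq_0_iff_AE[OF L2_integrable[OF assms(1)]] by simp
qed

lemma L2_imp_integrable_norm:
  assumes "u \<in> L2 \<Omega>"
  shows "integrable M (\<lambda>x. norm (u x))"
    and "(LINT x|M. norm (u x)) \<le> sqrt (measure M \<Omega>) * l2_norm \<Omega> u"
proof -
  interpret finite_measure M by (rule finite_M)
  \<comment> \<open>A constant unit field stands in for the constant function 1, since the
    Cauchy-Schwarz inequality at hand is one for fields.\<close>
  have c: "(\<lambda>x. axis 1 1 :: real^2) \<in> L2 \<Omega>" by (rule continuous_imp_L2) auto
  have "l2_norm \<Omega> (\<lambda>x. axis 1 1 :: real^2) = sqrt (measure M \<Omega>)"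
    by (simp add: l2_norm_def l2_inner_def inner_axis)
  then show "integrable M (\<lambda>x. norm (u x))"
    and "(LINT x|M. norm (u x)) \<le> sqrt (measure M \<Omega>) * l2_norm \<Omega> u"
    using L2_norm_mult[OF c assms] by (auto simp: norm_axis_1)
qed

lemma L2_imp_integrable: "u \<in> L2 \<Omega> \<Longrightarrow> integrable M u"
  using L2_imp_integrable_norm(1) L2_measurable by (blast intro: integrable_norm_cancel)

lemma L2_mult_continuous:
  assumes "continuous_on UNIV \<phi>" "u \<in> L2 \<Omega>"
  shows "(\<lambda>x. \<phi> x *\<^sub>R u x) \<in> L2 \<Omega>"
proof -
  have [measurable]: "\<phi> \<in> borel_measurable M" "u \<in> borel_measurable M"
    using assms by (auto simp: L2_def intro: continuous_imp_measurable)
  obtain C where C: "C \<ge> 0" "\<And>x. x \<in> \<Omega> \<Longrightarrow> norm (\<phi> x) \<le> C" using continuous_imp_bounded[OF assms(1)] by blast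
  have "integrable M (\<lambda>x. (norm (\<phi> x *\<^sub>R u x))\<^sup>2)"
  proof (rule Bochner_Integration.integrable_bound)
    show "integrable M (\<lambda>x. C\<^sup>2 * (norm (u x))\<^sup>2)" using assms by (simp add: L2_def)
    show "AE x in M. norm ((norm (\<phi> x *\<^sub>R u x))\<^sup>2) \<le> norm (C\<^sup>2 * (norm (u x))\<^sup>2)"
      using C by (intro AE_I2) (auto simp: power_mult_distrib abs_le_square_iff[symmetric] intro!: mult_right_mono)
  qed measurable
  then show ?thesis by (simp add: L2_def)
qed

lemma L2_convergent_AE_subseq:
  assumes u: "\<And>n. u n \<in> L2 \<Omega>" and v: "v \<in> L2 \<Omega>"
    and lim: "(\<lambda>n. l2_norm \<Omega> (\<lambda>x. u n x - v x)) \<longlonglongrightarrow> 0"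
  obtains r :: "nat \<Rightarrow> nat" where "strict_mono r" "AE x in M. (\<lambda>n. u (r n) x) \<longlonglongrightarrow> v x"
proof -
  have "(\<lambda>n. LINT x|M. norm (u n x - v x)) \<longlonglongrightarrow> 0"
  proof (rule tendsto_sandwich[OF always_eventually always_eventually tendsto_const])
    show "(\<lambda>n. sqrt (measure M \<Omega>) * l2_norm \<Omega> (\<lambda>x. u n x - v x)) \<longlonglongrightarrow> 0"
      by (rule tendsto_mult_right_zero[OF lim])
    show "\<forall>n. (LINT x|M. norm (u n x - v x)) \<le> sqrt (measure M \<Omega>) * l2_norm \<Omega> (\<lambda>x. u n x - v x)"
      by (rule allI, rule L2_imp_integrable_norm(2)[OF L2_diff[OF u v]])
  qed simp
  then obtain r where "strict_mono r" "AE x in M. (\<lambda>n. u (r n) x - v x) \<longlonglongrightarrow> 0"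
    using tendsto_L1_AE_subseq[of M "\<lambda>n x. u n x - v x"] u v by (auto intro: L2_imp_integrable)
  then show ?thesis using that by (simp add: LIM_zero_iff)
qed

text \<open>Riesz-Fischer: along a subsequence with steps of norm at most \<open>(1/2) ^ n\<close>
  the differences are summable almost everywhere, which produces the limit. It will provide the sum
  of the orthogonal series for the Leray projection.\<close>

lemma L2_complete:
  assumes u: "\<And>n. u n \<in> L2 \<Omega>"
    and cauchy: "\<And>e. e > 0 \<Longrightarrow> \<exists>N. \<forall>m\<ge>N. \<forall>n\<ge>N. l2_norm \<Omega> (\<lambda>x. u m x - u n x) \<le> e"
  obtains v where "v \<in> L2 \<Omega>" "(\<lambda>n. l2_norm \<Omega> (\<lambda>x. u n x - v x)) \<longlonglongrightarrow> 0"
proof -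
  have um [measurable]: "u n \<in> borel_measurable M" for n using u by (auto simp: L2_def)
  have "\<exists>r. \<forall>n. (\<forall>m\<ge>r n. \<forall>k\<ge>r n. l2_norm \<Omega> (\<lambda>x. u m x - u k x) \<le> (1/2)^n) \<and> r n < r (Suc n)"
  proof (rule dependent_nat_choice)
    show "\<exists>x. \<forall>m\<ge>x. \<forall>k\<ge>x. l2_norm \<Omega> (\<lambda>xa. u m xa - u k xa) \<le> (1 / 2) ^ 0"
      using cauchy[of 1] by auto
    fix x :: nat and n
    obtain N where "\<forall>m\<ge>N. \<forall>k\<ge>N. l2_norm \<Omega> (\<lambda>x. u m x - u k x) \<le> (1/2) ^ Suc n"
      using cauchy[of "(1/2) ^ Suc n"] by auto
    then show "\<exists>y. (\<forall>m\<ge>y. \<forall>k\<ge>y. l2_norm \<Omega> (\<lambda>x. u m x - u k x) \<le> (1 / 2) ^ Suc n) \<and> x < y"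
      by (intro exI[of _ "max N (Suc x)"]) auto
  qed
  then obtain r where r: "\<And>n m k. m \<ge> r n \<Longrightarrow> k \<ge> r n \<Longrightarrow> l2_norm \<Omega> (\<lambda>x. u m x - u k x) \<le> (1/2)^n"
    and "\<And>n. r n < r (Suc n)" by metis
  then have mono: "strict_mono r" by (simp add: strict_mono_Suc_iff)
  let ?K = "sqrt (measure M \<Omega>)"
  define d where "d n x = norm (u (r (Suc n)) x - u (r n) x)" for n x
  have d: "integrable M (d n)" "(LINT x|M. d n x) \<le> ?K * (1/2)^n" for n
  proof -
    have L: "(\<lambda>x. u (r (Suc n)) x - u (r n) x) \<in> L2 \<Omega>" by (intro L2_diff u)
    show "integrable M (d n)" unfolding d_def by (rule L2_imp_integrable_norm(1)[OF L])
    have "(LINT x|M. d n x) \<le> ?K * l2_norm \<Omega> (\<lambda>x. u (r (Suc n)) x - u (r n) x)"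
      unfolding d_def by (rule L2_imp_integrable_norm(2)[OF L])
    also have "\<dots> \<le> ?K * (1/2)^n"
      using r[of n "r (Suc n)" "r n"] mono by (intro mult_left_mono) (auto simp: strict_mono_less_eq)
    finally show "(LINT x|M. d n x) \<le> ?K * (1/2)^n" .
  qed
  have "(\<integral>\<^sup>+x. suminf (\<lambda>n. ennreal (d n x)) \<partial>M) = suminf (\<lambda>n. \<integral>\<^sup>+x. ennreal (d n x) \<partial>M)"
    unfolding d_def by (rule nn_integral_suminf) measurable
  also have "\<dots> \<le> suminf (\<lambda>n. ennreal (?K * (1/2)^n))"
  proof (intro suminf_le)
    show "(\<integral>\<^sup>+x. ennreal (d n x) \<partial>M) \<le> ennreal (?K * (1/2)^n)" for n
    proof -
      have "(\<integral>\<^sup>+x. ennreal (d n x) \<partial>M) = ennreal (LINT x|M. d n x)"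
        by (rule nn_integral_eq_integral[OF d(1)]) (simp add: d_def)
      then show ?thesis using ennreal_leI[OF d(2)] by simp
    qed
  qed auto
  finally have "(\<integral>\<^sup>+x. suminf (\<lambda>n. ennreal (d n x)) \<partial>M) \<le> suminf (\<lambda>n. ennreal (?K * (1/2)^n))" .
  moreover have "suminf (\<lambda>n. ennreal (?K * (1/2)^n)) \<noteq> \<infinity>"
    unfolding infinity_ennreal_def by (intro ennreal_suminf_neq_top summable_mult complete_algebra_summable_geometric) auto
  ultimately have "(\<integral>\<^sup>+x. suminf (\<lambda>n. ennreal (d n x)) \<partial>M) \<noteq> \<infinity>"
    by (auto simp: top_unique)
  moreover have "(\<lambda>x. suminf (\<lambda>n. ennreal (d n x))) \<in> borel_measurable M"
    unfolding d_def by measurable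
  ultimately have "AE x in M. suminf (\<lambda>n. ennreal (d n x)) \<noteq> \<infinity>"
    by (intro nn_integral_PInf_AE)
  then have "AE x in M. convergent (\<lambda>n. u (r n) x)"
  proof eventually_elim
    fix x assume "suminf (\<lambda>n. ennreal (d n x)) \<noteq> \<infinity>"
    then have "summable (\<lambda>n. d n x)" by (intro summable_suminf_not_top) (auto simp: d_def)
    then have "summable (\<lambda>n. u (r (Suc n)) x - u (r n) x)"
      unfolding d_def by (rule summable_norm_cancel)
    then have "convergent (\<lambda>n. \<Sum>i<n. u (r (Suc i)) x - u (r i) x)"
      by (simp add: summable_iff_convergent)
    then have "convergent (\<lambda>n. u (r n) x - u (r 0) x)"
      using sum_lessThan_telescope[of "\<lambda>n. u (r n) x"] by simp
    from convergent_add[OF this convergent_const[of "u (r 0) x"]]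
    show "convergent (\<lambda>n. u (r n) x)" by simp
  qed
  define v where "v x = lim (\<lambda>n. u (r n) x)" for x
  have [measurable]: "v \<in> borel_measurable M" unfolding v_def[abs_def] by measurable
  have lim: "AE x in M. (\<lambda>n. u (r n) x) \<longlonglongrightarrow> v x"
    using \<open>AE x in M. convergent (\<lambda>n. u (r n) x)\<close> by (simp add: v_def convergent_LIMSEQ_iff)
  \<comment> \<open>Fatou's lemma with \<open>m\<close> fixed, along the subsequence. Starting it at
    \<open>k\<close> keeps all indices beyond \<open>r k\<close>, where the Cauchy estimate
    applies.\<close>
  have est: "integrable M (\<lambda>x. (norm (u m x - v x))\<^sup>2) \<and> (LINT x|M. (norm (u m x - v x))\<^sup>2) \<le> ((1/2)^k)\<^sup>2"
    if m: "m \<ge> r k" for m k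
  proof (intro conjI)
    define h where "h n x = (norm (u m x - u (r (n + k)) x))\<^sup>2" for n x
    have int: "integrable M (h n)" for n
      unfolding h_def by (intro L2_integrable L2_diff u)
    have bound: "(LINT x|M. h n x) \<le> ((1/2)^k)\<^sup>2" for n
      unfolding h_def l2_norm_square_integral[symmetric]
      using r[OF m, of "r (n + k)"] mono
      by (auto intro!: power_mono simp: strict_mono_less_eq)
    have conv: "AE x in M. (\<lambda>n. h n x) \<longlonglongrightarrow> (norm (u m x - v x))\<^sup>2"
      using lim unfolding h_def by eventually_elim (intro tendsto_intros LIMSEQ_ignore_initial_segment)
    have nonneg: "0 \<le> h n x" for n x by (simp add: h_def)
    have meas: "(\<lambda>x. (norm (u m x - v x))\<^sup>2) \<in> borel_measurable M" by measurable
    show "integrable M (\<lambda>x. (norm (u m x - v x))\<^sup>2)"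
      by (rule integrable_Fatou(1)[OF int nonneg meas conv bound tendsto_const])
    show "(LINT x|M. (norm (u m x - v x))\<^sup>2) \<le> ((1/2)^k)\<^sup>2"
      by (rule integrable_Fatou(2)[OF int nonneg meas conv bound tendsto_const])
  qed
  have "(\<lambda>x. u (r 0) x - v x) \<in> L2 \<Omega>" using est[of 0 "r 0"] by (simp add: L2_def)
  from L2_diff[OF u this, of "r 0"] have v: "v \<in> L2 \<Omega>" by simp
  have "(\<lambda>n. l2_norm \<Omega> (\<lambda>x. u n x - v x)) \<longlonglongrightarrow> 0"
  proof (rule LIMSEQ_I)
    fix e :: real assume "e > 0"
    then obtain k where k: "(1/2)^k < e" using real_arch_pow_inv[of e "1/2"] by auto
    have "l2_norm \<Omega> (\<lambda>x. u n x - v x) < e" if "n \<ge> r k" for n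
    proof -
      have "(l2_norm \<Omega> (\<lambda>x. u n x - v x))\<^sup>2 \<le> ((1/2)^k)\<^sup>2"
        using est[OF that] by (simp add: l2_norm_square_integral)
      then have "l2_norm \<Omega> (\<lambda>x. u n x - v x) \<le> (1/2)^k" by (rule power2_le_imp_le) simp
      then show ?thesis using k by simp
    qed
    then show "\<exists>no. \<forall>n\<ge>no. norm (l2_norm \<Omega> (\<lambda>x. u n x - v x) - 0) < e"
      by (intro exI[of _ "r k"]) auto
  qed
  with v show ?thesis by (rule that)
qed

section \<open>Weak derivatives and the space H1\<close>

lemma has_weak_pderivD:
  "has_weak_pderiv T \<Omega> i u g \<Longrightarrow> \<phi> \<in> T \<Longrightarrow>
    (LINT x|M. pderiv_at i \<phi> x *\<^sub>R u x) = - (LINT x|M. \<phi> x *\<^sub>R g x)"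
  by (simp add: has_weak_pderiv_def)

text \<open>The difference of two candidates integrates to 0 against every test function. Since
  \<open>weak_pderiv\<close> picks some candidate, each later computation with it passes through
  this uniqueness.\<close>

lemma has_weak_pderiv_unique:
  assumes "g \<in> L2 \<Omega>" "g' \<in> L2 \<Omega>"
    and "has_weak_pderiv (test_functions \<Omega>) \<Omega> i u g" "has_weak_pderiv (test_functions \<Omega>) \<Omega> i u g'"
  shows "AE x in M. g x = g' x"
proof -
  have "AE x in M. g x - g' x = 0"
  proof (rule fundamental_lemma_calculus_of_variations[OF \<Omega>_open])
    show "integrable M (\<lambda>x. g x - g' x)" using assms by (intro L2_imp_integrable L2_diff)
    fix \<phi> assume \<phi>: "\<phi> \<in> test_functions \<Omega>"
    then have c: "continuous_on UNIV \<phi>" by (auto simp: test_functions_def intro: smooth_imp_continuous_on)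
    have "(LINT x|M. \<phi> x *\<^sub>R g x) = (LINT x|M. \<phi> x *\<^sub>R g' x)"
      using has_weak_pderivD[OF assms(3) \<phi>] has_weak_pderivD[OF assms(4) \<phi>] by simp
    then show "(LINT x|M. \<phi> x *\<^sub>R (g x - g' x)) = 0"
      using assms(1,2) c by (simp add: scaleR_diff_right L2_imp_integrable L2_mult_continuous)
  qed
  then show ?thesis by simp
qed

text \<open>The class \<open>T\<close> is left open because the same algebra serves the compactly
  supported tests behind \<open>weak_pderiv\<close> and the periodic tests behind
  \<open>H2\<close>.\<close>

lemma has_weak_pderiv_lincomb:
  assumes T: "\<And>\<phi>. \<phi> \<in> T \<Longrightarrow> smooth \<phi>"
    and "u \<in> L2 \<Omega>" "v \<in> L2 \<Omega>" "g \<in> L2 \<Omega>" "k \<in> L2 \<Omega>"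
    and u: "has_weak_pderiv T \<Omega> i u g" and v: "has_weak_pderiv T \<Omega> i v k"
  shows "has_weak_pderiv T \<Omega> i (\<lambda>x. a *\<^sub>R u x + b *\<^sub>R v x) (\<lambda>x. a *\<^sub>R g x + b *\<^sub>R k x)"
  unfolding has_weak_pderiv_def
proof
  fix \<phi> assume \<phi>: "\<phi> \<in> T"
  have c: "continuous_on UNIV \<phi>" "continuous_on UNIV (pderiv_at i \<phi>)"
    using T[OF \<phi>] by (auto intro: smooth_imp_continuous_on smooth_pderiv_at)
  have e: "(LINT x|M. \<psi> x *\<^sub>R (a *\<^sub>R p x + b *\<^sub>R q x)) = a *\<^sub>R (LINT x|M. \<psi> x *\<^sub>R p x) + b *\<^sub>R (LINT x|M. \<psi> x *\<^sub>R q x)"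
    if "continuous_on UNIV \<psi>" "p \<in> L2 \<Omega>" "q \<in> L2 \<Omega>" for \<psi> p q
  proof -
    have "\<psi> x *\<^sub>R (a *\<^sub>R p x + b *\<^sub>R q x) = a *\<^sub>R \<psi> x *\<^sub>R p x + b *\<^sub>R \<psi> x *\<^sub>R q x" for x
      by (simp add: algebra_simps)
    then show ?thesis
      using L2_imp_integrable[OF L2_mult_continuous[OF that(1,2)]]
        L2_imp_integrable[OF L2_mult_continuous[OF that(1,3)]]
      by (simp del: scaleR_scaleR)
  qed
  show "(LINT x|M. pderiv_at i \<phi> x *\<^sub>R (a *\<^sub>R u x + b *\<^sub>R v x)) = - (LINT x|M. \<phi> x *\<^sub>R (a *\<^sub>R g x + b *\<^sub>R k x))"
    using has_weak_pderivD[OF u \<phi>] has_weak_pderivD[OF v \<phi>] assms(2-5) c by (simp add: e del: scaleR_scaleR)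
qed

lemma has_weak_pderiv_cong_AE:
  assumes T: "\<And>\<phi>. \<phi> \<in> T \<Longrightarrow> smooth \<phi>"
    and "u \<in> L2 \<Omega>" "u' \<in> L2 \<Omega>" "g \<in> L2 \<Omega>" "g' \<in> L2 \<Omega>"
    and "AE x in M. u x = u' x" "AE x in M. g x = g' x" "has_weak_pderiv T \<Omega> i u g"
  shows "has_weak_pderiv T \<Omega> i u' g'"
  unfolding has_weak_pderiv_def
proof
  fix \<phi> assume \<phi>: "\<phi> \<in> T"
  have [measurable]: "\<phi> \<in> borel_measurable M" "pderiv_at i \<phi> \<in> borel_measurable M"
    using T[OF \<phi>] by (auto intro!: continuous_imp_measurable smooth_imp_continuous_on smooth_pderiv_at)
  have [measurable]: "u \<in> borel_measurable M" "u' \<in> borel_measurable M" "g \<in> borel_measurable M" "g' \<in> borel_measurable M"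
    using assms by (auto simp: L2_def)
  have "(LINT x|M. pderiv_at i \<phi> x *\<^sub>R u x) = (LINT x|M. pderiv_at i \<phi> x *\<^sub>R u' x)"
    using assms(6) by (intro integral_cong_AE) auto
  moreover have "(LINT x|M. \<phi> x *\<^sub>R g x) = (LINT x|M. \<phi> x *\<^sub>R g' x)"
    using assms(7) by (intro integral_cong_AE) auto
  ultimately show "(LINT x|M. pderiv_at i \<phi> x *\<^sub>R u' x) = - (LINT x|M. \<phi> x *\<^sub>R g' x)"
    using has_weak_pderivD[OF assms(8) \<phi>] by simp
qed

lemma test_functions_smooth: "\<phi> \<in> test_functions \<Omega> \<Longrightarrow> smooth \<phi>"
  by (simp add: test_functions_def)

lemma H1_imp_L2: "u \<in> H1 \<Omega> \<Longrightarrow> u \<in> L2 \<Omega>"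
  by (simp add: H1_def)

lemma weak_pderiv_spec:
  assumes "u \<in> H1 \<Omega>"
  shows "weak_pderiv \<Omega> i u \<in> L2 \<Omega>" "has_weak_pderiv (test_functions \<Omega>) \<Omega> i u (weak_pderiv \<Omega> i u)"
  using assms someI_ex[of "\<lambda>g. g \<in> L2 \<Omega> \<and> has_weak_pderiv (test_functions \<Omega>) \<Omega> i u g"]
  unfolding H1_def weak_pderiv_def[symmetric] by auto

lemma weak_pderiv_eq:
  assumes "g \<in> L2 \<Omega>" "has_weak_pderiv (test_functions \<Omega>) \<Omega> i u g"
  shows "weak_pderiv \<Omega> i u \<in> L2 \<Omega>" "AE x in M. weak_pderiv \<Omega> i u x = g x"
proof -
  have *: "weak_pderiv \<Omega> i u \<in> L2 \<Omega> \<and> has_weak_pderiv (test_functions \<Omega>) \<Omega> i u (weak_pderiv \<Omega> i u)"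
    using someI[of "\<lambda>g. g \<in> L2 \<Omega> \<and> has_weak_pderiv (test_functions \<Omega>) \<Omega> i u g" g] assms
    unfolding weak_pderiv_def[symmetric] by blast
  then show "weak_pderiv \<Omega> i u \<in> L2 \<Omega>" by simp
  from * assms show "AE x in M. weak_pderiv \<Omega> i u x = g x" by (intro has_weak_pderiv_unique) auto
qed

lemma H1_lincomb:
  assumes "u \<in> H1 \<Omega>" "v \<in> H1 \<Omega>"
  shows "(\<lambda>x. a *\<^sub>R u x + b *\<^sub>R v x) \<in> H1 \<Omega>"
    and "AE x in M. weak_pderiv \<Omega> i (\<lambda>x. a *\<^sub>R u x + b *\<^sub>R v x) x = a *\<^sub>R weak_pderiv \<Omega> i u x + b *\<^sub>R weak_pderiv \<Omega> i v x"
proof -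
  have w: "has_weak_pderiv (test_functions \<Omega>) \<Omega> i (\<lambda>x. a *\<^sub>R u x + b *\<^sub>R v x) (\<lambda>x. a *\<^sub>R weak_pderiv \<Omega> i u x + b *\<^sub>R weak_pderiv \<Omega> i v x)" for i
    using assms by (intro has_weak_pderiv_lincomb weak_pderiv_spec H1_imp_L2 test_functions_smooth)
  have L: "(\<lambda>x. a *\<^sub>R weak_pderiv \<Omega> i u x + b *\<^sub>R weak_pderiv \<Omega> i v x) \<in> L2 \<Omega>" for i
    using assms by (intro L2_lincomb weak_pderiv_spec)
  have uv: "(\<lambda>x. a *\<^sub>R u x + b *\<^sub>R v x) \<in> L2 \<Omega>" using assms by (intro L2_lincomb H1_imp_L2)
  show "(\<lambda>x. a *\<^sub>R u x + b *\<^sub>R v x) \<in> H1 \<Omega>"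
    using uv w L by (auto simp: H1_def)
  show "AE x in M. weak_pderiv \<Omega> i (\<lambda>x. a *\<^sub>R u x + b *\<^sub>R v x) x = a *\<^sub>R weak_pderiv \<Omega> i u x + b *\<^sub>R weak_pderiv \<Omega> i v x"
    by (rule weak_pderiv_eq(2)[OF L w])
qed

lemma H1_diff:
  assumes "u \<in> H1 \<Omega>" "v \<in> H1 \<Omega>"
  shows "(\<lambda>x. u x - v x) \<in> H1 \<Omega>"
    and "AE x in M. weak_pderiv \<Omega> i (\<lambda>x. u x - v x) x = weak_pderiv \<Omega> i u x - weak_pderiv \<Omega> i v x"
  using H1_lincomb(1)[OF assms, of 1 "-1"] H1_lincomb(2)[OF assms, of i 1 "-1"] by simp_all

lemma dirichlet_inner_eq_sum:
  assumes "u \<in> H1 \<Omega>" "v \<in> H1 \<Omega>"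
  shows "dirichlet_inner \<Omega> u v = (\<Sum>j\<in>UNIV. l2_inner \<Omega> (weak_pderiv \<Omega> j u) (weak_pderiv \<Omega> j v))"
  unfolding dirichlet_inner_def l2_inner_def
  by (intro Bochner_Integration.integral_sum L2_inner_integrable weak_pderiv_spec assms)

lemma dirichlet_norm_power2:
  assumes "u \<in> H1 \<Omega>"
  shows "(dirichlet_norm \<Omega> u)\<^sup>2 = (\<Sum>j\<in>UNIV. (l2_norm \<Omega> (weak_pderiv \<Omega> j u))\<^sup>2)"
  unfolding l2_norm_power2 dirichlet_norm_def dirichlet_inner_eq_sum[OF assms assms, symmetric]
  by (intro real_sqrt_pow2) (auto simp: dirichlet_inner_def intro!: Bochner_Integration.integral_nonneg sum_nonneg)

lemma dirichlet_norm_nonneg [simp]: "0 \<le> dirichlet_norm \<Omega> u"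
  by (auto simp: dirichlet_norm_def dirichlet_inner_def intro!: Bochner_Integration.integral_nonneg sum_nonneg)

lemma h1_norm_power2: "(h1_norm \<Omega> u)\<^sup>2 = (l2_norm \<Omega> u)\<^sup>2 + (dirichlet_norm \<Omega> u)\<^sup>2"
  by (simp add: h1_norm_def)

lemma h1_norm_nonneg [simp]: "0 \<le> h1_norm \<Omega> u"
  by (simp add: h1_norm_def)

lemma l2_norm_le_h1_norm: "l2_norm \<Omega> u \<le> h1_norm \<Omega> u"
  by (rule power2_le_imp_le) (simp_all add: h1_norm_power2)

lemma dirichlet_norm_le_h1_norm: "dirichlet_norm \<Omega> u \<le> h1_norm \<Omega> u"
  by (rule power2_le_imp_le) (simp_all add: h1_norm_power2)

lemma l2_norm_weak_pderiv_le: 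
  assumes "u \<in> H1 \<Omega>"
  shows "l2_norm \<Omega> (weak_pderiv \<Omega> j u) \<le> h1_norm \<Omega> u"
proof -
  have "(l2_norm \<Omega> (weak_pderiv \<Omega> j u))\<^sup>2 \<le> (dirichlet_norm \<Omega> u)\<^sup>2"
    unfolding dirichlet_norm_power2[OF assms] by (rule member_le_sum) auto
  then have "l2_norm \<Omega> (weak_pderiv \<Omega> j u) \<le> dirichlet_norm \<Omega> u" by (rule power2_le_imp_le) simp
  then show ?thesis using dirichlet_norm_le_h1_norm[of u] by linarith
qed

lemma h1_norm_tendsto:
  assumes u: "\<And>n. u n \<in> H1 \<Omega>" and v: "v \<in> H1 \<Omega>" and lim: "(\<lambda>n. h1_norm \<Omega> (\<lambda>x. u n x - v x)) \<longlonglongrightarrow> 0"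
  shows "(\<lambda>n. l2_norm \<Omega> (\<lambda>x. u n x - v x)) \<longlonglongrightarrow> 0"
    and "(\<lambda>n. l2_norm \<Omega> (\<lambda>x. weak_pderiv \<Omega> j (u n) x - weak_pderiv \<Omega> j v x)) \<longlonglongrightarrow> 0"
    and "(\<lambda>n. h1_norm \<Omega> (u n)) \<longlonglongrightarrow> h1_norm \<Omega> v"
proof -
  show l: "(\<lambda>n. l2_norm \<Omega> (\<lambda>x. u n x - v x)) \<longlonglongrightarrow> 0"
    by (rule tendsto_sandwich[OF _ _ tendsto_const lim]) (auto intro!: always_eventually l2_norm_le_h1_norm)
  have eq: "l2_norm \<Omega> (\<lambda>x. weak_pderiv \<Omega> j (u n) x - weak_pderiv \<Omega> j v x) = l2_norm \<Omega> (weak_pderiv \<Omega> j (\<lambda>x. u n x - v x))" for n j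
    using l2_norm_cong_AE[OF _ _ H1_diff(2)[OF u[of n] v, of j]] H1_diff(1)[OF u[of n] v] u v
    by (simp add: L2_diff weak_pderiv_spec)
  show d: "(\<lambda>n. l2_norm \<Omega> (\<lambda>x. weak_pderiv \<Omega> j (u n) x - weak_pderiv \<Omega> j v x)) \<longlonglongrightarrow> 0" for j
    unfolding eq
    by (rule tendsto_sandwich[OF _ _ tendsto_const lim]) (auto intro!: always_eventually l2_norm_weak_pderiv_le H1_diff u v)
  have conv: "(\<lambda>n. l2_norm \<Omega> (p n)) \<longlonglongrightarrow> l2_norm \<Omega> q"
    if "\<And>n. p n \<in> L2 \<Omega>" "q \<in> L2 \<Omega>" "(\<lambda>n. l2_norm \<Omega> (\<lambda>x. p n x - q x)) \<longlonglongrightarrow> 0" for p q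
    by (rule LIM_zero_cancel, rule tendsto_rabs_zero_cancel, rule tendsto_sandwich[OF _ _ tendsto_const that(3)])
      (use that in \<open>auto intro!: always_eventually l2_norm_diff_triangle\<close>)
  have h: "h1_norm \<Omega> z = sqrt ((l2_norm \<Omega> z)\<^sup>2 + (\<Sum>j\<in>UNIV. (l2_norm \<Omega> (weak_pderiv \<Omega> j z))\<^sup>2))" if "z \<in> H1 \<Omega>" for z
    using that by (simp add: h1_norm_def dirichlet_norm_power2)
  show "(\<lambda>n. h1_norm \<Omega> (u n)) \<longlonglongrightarrow> h1_norm \<Omega> v"
    unfolding h[OF u] h[OF v]
    by (intro tendsto_real_sqrt tendsto_add tendsto_power tendsto_sum conv l d weak_pderiv_spec H1_imp_L2 u v)
qed

end

subsection \<open>Test fields\<close>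

lemma pderiv_at_eqI:
  assumes "(f has_derivative F) (at x)" shows "pderiv_at i f x = F (axis i 1)"
  using frechet_derivative_at[OF assms] by (simp add: pderiv_at_def)

lemma pderiv_at_bilinear:
  assumes p: "bounded_bilinear p" and f: "smooth f" and g: "smooth g"
  shows "pderiv_at i (\<lambda>x. p (f x) (g x)) x = p (f x) (pderiv_at i g x) + p (pderiv_at i f x) (g x)"
  using pderiv_at_eqI[OF bounded_bilinear.FDERIV[OF p smooth_imp_has_derivative[OF f] smooth_imp_has_derivative[OF g]], of i x]
  by (simp add: pderiv_at_def)

lemma pderiv_at_lincomb:
  assumes f: "smooth f" and g: "smooth g"
  shows "pderiv_at i (\<lambda>x. a *\<^sub>R f x + b *\<^sub>R g x) x = a *\<^sub>R pderiv_at i f x + b *\<^sub>R pderiv_at i g x"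
proof -
  have "((\<lambda>x. a *\<^sub>R f x + b *\<^sub>R g x) has_derivative
      (\<lambda>h. a *\<^sub>R frechet_derivative f (at x) h + b *\<^sub>R frechet_derivative g (at x) h)) (at x)"
    by (intro has_derivative_add has_derivative_scaleR_right smooth_imp_has_derivative f g)
  from pderiv_at_eqI[OF this] show ?thesis by (simp add: pderiv_at_def)
qed

lemma pderiv_at_vec_nth:
  fixes f :: field
  assumes f: "smooth f"
  shows "pderiv_at i (\<lambda>x. f x $ k) x = pderiv_at i f x $ k"
  using pderiv_at_eqI[OF bounded_linear.has_derivative[OF bounded_linear_vec_nth smooth_imp_has_derivative[OF f]], of i k x]
  by (simp add: pderiv_at_def)

context bounded_domain
begin

lemma test_function_eq_0:
  assumes \<phi>: "compact_support_in \<Omega> \<phi>" and x: "x \<notin> \<Omega>"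
  shows "\<phi> x = 0"
  using assms closure_subset[of "{x. \<phi> x \<noteq> 0}"] by (auto simp: compact_support_in_def)

text \<open>A point outside \<Omega>, even one on its boundary, lies in the open complement of the
  support, where the function vanishes identically.\<close>

lemma test_function_pderiv_eq_0:
  fixes \<phi> :: "real^2 \<Rightarrow> 'b::real_normed_vector"
  assumes \<phi>: "compact_support_in \<Omega> \<phi>" and x: "x \<notin> \<Omega>"
  shows "pderiv_at i \<phi> x = 0"
proof -
  let ?U = "- closure {x. \<phi> x \<noteq> 0}"
  have "((\<lambda>_. 0 :: 'b) has_derivative (\<lambda>_. 0)) (at x)" by simp
  then have "(\<phi> has_derivative (\<lambda>_. 0)) (at x)"
  proof (rule has_derivative_transform_within_open[where s = ?U])
    show "x \<in> ?U" using assms by (auto simp: compact_support_in_def)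
    show "0 = \<phi> y" if "y \<in> ?U" for y
      using that closure_subset[of "{x. \<phi> x \<noteq> 0}"] by auto
    show "open ?U" by (rule open_Compl[OF closed_closure])
  qed
  from pderiv_at_eqI[OF this] show ?thesis by simp
qed

lemma compact_support_mono:
  assumes \<phi>: "compact_support_in \<Omega> \<phi>" and zero: "\<And>x. \<phi> x = 0 \<Longrightarrow> \<psi> x = 0"
  shows "compact_support_in \<Omega> \<psi>"
proof -
  have "closure {x. \<psi> x \<noteq> 0} \<subseteq> closure {x. \<phi> x \<noteq> 0}"
    by (rule closure_mono) (use zero in auto)
  then show ?thesis
    using \<phi> unfolding compact_support_in_def
    by (meson bounded_subset closed_closure compact_eq_bounded_closed order.trans)
qed

text \<open>The domain may have any shape, so lines through it are awkward. Because the derivative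
  vanishes on the rest of the box, the integral can be taken over the box instead.\<close>

lemma integral_pderiv_enclosing_box:
  fixes \<psi> :: "real^2 \<Rightarrow> real"
  assumes \<psi>: "smooth \<psi>" and sub: "\<Omega> \<subseteq> box lo hi" and le: "\<And>k. lo $ k \<le> hi $ k"
    and faces: "\<And>t. \<psi> (pt i (lo $ i) t) = \<psi> (pt i (hi $ i) t)"
    and out: "\<And>x. x \<in> box lo hi - \<Omega> \<Longrightarrow> pderiv_at i \<psi> x = 0"
  shows "(LINT x|M. pderiv_at i \<psi> x) = 0"
proof -
  have [measurable]: "pderiv_at i \<psi> \<in> borel_measurable borel"
    by (intro borel_measurable_continuous_onI smooth_imp_continuous_on smooth_pderiv_at \<psi>)
  have "(LINT x|M. pderiv_at i \<psi> x) = (LINT x|lborel. indicator \<Omega> x *\<^sub>R pderiv_at i \<psi> x)"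
    by (rule integral_lebesgue_on_eq_lborel) auto
  also have "\<dots> = (LINT x|lborel. indicator (box lo hi) x *\<^sub>R pderiv_at i \<psi> x)"
    using sub out by (intro Bochner_Integration.integral_cong) (auto simp: indicator_def)
  also have "\<dots> = (LINT x|lebesgue_on (box lo hi). pderiv_at i \<psi> x)"
    by (rule integral_lebesgue_on_eq_lborel[symmetric]) auto
  also have "\<dots> = 0" by (rule integral_pderiv_box_eq_0[OF \<psi> le faces])
  finally show ?thesis .
qed

lemma pt_not_in_box: "pt i (lo $ i) t \<notin> box lo hi" "pt i (hi $ i) t \<notin> box lo hi"
  by (auto simp: mem_box_cart pt_def intro!: exI[of _ i])

lemma enclosing_box:
  obtains lo hi where "\<Omega> \<subseteq> box lo hi" "\<And>k. lo $ k < hi $ k"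
proof -
  obtain a where a: "\<Omega> \<subseteq> box (- a) a" using bounded_subset_box_symmetric[OF \<Omega>_bounded] by blast
  show ?thesis
  \<comment> \<open>The symmetric box obtained above may be degenerate when \<Omega> is empty;
    enlarging each half side to \<open>\<bar>a $ k\<bar> + 1\<close> makes all sides
    positive.\<close>
  proof (rule that[of "- (\<chi> k. \<bar>a $ k\<bar> + 1)" "\<chi> k. \<bar>a $ k\<bar> + 1"])
    show "\<Omega> \<subseteq> box (- (\<chi> k. \<bar>a $ k\<bar> + 1)) (\<chi> k. \<bar>a $ k\<bar> + 1)"
    proof
      fix x assume "x \<in> \<Omega>"
      then have "- a $ k < x $ k \<and> x $ k < a $ k" for k
        using a by (auto simp: mem_box_cart)
      then show "x \<in> box (- (\<chi> k. \<bar>a $ k\<bar> + 1)) (\<chi> k. \<bar>a $ k\<bar> + 1)"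
        unfolding mem_box_cart by (simp, smt (verit))
    qed
  qed simp
qed

lemma integral_pderiv_test_function_eq_0:
  assumes \<phi>: "\<phi> \<in> test_functions \<Omega>"
  shows "(LINT x|M. pderiv_at i \<phi> x) = 0"
proof -
  obtain lo hi where box: "\<Omega> \<subseteq> box lo hi" "\<And>k. lo $ k < hi $ k" using enclosing_box by blast
  have sup: "smooth \<phi>" "compact_support_in \<Omega> \<phi>" using \<phi> by (auto simp: test_functions_def)
  have "pt i (lo $ i) t \<notin> \<Omega>" "pt i (hi $ i) t \<notin> \<Omega>" for t
    using box(1) pt_not_in_box by blast+
  then show ?thesis
    using sup box(2) test_function_eq_0[OF sup(2)] test_function_pderiv_eq_0[OF sup(2)]
    by (intro integral_pderiv_enclosing_box[OF sup(1) box(1)]) (auto intro: less_imp_le)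
qed

text \<open>The product of \<open>\<phi>\<close> with a component of \<open>u\<close> is again a
  test function, so its derivative integrates to 0. No boundary behaviour of \<open>u\<close> is
  involved, as \<open>\<phi>\<close> carries the compact support.\<close>

lemma smooth_has_weak_pderiv:
  fixes u :: field
  assumes u: "smooth u"
  shows "has_weak_pderiv (test_functions \<Omega>) \<Omega> i u (pderiv_at i u)"
  unfolding has_weak_pderiv_def
proof
  fix \<phi> assume \<phi>: "\<phi> \<in> test_functions \<Omega>"
  then have s: "smooth \<phi>" by (rule test_functions_smooth)
  have int: "integrable M (\<lambda>x. \<psi> x *\<^sub>R v x)" if "smooth \<psi>" "smooth v" for \<psi> and v :: field
    using that by (intro L2_imp_integrable L2_mult_continuous continuous_imp_L2 smooth_imp_continuous_on)
  have i1: "integrable M (\<lambda>x. pderiv_at i \<phi> x *\<^sub>R u x)" and i2: "integrable M (\<lambda>x. \<phi> x *\<^sub>R pderiv_at i u x)"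
    by (intro int smooth_pderiv_at s u)+
  have "(LINT x|M. pderiv_at i \<phi> x *\<^sub>R u x + \<phi> x *\<^sub>R pderiv_at i u x) = 0"
  proof (simp only: vec_eq_iff, intro allI)
    fix k
    let ?\<psi> = "\<lambda>x. \<phi> x * u x $ k"
    have "(LINT x|M. pderiv_at i \<phi> x *\<^sub>R u x + \<phi> x *\<^sub>R pderiv_at i u x) $ k =
        (LINT x|M. (pderiv_at i \<phi> x *\<^sub>R u x + \<phi> x *\<^sub>R pderiv_at i u x) $ k)"
      by (rule integral_bounded_linear[OF bounded_linear_vec_nth, symmetric]) (intro Bochner_Integration.integrable_add i1 i2)
    also have "\<dots> = (LINT x|M. pderiv_at i ?\<psi> x)"
      by (simp add: pderiv_at_bilinear[OF bounded_bilinear_mult s smooth_vec_nth[OF u]] pderiv_at_vec_nth[OF u] add.commute)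
    also have "\<dots> = 0"
    proof (rule integral_pderiv_test_function_eq_0)
      have "compact_support_in \<Omega> ?\<psi>"
        using \<phi> by (auto simp: test_functions_def intro: compact_support_mono[of \<phi> ?\<psi>])
      then show "?\<psi> \<in> test_functions \<Omega>"
        using smooth_mult[OF s smooth_vec_nth[OF u]] by (simp add: test_functions_def)
    qed
    finally show "(LINT x|M. pderiv_at i \<phi> x *\<^sub>R u x + \<phi> x *\<^sub>R pderiv_at i u x) $ k = 0 $ k" by simp
  qed
  then show "(LINT x|M. pderiv_at i \<phi> x *\<^sub>R u x) = - (LINT x|M. \<phi> x *\<^sub>R pderiv_at i u x)"
    using i1 i2 by (simp add: eq_neg_iff_add_eq_0)
qed

lemma smooth_imp_H1:
  fixes u :: field
  assumes u: "smooth u"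
  shows "u \<in> H1 \<Omega>" "AE x in M. weak_pderiv \<Omega> i u x = pderiv_at i u x"
proof -
  have L: "u \<in> L2 \<Omega>" "pderiv_at i u \<in> L2 \<Omega>" for i
    by (intro continuous_imp_L2 smooth_imp_continuous_on smooth_pderiv_at u)+
  show "u \<in> H1 \<Omega>" using L smooth_has_weak_pderiv[OF u] by (auto simp: H1_def)
  show "AE x in M. weak_pderiv \<Omega> i u x = pderiv_at i u x"
    by (rule weak_pderiv_eq(2)[OF L(2) smooth_has_weak_pderiv[OF u]])
qed

end

section \<open>The two flow settings and their test fields\<close>

lemma region_Periodic: "region (Periodic L) = box 0 (\<chi> i. L)"
  by (auto simp: mem_box_cart)

locale flow_domain =
  fixes S :: flow_setting
  assumes admissible: "admissible S"

sublocale flow_domain \<subseteq> bounded_domain "region S"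
proof (unfold_locales, goal_cases)
  case 1
  show ?case
  proof (cases S)
    case (Periodic L)
    show ?thesis unfolding Periodic region_Periodic by (rule open_box)
  qed (use admissible in auto)
next
  case 2
  show ?case
  proof (cases S)
    case (Periodic L)
    show ?thesis unfolding Periodic region_Periodic by (rule bounded_box)
  qed (use admissible in auto)
qed

text \<open>In each setting this is an algebra of smooth functions that can be integrated by parts
  without boundary terms. It contains the components of the test fields, and it is the class of
  tests behind \<open>H2\<close>, so the two settings can share one argument.\<close>

fun scalar_tests :: "flow_setting \<Rightarrow> (real^2 \<Rightarrow> real) set" where
  "scalar_tests (Periodic L) = periodic_test_functions L"
| "scalar_tests (No_Slip \<Omega>) = test_functions \<Omega>"

lemma H2_eq: "H2 S = sobolev2 (scalar_tests S) (region S)"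
  by (cases S) auto

lemma scalar_tests_smooth: "\<phi> \<in> scalar_tests S \<Longrightarrow> smooth \<phi>"
  by (cases S) (auto simp: periodic_test_functions_def test_functions_def)

lemma trig_poly_smooth:
  assumes "trig_poly L v" shows "smooth v"
proof -
  have lin: "bounded_linear (\<lambda>x::real^2. 2 * pi * (of_int m * x $ 1 + of_int n * x $ 2) / L)" for m n :: int
    unfolding linear_conv_bounded_linear[symmetric]
    by (rule linearI) (auto simp: field_simps add_divide_distrib)
  have "smooth (\<lambda>x::real^2. cos (2 * pi * (of_int m * x $ 1 + of_int n * x $ 2) / L))"
    and "smooth (\<lambda>x::real^2. sin (2 * pi * (of_int m * x $ 1 + of_int n * x $ 2) / L))" for m n :: int
    using smooth_compose_affine[OF smooth_cos_sin[of 1 0] lin, of m n 0]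
      smooth_compose_affine[OF smooth_cos_sin[of 0 1] lin, of m n 0] by simp_all
  then show ?thesis
    using assms unfolding trig_poly_def
    by (auto intro!: smooth_sum smooth_add smooth_scaleR smooth_const simp: case_prod_beta)
qed

lemma trig_poly_periodic:
  assumes "trig_poly L v" "L \<noteq> 0" shows "v (x + axis i L) = v x"
proof -
  have "cos (2 * pi * (of_int m * (x + axis i L) $ 1 + of_int n * (x + axis i L) $ 2) / L) =
      cos (2 * pi * (of_int m * x $ 1 + of_int n * x $ 2) / L)"
    and "sin (2 * pi * (of_int m * (x + axis i L) $ 1 + of_int n * (x + axis i L) $ 2) / L) =
      sin (2 * pi * (of_int m * x $ 1 + of_int n * x $ 2) / L)" for m n :: int
  proof -
    have "2 * pi * (of_int m * (x + axis i L) $ 1 + of_int n * (x + axis i L) $ 2) / L =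
        2 * pi * (of_int m * x $ 1 + of_int n * x $ 2) / L + of_int (if i = 1 then m else n) * (2 * pi)"
      using assms(2) exhaust_2[of i] by (auto simp: axis_def field_simps)
    note e = this
    show "cos (2 * pi * (of_int m * (x + axis i L) $ 1 + of_int n * (x + axis i L) $ 2) / L) =
        cos (2 * pi * (of_int m * x $ 1 + of_int n * x $ 2) / L)"
      and "sin (2 * pi * (of_int m * (x + axis i L) $ 1 + of_int n * (x + axis i L) $ 2) / L) =
        sin (2 * pi * (of_int m * x $ 1 + of_int n * x $ 2) / L)"
      unfolding e
      using cos.plus_of_int[where 'a = real, unfolded of_real_eq_id id_apply]
        sin.plus_of_int[where 'a = real, unfolded of_real_eq_id id_apply] by blast+
  qed
  then show ?thesis
    using assms(1) unfolding trig_poly_def by (auto intro!: sum.cong)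
qed

lemma trig_poly_lincomb:
  assumes "trig_poly L v" "trig_poly L v'"
  shows "trig_poly L (\<lambda>x. s *\<^sub>R v x + t *\<^sub>R v' x)"
proof -
  define c d where "c p x = cos (2 * pi * (of_int (fst p) * x $ 1 + of_int (snd p) * x $ 2) / L)"
    and "d p x = sin (2 * pi * (of_int (fst p) * x $ 1 + of_int (snd p) * x $ 2) / L)"
    for p :: "int \<times> int" and x :: "real^2"
  have tp: "trig_poly L w \<longleftrightarrow> (\<exists>K a b. finite K \<and> w = (\<lambda>x. \<Sum>p\<in>K. c p x *\<^sub>R a p + d p x *\<^sub>R b p))" for w
    unfolding trig_poly_def c_def d_def by (simp add: case_prod_beta)
  obtain K a b where K: "finite K" "v = (\<lambda>x. \<Sum>p\<in>K. c p x *\<^sub>R a p + d p x *\<^sub>R b p)"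
    using assms(1) unfolding tp by blast
  obtain K' a' b' where K': "finite K'" "v' = (\<lambda>x. \<Sum>p\<in>K'. c p x *\<^sub>R a' p + d p x *\<^sub>R b' p)"
    using assms(2) unfolding tp by blast
  \<comment> \<open>Coefficients are extended by 0, so that both sums run over the union of the two
    frequency sets.\<close>
  define z where "z X q p = (if p \<in> X then q p else 0)" for X :: "(int \<times> int) set" and q :: "int \<times> int \<Rightarrow> real^2" and p
  have ext: "(\<Sum>p\<in>X. c p x *\<^sub>R q p + d p x *\<^sub>R r p) = (\<Sum>p\<in>K \<union> K'. c p x *\<^sub>R z X q p + d p x *\<^sub>R z X r p)"
    if "X \<subseteq> K \<union> K'" for X x q r
  proof -
    have "(\<Sum>p\<in>X. c p x *\<^sub>R q p + d p x *\<^sub>R r p) = (\<Sum>p\<in>X. c p x *\<^sub>R z X q p + d p x *\<^sub>R z X r p)"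
      by (intro sum.cong) (auto simp: z_def)
    also have "\<dots> = (\<Sum>p\<in>K \<union> K'. c p x *\<^sub>R z X q p + d p x *\<^sub>R z X r p)"
      using that K(1) K'(1) by (intro sum.mono_neutral_left) (auto simp: z_def)
    finally show ?thesis .
  qed
  have "(\<lambda>x. s *\<^sub>R v x + t *\<^sub>R v' x) = (\<lambda>x. \<Sum>p\<in>K \<union> K'. c p x *\<^sub>R (s *\<^sub>R z K a p + t *\<^sub>R z K' a' p) + d p x *\<^sub>R (s *\<^sub>R z K b p + t *\<^sub>R z K' b' p))"
  proof
    fix x
    show "s *\<^sub>R v x + t *\<^sub>R v' x = (\<Sum>p\<in>K \<union> K'. c p x *\<^sub>R (s *\<^sub>R z K a p + t *\<^sub>R z K' a' p) + d p x *\<^sub>R (s *\<^sub>R z K b p + t *\<^sub>R z K' b' p))"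
      unfolding K(2) K'(2) ext[OF Un_upper1] ext[OF Un_upper2] scaleR_sum_right sum.distrib[symmetric]
      by (intro sum.cong refl) (simp add: algebra_simps)
  qed
  then show ?thesis unfolding tp using K(1) K'(1)
    by (intro exI[of _ "K \<union> K'"] exI[of _ "\<lambda>p. s *\<^sub>R z K a p + t *\<^sub>R z K' a' p"] exI[of _ "\<lambda>p. s *\<^sub>R z K b p + t *\<^sub>R z K' b' p"]) simp
qed

context flow_domain
begin

abbreviation "\<Omega> \<equiv> region S"

lemma scalar_tests_mult: "\<phi> \<in> scalar_tests S \<Longrightarrow> \<psi> \<in> scalar_tests S \<Longrightarrow> (\<lambda>x. \<phi> x * \<psi> x) \<in> scalar_tests S"
proof (cases S)
  case (Periodic L)
  then show "\<phi> \<in> scalar_tests S \<Longrightarrow> \<psi> \<in> scalar_tests S \<Longrightarrow> ?thesis"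
    by (auto simp: periodic_test_functions_def intro: smooth_mult)
next
  case (No_Slip D)
  assume "\<phi> \<in> scalar_tests S" "\<psi> \<in> scalar_tests S"
  then show ?thesis
    using No_Slip compact_support_mono[of \<phi> "\<lambda>x. \<phi> x * \<psi> x"]
    by (auto simp: test_functions_def intro: smooth_mult)
qed

lemma scalar_tests_add: "\<phi> \<in> scalar_tests S \<Longrightarrow> \<psi> \<in> scalar_tests S \<Longrightarrow> (\<lambda>x. \<phi> x + \<psi> x) \<in> scalar_tests S"
proof (cases S)
  case (Periodic L)
  then show "\<phi> \<in> scalar_tests S \<Longrightarrow> \<psi> \<in> scalar_tests S \<Longrightarrow> ?thesis"
    by (auto simp: periodic_test_functions_def intro: smooth_add)
next
  case (No_Slip D)
  assume *: "\<phi> \<in> scalar_tests S" "\<psi> \<in> scalar_tests S"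
  let ?s = "\<lambda>\<phi>::real^2 \<Rightarrow> real. closure {x. \<phi> x \<noteq> 0}"
  have "?s (\<lambda>x. \<phi> x + \<psi> x) \<subseteq> ?s \<phi> \<union> ?s \<psi>"
    unfolding closure_Un[symmetric] by (rule closure_mono) auto
  moreover have "compact (?s \<phi> \<union> ?s \<psi>)" "?s \<phi> \<union> ?s \<psi> \<subseteq> D"
    using * No_Slip by (auto simp: test_functions_def compact_support_in_def)
  ultimately have "compact_support_in D (\<lambda>x. \<phi> x + \<psi> x)"
    unfolding compact_support_in_def
    by (meson bounded_subset closed_closure compact_eq_bounded_closed order.trans)
  then show ?thesis
    using No_Slip * by (auto simp: test_functions_def intro: smooth_add)
qed

text \<open>In the periodic setting the box is \<Omega> itself and periodicity identifies opposite
  faces. In the no-slip setting any box around \<Omega> serves, because the tests vanish outside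
  \<Omega>, in particular on its faces.\<close>

lemma cell:
  obtains lo hi where "\<Omega> \<subseteq> box lo hi" "\<And>k. lo $ k < hi $ k"
    "\<And>\<phi> x. \<phi> \<in> scalar_tests S \<Longrightarrow> x \<in> box lo hi - \<Omega> \<Longrightarrow> \<phi> x = 0 \<and> pderiv_at i \<phi> x = 0"
    "\<And>\<phi> i t. \<phi> \<in> scalar_tests S \<Longrightarrow> \<phi> (pt i (lo $ i) t) = \<phi> (pt i (hi $ i) t)"
proof (cases S)
  case (Periodic L)
  have "pt i L t = pt i 0 t + axis i L" for i t
    by (simp add: pt_def axis_def vec_eq_iff)
  then show ?thesis
    using Periodic admissible
    by (intro that[of 0 "\<chi> i. L"]) (auto simp: region_Periodic periodic_test_functions_def simp del: region.simps(1))
next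
  case (No_Slip D)
  obtain lo hi where box: "\<Omega> \<subseteq> box lo hi" "\<And>k. lo $ k < hi $ k" using enclosing_box by blast
  have n: "pt i (lo $ i) t \<notin> \<Omega>" "pt i (hi $ i) t \<notin> \<Omega>" for i t
    using box(1) pt_not_in_box by blast+
  have z: "\<phi> x = 0" if "\<phi> \<in> scalar_tests S" "x \<notin> \<Omega>" for \<phi> x
    using that No_Slip test_function_eq_0[of \<phi> x] by (auto simp: test_functions_def)
  show ?thesis
  proof (rule that[OF box])
    show "\<phi> x = 0 \<and> pderiv_at i \<phi> x = 0" if "\<phi> \<in> scalar_tests S" "x \<in> box lo hi - \<Omega>" for \<phi> x
      using that No_Slip z[of \<phi> x] test_function_pderiv_eq_0[of \<phi> x i]
      by (auto simp: test_functions_def)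
    show "\<phi> (pt i (lo $ i) t) = \<phi> (pt i (hi $ i) t)" if "\<phi> \<in> scalar_tests S" for \<phi> i t
      using z[OF that n(1)] z[OF that n(2)] by simp
  qed
qed

lemma integral_pderiv_scalar_tests_eq_0:
  assumes "\<phi> \<in> scalar_tests S"
  shows "(LINT x|M. pderiv_at i \<phi> x) = 0"
proof -
  obtain lo hi where box: "\<Omega> \<subseteq> box lo hi" "\<And>k. lo $ k < hi $ k"
    "\<And>\<phi> x. \<phi> \<in> scalar_tests S \<Longrightarrow> x \<in> box lo hi - \<Omega> \<Longrightarrow> \<phi> x = 0 \<and> pderiv_at i \<phi> x = 0"
    "\<And>\<phi> i t. \<phi> \<in> scalar_tests S \<Longrightarrow> \<phi> (pt i (lo $ i) t) = \<phi> (pt i (hi $ i) t)"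
    using cell[of i] by blast
  show ?thesis
    by (rule integral_pderiv_enclosing_box[OF scalar_tests_smooth[OF assms] box(1)])
      (use box assms in \<open>auto intro: less_imp_le\<close>)
qed

lemma test_fields_smooth: "\<phi> \<in> test_fields S \<Longrightarrow> smooth \<phi>"
  by (cases S) (auto intro: trig_poly_smooth)

lemma test_fields_divergence: "\<phi> \<in> test_fields S \<Longrightarrow> divergence \<phi> x = 0"
  by (cases S) auto

lemma test_fields_component: "\<phi> \<in> test_fields S \<Longrightarrow> (\<lambda>x. \<phi> x $ k) \<in> scalar_tests S"
proof (cases S)
  case (Periodic L)
  assume "\<phi> \<in> test_fields S"
  then show ?thesis
    using Periodic admissible trig_poly_periodic[of L \<phi>]
    by (auto simp: periodic_test_functions_def intro: smooth_vec_nth trig_poly_smooth)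
next
  case (No_Slip D)
  assume "\<phi> \<in> test_fields S"
  then show ?thesis
    using No_Slip compact_support_mono[of \<phi> "\<lambda>x. \<phi> x $ k"]
    by (auto simp: test_functions_def intro: smooth_vec_nth)
qed

lemma test_fields_lincomb:
  assumes "\<phi> \<in> test_fields S" "\<psi> \<in> test_fields S"
  shows "(\<lambda>x. a *\<^sub>R \<phi> x + b *\<^sub>R \<psi> x) \<in> test_fields S"
proof -
  have s: "smooth \<phi>" "smooth \<psi>" using assms by (auto intro: test_fields_smooth)
  have "divergence (\<lambda>x. a *\<^sub>R \<phi> x + b *\<^sub>R \<psi> x) x = a * divergence \<phi> x + b * divergence \<psi> x" for x
    unfolding divergence_def by (simp add: pderiv_at_lincomb s sum.distrib sum_distrib_left)
  then have div: "divergence (\<lambda>x. a *\<^sub>R \<phi> x + b *\<^sub>R \<psi> x) x = 0" for x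
    using assms by (simp add: test_fields_divergence)
  have int: "integrable M \<phi>" "integrable M \<psi>"
    using s by (auto intro: L2_imp_integrable continuous_imp_L2 smooth_imp_continuous_on)
  show ?thesis
  proof (cases S)
    case (Periodic L)
    then show ?thesis using assms div int by (auto simp: trig_poly_lincomb simp del: region.simps(1))
  next
    case (No_Slip D)
    let ?s = "\<lambda>\<phi>::field. closure {x. \<phi> x \<noteq> 0}"
    have "?s (\<lambda>x. a *\<^sub>R \<phi> x + b *\<^sub>R \<psi> x) \<subseteq> ?s \<phi> \<union> ?s \<psi>"
      unfolding closure_Un[symmetric] by (rule closure_mono) auto
    moreover have "compact (?s \<phi> \<union> ?s \<psi>)" "?s \<phi> \<union> ?s \<psi> \<subseteq> D"
      using assms No_Slip by (auto simp: compact_support_in_def)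
    ultimately have "compact_support_in D (\<lambda>x. a *\<^sub>R \<phi> x + b *\<^sub>R \<psi> x)"
      unfolding compact_support_in_def
      by (meson bounded_subset closed_closure compact_eq_bounded_closed order.trans)
    moreover have "smooth (\<lambda>x. a *\<^sub>R \<phi> x + b *\<^sub>R \<psi> x)"
      by (intro smooth_add smooth_scaleR smooth_const s)
    ultimately show ?thesis using No_Slip div by simp
  qed
qed

lemma test_fields_H1: "\<phi> \<in> test_fields S \<Longrightarrow> \<phi> \<in> H1 \<Omega>"
  by (intro smooth_imp_H1 test_fields_smooth)

lemma test_fields_L2: "\<phi> \<in> test_fields S \<Longrightarrow> \<phi> \<in> L2 \<Omega>"
  by (intro H1_imp_L2 test_fields_H1)

end

subsection \<open>The embedding into $L^4$\<close>

context bounded_domain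
begin

lemma continuous_imp_integrable:
  fixes f :: "real^2 \<Rightarrow> 'b::{banach, second_countable_topology}"
  assumes f: "continuous_on UNIV f"
  shows "integrable M f"
proof -
  obtain C where "\<And>x. x \<in> \<Omega> \<Longrightarrow> norm (f x) \<le> C" using continuous_imp_bounded[OF f] by blast
  then show ?thesis
    by (intro finite_measure.integrable_const_bound[OF finite_M, of _ C] AE_I2 continuous_imp_measurable f) auto
qed

lemma nn_integral_enclosing_box:
  fixes F :: "real^2 \<Rightarrow> real"
  assumes F: "continuous_on UNIV F" "\<And>x. 0 \<le> F x" and sub: "\<Omega> \<subseteq> box lo hi"
    and out: "\<And>x. x \<in> box lo hi - \<Omega> \<Longrightarrow> F x = 0"
  shows "(\<integral>\<^sup>+x. ennreal (F x) * indicator (box lo hi) x \<partial>lborel) = ennreal (LINT x|M. F x)"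
proof -
  have "(\<integral>\<^sup>+x. ennreal (F x) * indicator (box lo hi) x \<partial>lborel) = (\<integral>\<^sup>+x. ennreal (F x) * indicator \<Omega> x \<partial>lborel)"
    using sub out by (intro nn_integral_cong) (auto simp: indicator_def)
  also have "\<dots> = (\<integral>\<^sup>+x. ennreal (F x) * indicator \<Omega> x \<partial>lebesgue)"
    by (simp add: nn_integral_completion)
  also have "\<dots> = (\<integral>\<^sup>+x. ennreal (F x) \<partial>M)"
    by (subst nn_integral_restrict_space) auto
  also have "\<dots> = ennreal (LINT x|M. F x)"
    using F by (intro nn_integral_eq_integral continuous_imp_integrable) auto
  finally show ?thesis .
qed

text \<open>The weak gradient of a difference is a choice separate from those for the two fields.
  Norms of differences, even the symmetry of the H1 distance, are therefore read off from gradients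
  that agree almost everywhere.\<close>

lemma h1_norm_cong:
  assumes u: "u \<in> H1 \<Omega>" and g: "\<And>i. g i \<in> L2 \<Omega>" "\<And>i. AE x in M. weak_pderiv \<Omega> i u x = g i x"
  shows "h1_norm \<Omega> u = sqrt ((l2_norm \<Omega> u)\<^sup>2 + (\<Sum>i\<in>UNIV. (l2_norm \<Omega> (g i))\<^sup>2))"
proof -
  have "l2_norm \<Omega> (weak_pderiv \<Omega> i u) = l2_norm \<Omega> (g i)" for i
    by (intro l2_norm_cong_AE weak_pderiv_spec u g)
  then show ?thesis by (simp add: h1_norm_def dirichlet_norm_power2[OF u])
qed

lemma h1_norm_diff:
  assumes "u \<in> H1 \<Omega>" "v \<in> H1 \<Omega>"
  shows "h1_norm \<Omega> (\<lambda>x. u x - v x) = sqrt ((l2_norm \<Omega> (\<lambda>x. u x - v x))\<^sup>2 +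
    (\<Sum>i\<in>UNIV. (l2_norm \<Omega> (\<lambda>x. weak_pderiv \<Omega> i u x - weak_pderiv \<Omega> i v x))\<^sup>2))"
  by (rule h1_norm_cong) (intro H1_diff L2_diff weak_pderiv_spec assms)+

lemma h1_norm_minus_commute:
  assumes "u \<in> H1 \<Omega>" "v \<in> H1 \<Omega>"
  shows "h1_norm \<Omega> (\<lambda>x. u x - v x) = h1_norm \<Omega> (\<lambda>x. v x - u x)"
proof -
  have "l2_norm \<Omega> (\<lambda>x. weak_pderiv \<Omega> i u x - weak_pderiv \<Omega> i v x) =
      l2_norm \<Omega> (\<lambda>x. weak_pderiv \<Omega> i v x - weak_pderiv \<Omega> i u x)" for i
    by (rule l2_norm_minus_commute)
  then show ?thesis
    unfolding h1_norm_diff[OF assms] h1_norm_diff[OF assms(2,1)] l2_norm_minus_commute[of u v] by simp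
qed

lemma h1_norm_diff_tendsto_0I:
  assumes "\<And>n. u n \<in> H1 \<Omega>" "v \<in> H1 \<Omega>" "(\<lambda>n. l2_norm \<Omega> (\<lambda>x. u n x - v x)) \<longlonglongrightarrow> 0"
    and "\<And>j. (\<lambda>n. l2_norm \<Omega> (\<lambda>x. weak_pderiv \<Omega> j (u n) x - weak_pderiv \<Omega> j v x)) \<longlonglongrightarrow> 0"
  shows "(\<lambda>n. h1_norm \<Omega> (\<lambda>x. u n x - v x)) \<longlonglongrightarrow> 0"
proof -
  have "(\<lambda>n. sqrt ((l2_norm \<Omega> (\<lambda>x. u n x - v x))\<^sup>2 +
    (\<Sum>i\<in>UNIV. (l2_norm \<Omega> (\<lambda>x. weak_pderiv \<Omega> i (u n) x - weak_pderiv \<Omega> i v x))\<^sup>2))) \<longlonglongrightarrow>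
    sqrt (0\<^sup>2 + (\<Sum>i\<in>(UNIV::2 set). 0\<^sup>2))"
    by (intro tendsto_intros assms)
  then show ?thesis using assms(1,2) by (simp add: h1_norm_diff)
qed

lemma l2_norm_tendsto_lincomb:
  assumes "\<And>n. u n \<in> L2 \<Omega>" "u' \<in> L2 \<Omega>" "\<And>n. v n \<in> L2 \<Omega>" "v' \<in> L2 \<Omega>"
    and "(\<lambda>n. l2_norm \<Omega> (\<lambda>x. u n x - u' x)) \<longlonglongrightarrow> 0" "(\<lambda>n. l2_norm \<Omega> (\<lambda>x. v n x - v' x)) \<longlonglongrightarrow> 0"
  shows "(\<lambda>n. l2_norm \<Omega> (\<lambda>x. (a *\<^sub>R u n x + b *\<^sub>R v n x) - (a *\<^sub>R u' x + b *\<^sub>R v' x))) \<longlonglongrightarrow> 0"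
proof (rule tendsto_sandwich[OF always_eventually always_eventually tendsto_const])
  show "\<forall>n. l2_norm \<Omega> (\<lambda>x. (a *\<^sub>R u n x + b *\<^sub>R v n x) - (a *\<^sub>R u' x + b *\<^sub>R v' x)) \<le>
      \<bar>a\<bar> * l2_norm \<Omega> (\<lambda>x. u n x - u' x) + \<bar>b\<bar> * l2_norm \<Omega> (\<lambda>x. v n x - v' x)"
  proof
    fix n
    have "(\<lambda>x. (a *\<^sub>R u n x + b *\<^sub>R v n x) - (a *\<^sub>R u' x + b *\<^sub>R v' x)) =
        (\<lambda>x. a *\<^sub>R (u n x - u' x) + b *\<^sub>R (v n x - v' x))"
      by (simp add: algebra_simps)
    then show "l2_norm \<Omega> (\<lambda>x. (a *\<^sub>R u n x + b *\<^sub>R v n x) - (a *\<^sub>R u' x + b *\<^sub>R v' x)) \<le>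
      \<bar>a\<bar> * l2_norm \<Omega> (\<lambda>x. u n x - u' x) + \<bar>b\<bar> * l2_norm \<Omega> (\<lambda>x. v n x - v' x)"
      using l2_norm_triangle[OF L2_scaleR[OF L2_diff[OF assms(1)[of n] assms(2)]] L2_scaleR[OF L2_diff[OF assms(3)[of n] assms(4)]], of a b]
      by (simp add: l2_norm_scaleR)
  qed
  have "(\<lambda>n. \<bar>a\<bar> * l2_norm \<Omega> (\<lambda>x. u n x - u' x) + \<bar>b\<bar> * l2_norm \<Omega> (\<lambda>x. v n x - v' x)) \<longlonglongrightarrow> \<bar>a\<bar> * 0 + \<bar>b\<bar> * 0"
    by (intro tendsto_intros assms)
  then show "(\<lambda>n. \<bar>a\<bar> * l2_norm \<Omega> (\<lambda>x. u n x - u' x) + \<bar>b\<bar> * l2_norm \<Omega> (\<lambda>x. v n x - v' x)) \<longlonglongrightarrow> 0" by simp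
qed simp

end

context flow_domain
begin

lemma scalar_tests_norm_square:
  assumes "\<phi> \<in> test_fields S"
  shows "(\<lambda>x. (norm (\<phi> x))\<^sup>2) \<in> scalar_tests S"
proof -
  have "(\<lambda>x. (norm (\<phi> x))\<^sup>2) = (\<lambda>x. \<phi> x $ 1 * \<phi> x $ 1 + \<phi> x $ 2 * \<phi> x $ 2)"
    by (simp add: power2_norm_eq_inner inner_vec_def sum_2)
  then show ?thesis using assms by (simp add: scalar_tests_add scalar_tests_mult test_fields_component)
qed

lemma pderiv_at_norm_square:
  assumes "smooth \<phi>"
  shows "pderiv_at i (\<lambda>x. (norm (\<phi> x))\<^sup>2) x = 2 * (\<phi> x \<bullet> pderiv_at i \<phi> x)"
  by (simp add: power2_norm_eq_inner pderiv_at_bilinear[OF bounded_bilinear_inner assms assms] inner_commute)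

text \<open>Ladyzhenskaya's bound is applied to \<open>g\<close>, the squared length of
  \<open>\<phi>\<close>. Since \<open>\<bar>pderiv_at i g x\<bar>\<close> is at most twice the
  product of the lengths of \<open>\<phi>\<close> and of its derivative, each of the two factors is
  bounded by a multiple of the squared H1 norm.\<close>

lemma test_fields_L4:
  obtains C where "C \<ge> 0" "\<And>\<phi>. \<phi> \<in> test_fields S \<Longrightarrow> (LINT x|M. (norm (\<phi> x))^4) \<le> C * (h1_norm \<Omega> \<phi>)^4"
proof -
  obtain lo hi where box: "\<Omega> \<subseteq> box lo hi" "\<And>k. lo $ k < hi $ k"
    "\<And>\<phi> x. \<phi> \<in> scalar_tests S \<Longrightarrow> x \<in> box lo hi - \<Omega> \<Longrightarrow> \<phi> x = 0 \<and> pderiv_at 1 \<phi> x = 0"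
    "\<And>\<phi> i t. \<phi> \<in> scalar_tests S \<Longrightarrow> \<phi> (pt i (lo $ i) t) = \<phi> (pt i (hi $ i) t)"
    using cell[of 1] by blast
  have out: "\<phi> x = 0" if "\<phi> \<in> scalar_tests S" "x \<in> box lo hi - \<Omega>" for \<phi> x
    using box(3)[OF that] by simp
  \<comment> \<open>The first summand comes from the average of \<open>g\<close> over the side of
    the box, the 2 from differentiating a square.\<close>
  define c where "c i = 1 / (hi $ i - lo $ i) + 2" for i
  have c: "0 \<le> c i" for i using box(2)[of i] by (simp add: c_def)
  have "(LINT x|M. (norm (\<phi> x))^4) \<le> (c 1 * c 2) * (h1_norm \<Omega> \<phi>)^4" if \<phi>: "\<phi> \<in> test_fields S" for \<phi>
  proof -
    let ?h = "h1_norm \<Omega> \<phi>"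
    define g where "g x = (norm (\<phi> x))\<^sup>2" for x
    define G where "G i x = g x / (hi $ i - lo $ i) + \<bar>pderiv_at i g x\<bar>" for i x
    have s: "smooth \<phi>" using \<phi> by (rule test_fields_smooth)
    have gT: "g \<in> scalar_tests S" unfolding g_def by (rule scalar_tests_norm_square[OF \<phi>])
    have sg: "smooth g" using gT by (rule scalar_tests_smooth)
    have dg: "pderiv_at i g x = 2 * (\<phi> x \<bullet> pderiv_at i \<phi> x)" for i x
      unfolding g_def by (rule pderiv_at_norm_square[OF s])
    have g0: "g x = 0" if "x \<in> box lo hi - \<Omega>" for x using out[OF gT that] .
    \<comment> \<open>The derivative of a squared length has \<open>\<phi> x\<close> as a factor, so
      it vanishes wherever \<open>\<phi>\<close> does. This treats both directions at once, whereas
      \<open>cell\<close> was instantiated for a single one.\<close>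
    have dg0: "pderiv_at i g x = 0" if "x \<in> box lo hi - \<Omega>" for i x
      using g0[OF that] by (simp add: dg) (simp add: g_def)
    have cg: "continuous_on UNIV g" "continuous_on UNIV (pderiv_at i g)" for i
      using sg by (auto intro: smooth_imp_continuous_on smooth_pderiv_at)
    have cG: "continuous_on UNIV (G i)" for i
      unfolding G_def using box(2)[of i] by (intro continuous_intros cg) auto
    have G_nonneg: "0 \<le> G i x" for i x
      using box(2)[of i] by (simp add: G_def g_def)
    have L: "\<phi> \<in> L2 \<Omega>" "pderiv_at i \<phi> \<in> L2 \<Omega>" for i
      by (intro continuous_imp_L2 smooth_imp_continuous_on smooth_pderiv_at s)+
    have ph: "l2_norm \<Omega> \<phi> \<le> ?h" "l2_norm \<Omega> (pderiv_at i \<phi>) \<le> ?h" for i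
      using l2_norm_le_h1_norm[of \<phi>] l2_norm_weak_pderiv_le[OF test_fields_H1[OF \<phi>], of i]
        l2_norm_cong_AE[OF weak_pderiv_spec(1)[OF test_fields_H1[OF \<phi>]] L(2) smooth_imp_H1(2)[OF s], of i]
      by simp_all
    have KG: "(LINT x|M. G i x) \<le> c i * ?h\<^sup>2" for i
    proof -
      have "(LINT x|M. \<bar>pderiv_at i g x\<bar>) \<le> (LINT x|M. 2 * (norm (\<phi> x) * norm (pderiv_at i \<phi> x)))"
        using L2_norm_mult(1)[OF L(1) L(2)[of i]] Cauchy_Schwarz_ineq2
        by (intro integral_mono continuous_imp_integrable continuous_intros cg) (auto simp: dg abs_mult intro: smooth_imp_continuous_on smooth_pderiv_at s)
      also have "\<dots> \<le> 2 * (l2_norm \<Omega> \<phi> * l2_norm \<Omega> (pderiv_at i \<phi>))"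
        using L2_norm_mult(2)[OF L(1) L(2)[of i]] by simp
      also have "\<dots> \<le> 2 * (?h * ?h)"
        using ph by (intro mult_left_mono mult_mono) auto
      finally have 1: "(LINT x|M. \<bar>pderiv_at i g x\<bar>) \<le> 2 * ?h\<^sup>2" by (simp add: power2_eq_square)
      have "(LINT x|M. g x / (hi $ i - lo $ i)) = (l2_norm \<Omega> \<phi>)\<^sup>2 / (hi $ i - lo $ i)"
        by (simp add: g_def l2_norm_square_integral)
      also have "\<dots> \<le> ?h\<^sup>2 / (hi $ i - lo $ i)"
        using ph(1) box(2)[of i] by (intro divide_right_mono power_mono) auto
      finally have 2: "(LINT x|M. g x / (hi $ i - lo $ i)) \<le> ?h\<^sup>2 / (hi $ i - lo $ i)" .
      have "(LINT x|M. G i x) = (LINT x|M. g x / (hi $ i - lo $ i)) + (LINT x|M. \<bar>pderiv_at i g x\<bar>)"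
        unfolding G_def using box(2)[of i]
        by (intro Bochner_Integration.integral_add continuous_imp_integrable continuous_intros cg) auto
      also have "\<dots> \<le> ?h\<^sup>2 / (hi $ i - lo $ i) + 2 * ?h\<^sup>2" using 1 2 by (rule add_mono[rotated])
      also have "\<dots> = c i * ?h\<^sup>2" by (simp add: c_def algebra_simps)
      finally show ?thesis .
    qed
    have "ennreal (LINT x|M. (g x)\<^sup>2) = (\<integral>\<^sup>+x. ennreal ((g x)\<^sup>2) * indicator (box lo hi) x \<partial>lborel)"
      by (rule nn_integral_enclosing_box[symmetric]) (use box(1) g0 in \<open>auto intro!: continuous_intros cg\<close>)
    also have "\<dots> \<le> (\<integral>\<^sup>+x. ennreal (G 1 x) * indicator (box lo hi) x \<partial>lborel) * (\<integral>\<^sup>+x. ennreal (G 2 x) * indicator (box lo hi) x \<partial>lborel)"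
      unfolding G_def by (rule nn_integral_square_box_le[OF sg _ box(2)]) (simp add: g_def)
    also have "\<dots> = ennreal (LINT x|M. G 1 x) * ennreal (LINT x|M. G 2 x)"
      using box(1) g0 dg0 by (subst (1 2) nn_integral_enclosing_box[OF cG G_nonneg]) (auto simp: G_def)
    also have "\<dots> = ennreal ((LINT x|M. G 1 x) * (LINT x|M. G 2 x))"
      using G_nonneg by (intro ennreal_mult[symmetric] Bochner_Integration.integral_nonneg) auto
    finally have "(LINT x|M. (g x)\<^sup>2) \<le> (LINT x|M. G 1 x) * (LINT x|M. G 2 x)"
      using G_nonneg by (subst (asm) ennreal_le_iff) (auto intro!: mult_nonneg_nonneg Bochner_Integration.integral_nonneg)
    also have "\<dots> \<le> (c 1 * ?h\<^sup>2) * (c 2 * ?h\<^sup>2)"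
      using KG c G_nonneg by (intro mult_mono Bochner_Integration.integral_nonneg) auto
    also have "\<dots> = (c 1 * c 2) * ?h ^ 4" by (simp add: power4_eq_xxxx power2_eq_square)
    finally show ?thesis by (simp add: g_def flip: power_mult)
  qed
  then show ?thesis using c by (intro that[of "c 1 * c 2"]) auto
qed

section \<open>The space V and its L4 bound\<close>

lemma V_imp_H1: "v \<in> V_space S \<Longrightarrow> v \<in> H1 \<Omega>"
  by (simp add: V_space_def)

lemma V_imp_L2: "v \<in> V_space S \<Longrightarrow> v \<in> L2 \<Omega>"
  by (intro H1_imp_L2 V_imp_H1)

lemma V_approx:
  assumes v: "v \<in> V_space S"
  obtains \<phi> where "\<And>n. \<phi> n \<in> test_fields S" "(\<lambda>n. h1_norm \<Omega> (\<lambda>x. \<phi> n x - v x)) \<longlonglongrightarrow> 0"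
proof -
  have "\<forall>n. \<exists>\<phi>\<in>test_fields S. h1_norm \<Omega> (\<lambda>x. v x - \<phi> x) < 1 / Suc n"
    using v by (auto simp: V_space_def)
  then obtain \<phi> where \<phi>: "\<And>n. \<phi> n \<in> test_fields S" "\<And>n. h1_norm \<Omega> (\<lambda>x. v x - \<phi> n x) < 1 / Suc n"
    by metis
  have "(\<lambda>n. h1_norm \<Omega> (\<lambda>x. \<phi> n x - v x)) \<longlonglongrightarrow> 0"
  proof (rule tendsto_sandwich[OF always_eventually always_eventually tendsto_const])
    show "\<forall>n. h1_norm \<Omega> (\<lambda>x. \<phi> n x - v x) \<le> 1 / Suc n"
      using \<phi>(2) by (simp add: h1_norm_minus_commute[OF test_fields_H1[OF \<phi>(1)] V_imp_H1[OF v]] less_imp_le)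
    show "(\<lambda>n. 1 / real (Suc n)) \<longlonglongrightarrow> 0" by (rule LIMSEQ_Suc[OF lim_1_over_n])
  qed simp
  with \<phi>(1) show ?thesis by (rule that)
qed

lemma V_spaceI:
  assumes v: "v \<in> H1 \<Omega>" and \<phi>: "\<And>n. \<phi> n \<in> test_fields S" and lim: "(\<lambda>n. h1_norm \<Omega> (\<lambda>x. \<phi> n x - v x)) \<longlonglongrightarrow> 0"
  shows "v \<in> V_space S"
proof -
  have "\<exists>\<psi>\<in>test_fields S. h1_norm \<Omega> (\<lambda>x. v x - \<psi> x) < e" if e: "e > 0" for e
  proof -
    obtain n where "h1_norm \<Omega> (\<lambda>x. \<phi> n x - v x) < e"
      using order_tendstoD(2)[OF lim e] by (auto simp: eventually_sequentially)
    then show ?thesis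
      using \<phi>[of n] h1_norm_minus_commute[OF v test_fields_H1[OF \<phi>[of n]]]
      by (intro bexI[of _ "\<phi> n"]) simp_all
  qed
  then show ?thesis using v by (auto simp: V_space_def)
qed

lemma test_fields_V:
  assumes \<phi>: "\<phi> \<in> test_fields S"
  shows "\<phi> \<in> V_space S"
proof (rule V_spaceI[OF test_fields_H1[OF \<phi>] \<phi>])
  have "h1_norm \<Omega> (\<lambda>x. \<phi> x - \<phi> x) = 0"
    unfolding h1_norm_diff[OF test_fields_H1[OF \<phi>] test_fields_H1[OF \<phi>]]
    by (simp add: l2_norm_def l2_inner_def)
  then show "(\<lambda>n. h1_norm \<Omega> (\<lambda>x. \<phi> x - \<phi> x)) \<longlonglongrightarrow> 0" by simp
qed

lemma V_lincomb:
  assumes u: "u \<in> V_space S" and v: "v \<in> V_space S"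
  shows "(\<lambda>x. a *\<^sub>R u x + b *\<^sub>R v x) \<in> V_space S"
proof -
  obtain \<phi> where \<phi>: "\<And>n. \<phi> n \<in> test_fields S" "(\<lambda>n. h1_norm \<Omega> (\<lambda>x. \<phi> n x - u x)) \<longlonglongrightarrow> 0"
    using V_approx[OF u] by blast
  obtain \<psi> where \<psi>: "\<And>n. \<psi> n \<in> test_fields S" "(\<lambda>n. h1_norm \<Omega> (\<lambda>x. \<psi> n x - v x)) \<longlonglongrightarrow> 0"
    using V_approx[OF v] by blast
  note H1 = V_imp_H1[OF u] V_imp_H1[OF v] test_fields_H1[OF \<phi>(1)] test_fields_H1[OF \<psi>(1)]
  note l\<phi> = h1_norm_tendsto[OF H1(3) H1(1) \<phi>(2)] and l\<psi> = h1_norm_tendsto[OF H1(4) H1(2) \<psi>(2)]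
  show ?thesis
  proof (rule V_spaceI[where \<phi> = "\<lambda>n x. a *\<^sub>R \<phi> n x + b *\<^sub>R \<psi> n x"])
    show "(\<lambda>n. h1_norm \<Omega> (\<lambda>x. a *\<^sub>R \<phi> n x + b *\<^sub>R \<psi> n x - (a *\<^sub>R u x + b *\<^sub>R v x))) \<longlonglongrightarrow> 0"
    proof (rule h1_norm_diff_tendsto_0I)
      show "(\<lambda>n. l2_norm \<Omega> (\<lambda>x. a *\<^sub>R \<phi> n x + b *\<^sub>R \<psi> n x - (a *\<^sub>R u x + b *\<^sub>R v x))) \<longlonglongrightarrow> 0"
        by (intro l2_norm_tendsto_lincomb H1_imp_L2 H1 l\<phi>(1) l\<psi>(1))
      fix j
      let ?D = "weak_pderiv \<Omega> j"
      have "l2_norm \<Omega> (\<lambda>x. ?D (\<lambda>x. a *\<^sub>R \<phi> n x + b *\<^sub>R \<psi> n x) x - ?D (\<lambda>x. a *\<^sub>R u x + b *\<^sub>R v x) x) =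
          l2_norm \<Omega> (\<lambda>x. (a *\<^sub>R ?D (\<phi> n) x + b *\<^sub>R ?D (\<psi> n) x) - (a *\<^sub>R ?D u x + b *\<^sub>R ?D v x))" for n
      proof (intro l2_norm_cong_AE L2_diff L2_lincomb weak_pderiv_spec H1 H1_lincomb)
        show "AE x in M. ?D (\<lambda>x. a *\<^sub>R \<phi> n x + b *\<^sub>R \<psi> n x) x - ?D (\<lambda>x. a *\<^sub>R u x + b *\<^sub>R v x) x =
            (a *\<^sub>R ?D (\<phi> n) x + b *\<^sub>R ?D (\<psi> n) x) - (a *\<^sub>R ?D u x + b *\<^sub>R ?D v x)"
          using H1_lincomb(2)[OF H1(3)[of n] H1(4)[of n], of j a b] H1_lincomb(2)[OF H1(1,2), of j a b]
          by eventually_elim simp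
      qed
      then show "(\<lambda>n. l2_norm \<Omega> (\<lambda>x. ?D (\<lambda>x. a *\<^sub>R \<phi> n x + b *\<^sub>R \<psi> n x) x - ?D (\<lambda>x. a *\<^sub>R u x + b *\<^sub>R v x) x)) \<longlonglongrightarrow> 0"
        using l2_norm_tendsto_lincomb[OF weak_pderiv_spec(1)[OF H1(3)] weak_pderiv_spec(1)[OF H1(1)]
            weak_pderiv_spec(1)[OF H1(4)] weak_pderiv_spec(1)[OF H1(2)] l\<phi>(2)[of j] l\<psi>(2)[of j], of a b]
        by simp
    qed (intro H1_lincomb H1)+
  qed (intro H1_lincomb H1 test_fields_lincomb \<phi> \<psi>)+
qed

lemma V_diff: "u \<in> V_space S \<Longrightarrow> v \<in> V_space S \<Longrightarrow> (\<lambda>x. u x - v x) \<in> V_space S"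
  using V_lincomb[of u v 1 "-1"] by simp

lemma V_scaleR: "u \<in> V_space S \<Longrightarrow> (\<lambda>x. a *\<^sub>R u x) \<in> V_space S"
  using V_lincomb[of u u a 0] by simp

lemma V_sum:
  assumes "finite A" "A \<noteq> {}" "\<And>i. i \<in> A \<Longrightarrow> u i \<in> V_space S"
  shows "(\<lambda>x. \<Sum>i\<in>A. c i *\<^sub>R u i x) \<in> V_space S"
  using assms
proof (induction rule: finite_ne_induct)
  case (insert i A)
  then show ?case using V_lincomb[of "u i" "\<lambda>x. \<Sum>i\<in>A. c i *\<^sub>R u i x" "c i" 1] by simp
qed (simp add: V_scaleR)

text \<open>Density: an approximating sequence of test fields has a subsequence converging almost
  everywhere, and Fatou's lemma passes the bound to the limit because the H1 norms converge.\<close>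

lemma V_L4:
  obtains C where "C \<ge> 0" "\<And>v. v \<in> V_space S \<Longrightarrow> integrable M (\<lambda>x. (norm (v x))^4)"
    "\<And>v. v \<in> V_space S \<Longrightarrow> (LINT x|M. (norm (v x))^4) \<le> C * (h1_norm \<Omega> v)^4"
proof -
  obtain C where C: "C \<ge> 0" "\<And>\<phi>. \<phi> \<in> test_fields S \<Longrightarrow> (LINT x|M. (norm (\<phi> x))^4) \<le> C * (h1_norm \<Omega> \<phi>)^4"
    using test_fields_L4 by blast
  have "integrable M (\<lambda>x. (norm (v x))^4) \<and> (LINT x|M. (norm (v x))^4) \<le> C * (h1_norm \<Omega> v)^4"
    if v: "v \<in> V_space S" for v
  proof -
    obtain \<phi> where \<phi>: "\<And>n. \<phi> n \<in> test_fields S" "(\<lambda>n. h1_norm \<Omega> (\<lambda>x. \<phi> n x - v x)) \<longlonglongrightarrow> 0"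
      using V_approx[OF v] by blast
    note lim = h1_norm_tendsto[OF test_fields_H1[OF \<phi>(1)] V_imp_H1[OF v] \<phi>(2)]
    obtain r where r: "strict_mono r" "AE x in M. (\<lambda>n. \<phi> (r n) x) \<longlonglongrightarrow> v x"
      using L2_convergent_AE_subseq[OF test_fields_L2[OF \<phi>(1)] V_imp_L2[OF v] lim(1)] by blast
    have [measurable]: "v \<in> borel_measurable M" using V_imp_L2[OF v] by (simp add: L2_def)
    have int: "integrable M (\<lambda>x. (norm (\<phi> (r n) x))^4)" for n
      by (intro continuous_imp_integrable continuous_intros smooth_imp_continuous_on test_fields_smooth \<phi>)
    have nonneg: "0 \<le> (norm (\<phi> (r n) x))^4" for n x by simp
    have meas: "(\<lambda>x. (norm (v x))^4) \<in> borel_measurable M" by measurable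
    have conv: "AE x in M. (\<lambda>n. (norm (\<phi> (r n) x))^4) \<longlonglongrightarrow> (norm (v x))^4"
      using r(2) by eventually_elim (intro tendsto_intros)
    have bound: "(LINT x|M. (norm (\<phi> (r n) x))^4) \<le> C * (h1_norm \<Omega> (\<phi> (r n)))^4" for n
      by (rule C(2)[OF \<phi>(1)])
    have c: "(\<lambda>n. C * (h1_norm \<Omega> (\<phi> (r n)))^4) \<longlonglongrightarrow> C * (h1_norm \<Omega> v)^4"
      using LIMSEQ_subseq_LIMSEQ[OF lim(3) r(1)] by (intro tendsto_intros) (simp add: o_def)
    show ?thesis
      using integrable_Fatou[OF int nonneg meas conv bound c] by blast
  qed
  then show ?thesis using C(1) that by blast
qed

lemma L4_product:
  assumes u: "u \<in> borel_measurable M" "integrable M (\<lambda>x. (norm (u x))^4)"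
    and w: "w \<in> borel_measurable M" "integrable M (\<lambda>x. (norm (w x))^4)"
  shows "integrable M (\<lambda>x. (norm (u x) * norm (w x))\<^sup>2)"
    and "(LINT x|M. (norm (u x) * norm (w x))\<^sup>2) \<le> sqrt (LINT x|M. (norm (u x))^4) * sqrt (LINT x|M. (norm (w x))^4)"
proof -
  note [measurable] = u(1) w(1)
  have "integrable M (\<lambda>x. (norm (u x))\<^sup>2 * (norm (w x))\<^sup>2)"
    and "\<bar>LINT x|M. (norm (u x))\<^sup>2 * (norm (w x))\<^sup>2\<bar> \<le> sqrt (LINT x|M. ((norm (u x))\<^sup>2)\<^sup>2) * sqrt (LINT x|M. ((norm (w x))\<^sup>2)\<^sup>2)"
    by (rule integral_Cauchy_Schwarz; use u w in \<open>simp flip: power_mult\<close>)+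
  then show "integrable M (\<lambda>x. (norm (u x) * norm (w x))\<^sup>2)"
    and "(LINT x|M. (norm (u x) * norm (w x))\<^sup>2) \<le> sqrt (LINT x|M. (norm (u x))^4) * sqrt (LINT x|M. (norm (w x))^4)"
    by (simp_all add: power_mult_distrib flip: power_mult)
qed

text \<open>Hoelder's inequality with exponents 2, 4, 4, obtained from two applications of
  Cauchy-Schwarz.\<close>

lemma trilinear_integrable:
  assumes u: "u \<in> V_space S" and w: "w \<in> V_space S" and g: "g \<in> L2 \<Omega>"
  shows "integrable M (\<lambda>x. norm (g x) * (norm (u x) * norm (w x)))"
    and "(LINT x|M. norm (g x) * (norm (u x) * norm (w x))) \<le>
      l2_norm \<Omega> g * sqrt (sqrt (LINT x|M. (norm (u x))^4) * sqrt (LINT x|M. (norm (w x))^4))"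
proof -
  obtain C where L4: "\<And>v. v \<in> V_space S \<Longrightarrow> integrable M (\<lambda>x. (norm (v x))^4)" using V_L4 by blast
  have [measurable]: "u \<in> borel_measurable M" "w \<in> borel_measurable M" "g \<in> borel_measurable M"
    using V_imp_L2[OF u] V_imp_L2[OF w] g by (auto simp: L2_def)
  note P = L4_product[OF \<open>u \<in> borel_measurable M\<close> L4[OF u] \<open>w \<in> borel_measurable M\<close> L4[OF w]]
  show "integrable M (\<lambda>x. norm (g x) * (norm (u x) * norm (w x)))"
    by (rule integral_Cauchy_Schwarz(1)) (use P(1) L2_integrable[OF g] in auto)
  have "\<bar>LINT x|M. norm (g x) * (norm (u x) * norm (w x))\<bar> \<le>
      sqrt (LINT x|M. (norm (g x))\<^sup>2) * sqrt (LINT x|M. (norm (u x) * norm (w x))\<^sup>2)"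
    by (rule integral_Cauchy_Schwarz(2)) (use P(1) L2_integrable[OF g] in auto)
  also have "\<dots> \<le> l2_norm \<Omega> g * sqrt (sqrt (LINT x|M. (norm (u x))^4) * sqrt (LINT x|M. (norm (w x))^4))"
    using P(2) by (intro mult_mono) (auto simp: l2_norm_square_integral[symmetric])
  finally show "(LINT x|M. norm (g x) * (norm (u x) * norm (w x))) \<le>
      l2_norm \<Omega> g * sqrt (sqrt (LINT x|M. (norm (u x))^4) * sqrt (LINT x|M. (norm (w x))^4))" by simp
qed

end

subsection \<open>The trilinear form\<close>

context flow_domain
begin

lemma convection_integrable:
  assumes u: "u \<in> V_space S" and w: "w \<in> V_space S" and g: "g \<in> L2 \<Omega>"
  shows "integrable M (\<lambda>x. (u x $ j *\<^sub>R g x) \<bullet> w x)"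
    and "\<bar>LINT x|M. (u x $ j *\<^sub>R g x) \<bullet> w x\<bar> \<le>
      l2_norm \<Omega> g * sqrt (sqrt (LINT x|M. (norm (u x))^4) * sqrt (LINT x|M. (norm (w x))^4))"
proof -
  have [measurable]: "u \<in> borel_measurable M" "w \<in> borel_measurable M" "g \<in> borel_measurable M"
    using V_imp_L2[OF u] V_imp_L2[OF w] g by (auto simp: L2_def)
  have [measurable]: "(\<lambda>x. u x $ j) \<in> borel_measurable M"
    by (rule borel_measurable_continuous_on[where f = "\<lambda>y::real^2. y $ j"]) (auto intro: continuous_intros)
  have le: "norm ((u x $ j *\<^sub>R g x) \<bullet> w x) \<le> norm (norm (g x) * (norm (u x) * norm (w x)))" for x
  proof -
    have "\<bar>u x $ j * (g x \<bullet> w x)\<bar> \<le> norm (u x) * (norm (g x) * norm (w x))"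
      unfolding abs_mult by (intro mult_mono component_le_norm_cart Cauchy_Schwarz_ineq2) auto
    then show ?thesis by (simp add: ac_simps)
  qed
  show int: "integrable M (\<lambda>x. (u x $ j *\<^sub>R g x) \<bullet> w x)"
    by (rule Bochner_Integration.integrable_bound[OF trilinear_integrable(1)[OF u w g]])
      (use le in \<open>auto intro!: AE_I2 simp del: inner_scaleR_left\<close>)
  have "\<bar>LINT x|M. (u x $ j *\<^sub>R g x) \<bullet> w x\<bar> \<le> (LINT x|M. norm ((u x $ j *\<^sub>R g x) \<bullet> w x))"
    using integral_norm_bound[of M "\<lambda>x. (u x $ j *\<^sub>R g x) \<bullet> w x"] by simp
  also have "\<dots> \<le> (LINT x|M. norm (g x) * (norm (u x) * norm (w x)))"
    using le by (intro integral_mono integrable_norm int trilinear_integrable(1) u w g) (simp del: inner_scaleR_left)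
  also note trilinear_integrable(2)[OF u w g]
  finally show "\<bar>LINT x|M. (u x $ j *\<^sub>R g x) \<bullet> w x\<bar> \<le>
      l2_norm \<Omega> g * sqrt (sqrt (LINT x|M. (norm (u x))^4) * sqrt (LINT x|M. (norm (w x))^4))" .
qed

text \<open>\<open>B\<close> is the integral of a sum. The L4 bound makes each summand integrable,
  which justifies taking the sum outside and lets linearity be checked one direction at a
  time.\<close>

lemma B_eq_sum:
  assumes u: "u \<in> V_space S" and v: "v \<in> V_space S" and w: "w \<in> V_space S"
  shows "B S u v w = (\<Sum>j\<in>UNIV. LINT x|M. (u x $ j *\<^sub>R weak_pderiv \<Omega> j v x) \<bullet> w x)"
  unfolding B_def l2_inner_def inner_sum_left
  by (intro Bochner_Integration.integral_sum convection_integrable(1) u w weak_pderiv_spec V_imp_H1 v)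

lemma B_bound:
  obtains C where "C \<ge> 0" "\<And>u v w. u \<in> V_space S \<Longrightarrow> v \<in> V_space S \<Longrightarrow> w \<in> V_space S \<Longrightarrow>
    \<bar>B S u v w\<bar> \<le> C * (h1_norm \<Omega> u * h1_norm \<Omega> v * h1_norm \<Omega> w)"
proof -
  obtain C where C: "C \<ge> 0" and L4: "\<And>v. v \<in> V_space S \<Longrightarrow> (LINT x|M. (norm (v x))^4) \<le> C * (h1_norm \<Omega> v)^4"
    using V_L4 by metis
  \<comment> \<open>One summand for each of the two directions; in each the L4 norms of
    \<open>u\<close> and \<open>w\<close> contribute a fourth root of \<open>C\<close>
    apiece.\<close>
  have "\<bar>B S u v w\<bar> \<le> (2 * sqrt C) * (h1_norm \<Omega> u * h1_norm \<Omega> v * h1_norm \<Omega> w)"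
    if u: "u \<in> V_space S" and v: "v \<in> V_space S" and w: "w \<in> V_space S" for u v w
  proof -
    let ?hu = "h1_norm \<Omega> u" and ?hv = "h1_norm \<Omega> v" and ?hw = "h1_norm \<Omega> w"
    have s: "sqrt (C * h ^ 4) = sqrt C * h\<^sup>2" for h :: real
    proof -
      have "sqrt (h ^ 4) = h\<^sup>2" by (rule real_sqrt_unique) (simp_all flip: power_mult)
      then show ?thesis by (simp add: real_sqrt_mult)
    qed
    have "sqrt (LINT x|M. (norm (u x))^4) * sqrt (LINT x|M. (norm (w x))^4) \<le> sqrt (C * ?hu^4) * sqrt (C * ?hw^4)"
      using C by (intro mult_mono real_sqrt_le_mono L4 u w) auto
    also have "\<dots> = C * (?hu * ?hw)\<^sup>2" using C by (simp add: s power_mult_distrib)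
    finally have "sqrt (sqrt (LINT x|M. (norm (u x))^4) * sqrt (LINT x|M. (norm (w x))^4)) \<le> sqrt (C * (?hu * ?hw)\<^sup>2)"
      by (rule real_sqrt_le_mono)
    also have "\<dots> = sqrt C * (?hu * ?hw)" by (simp add: real_sqrt_mult)
    finally have *: "sqrt (sqrt (LINT x|M. (norm (u x))^4) * sqrt (LINT x|M. (norm (w x))^4)) \<le> sqrt C * (?hu * ?hw)" .
    have "\<bar>LINT x|M. (u x $ j *\<^sub>R weak_pderiv \<Omega> j v x) \<bullet> w x\<bar> \<le> ?hv * (sqrt C * (?hu * ?hw))" for j
      by (rule order.trans[OF convection_integrable(2)[OF u w weak_pderiv_spec(1)[OF V_imp_H1[OF v]]]])
        (intro mult_mono l2_norm_weak_pderiv_le V_imp_H1 v *, auto)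
    then have "(\<Sum>j\<in>UNIV. \<bar>LINT x|M. (u x $ j *\<^sub>R weak_pderiv \<Omega> j v x) \<bullet> w x\<bar>) \<le> (\<Sum>j\<in>(UNIV :: 2 set). ?hv * (sqrt C * (?hu * ?hw)))"
      by (intro sum_mono)
    then show ?thesis
      unfolding B_eq_sum[OF u v w] by (intro order.trans[OF sum_abs]) (simp add: ac_simps)
  qed
  then show ?thesis using C by (intro that[of "2 * sqrt C"]) auto
qed

section \<open>Linearity of the trilinear form in each argument\<close>

lemma B_lincomb1:
  assumes u: "u \<in> V_space S" "u' \<in> V_space S" and v: "v \<in> V_space S" and w: "w \<in> V_space S"
  shows "B S (\<lambda>x. a *\<^sub>R u x + b *\<^sub>R u' x) v w = a * B S u v w + b * B S u' v w"
proof -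
  have "(LINT x|M. ((a *\<^sub>R u x + b *\<^sub>R u' x) $ j *\<^sub>R weak_pderiv \<Omega> j v x) \<bullet> w x) =
      a * (LINT x|M. (u x $ j *\<^sub>R weak_pderiv \<Omega> j v x) \<bullet> w x) + b * (LINT x|M. (u' x $ j *\<^sub>R weak_pderiv \<Omega> j v x) \<bullet> w x)" for j
  proof -
    have "((a *\<^sub>R u x + b *\<^sub>R u' x) $ j *\<^sub>R weak_pderiv \<Omega> j v x) \<bullet> w x =
      a * ((u x $ j *\<^sub>R weak_pderiv \<Omega> j v x) \<bullet> w x) + b * ((u' x $ j *\<^sub>R weak_pderiv \<Omega> j v x) \<bullet> w x)" for x
      by (simp add: algebra_simps)
    then show ?thesis
      using convection_integrable(1)[OF u(1) w weak_pderiv_spec(1)[OF V_imp_H1[OF v], of j], of j]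
        convection_integrable(1)[OF u(2) w weak_pderiv_spec(1)[OF V_imp_H1[OF v], of j], of j]
      by (simp del: inner_scaleR_left)
  qed
  then show ?thesis
    by (simp only: B_eq_sum[OF V_lincomb[OF u] v w] B_eq_sum[OF u(1) v w] B_eq_sum[OF u(2) v w]
        sum.distrib sum_distrib_left)
qed

text \<open>Unlike the other arguments, the second enters through \<open>weak_pderiv\<close>, whose
  linearity holds only almost everywhere.\<close>

lemma B_lincomb2:
  assumes u: "u \<in> V_space S" and v: "v \<in> V_space S" "v' \<in> V_space S" and w: "w \<in> V_space S"
  shows "B S u (\<lambda>x. a *\<^sub>R v x + b *\<^sub>R v' x) w = a * B S u v w + b * B S u v' w"
proof -
  let ?D = "weak_pderiv \<Omega>"
  have "(LINT x|M. (u x $ j *\<^sub>R ?D j (\<lambda>x. a *\<^sub>R v x + b *\<^sub>R v' x) x) \<bullet> w x) =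
      a * (LINT x|M. (u x $ j *\<^sub>R ?D j v x) \<bullet> w x) + b * (LINT x|M. (u x $ j *\<^sub>R ?D j v' x) \<bullet> w x)" for j
  proof -
    note int = convection_integrable(1)[OF u w weak_pderiv_spec(1)[OF V_imp_H1]]
    have "(LINT x|M. (u x $ j *\<^sub>R ?D j (\<lambda>x. a *\<^sub>R v x + b *\<^sub>R v' x) x) \<bullet> w x) =
      (LINT x|M. a * ((u x $ j *\<^sub>R ?D j v x) \<bullet> w x) + b * ((u x $ j *\<^sub>R ?D j v' x) \<bullet> w x))"
    proof (rule integral_cong_AE)
      show "(\<lambda>x. (u x $ j *\<^sub>R ?D j (\<lambda>x. a *\<^sub>R v x + b *\<^sub>R v' x) x) \<bullet> w x) \<in> borel_measurable M"
        by (rule borel_measurable_integrable[OF int[OF V_lincomb[OF v]]])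
      show "(\<lambda>x. a * ((u x $ j *\<^sub>R ?D j v x) \<bullet> w x) + b * ((u x $ j *\<^sub>R ?D j v' x) \<bullet> w x)) \<in> borel_measurable M"
        using int[OF v(1), of j j] int[OF v(2), of j j]
        by (intro borel_measurable_add borel_measurable_times borel_measurable_const borel_measurable_integrable)
      show "AE x in M. (u x $ j *\<^sub>R ?D j (\<lambda>x. a *\<^sub>R v x + b *\<^sub>R v' x) x) \<bullet> w x =
          a * ((u x $ j *\<^sub>R ?D j v x) \<bullet> w x) + b * ((u x $ j *\<^sub>R ?D j v' x) \<bullet> w x)"
        using H1_lincomb(2)[OF V_imp_H1[OF v(1)] V_imp_H1[OF v(2)], of j a b]
        by eventually_elim (simp add: algebra_simps)
    qed
    also have "\<dots> = a * (LINT x|M. (u x $ j *\<^sub>R ?D j v x) \<bullet> w x) + b * (LINT x|M. (u x $ j *\<^sub>R ?D j v' x) \<bullet> w x)"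
      using int[OF v(1), of j j] int[OF v(2), of j j] by (simp del: inner_scaleR_left)
    finally show ?thesis .
  qed
  then show ?thesis
    by (simp only: B_eq_sum[OF u V_lincomb[OF v] w] B_eq_sum[OF u v(1) w] B_eq_sum[OF u v(2) w]
        sum.distrib sum_distrib_left)
qed

lemma B_lincomb3:
  assumes u: "u \<in> V_space S" and v: "v \<in> V_space S" and w: "w \<in> V_space S" "w' \<in> V_space S"
  shows "B S u v (\<lambda>x. a *\<^sub>R w x + b *\<^sub>R w' x) = a * B S u v w + b * B S u v w'"
proof -
  have "(LINT x|M. (u x $ j *\<^sub>R weak_pderiv \<Omega> j v x) \<bullet> (a *\<^sub>R w x + b *\<^sub>R w' x)) =
      a * (LINT x|M. (u x $ j *\<^sub>R weak_pderiv \<Omega> j v x) \<bullet> w x) + b * (LINT x|M. (u x $ j *\<^sub>R weak_pderiv \<Omega> j v x) \<bullet> w' x)" for j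
    using convection_integrable(1)[OF u w(1) weak_pderiv_spec(1)[OF V_imp_H1[OF v], of j], of j]
      convection_integrable(1)[OF u w(2) weak_pderiv_spec(1)[OF V_imp_H1[OF v], of j], of j]
    by (simp add: inner_add_right del: inner_scaleR_left)
  then show ?thesis
    by (simp only: B_eq_sum[OF u v V_lincomb[OF w]] B_eq_sum[OF u v w(1)] B_eq_sum[OF u v w(2)]
        sum.distrib sum_distrib_left)
qed

lemma B_sum1:
  assumes "finite A" "A \<noteq> {}" and "\<And>i. i \<in> A \<Longrightarrow> u i \<in> V_space S" and "v \<in> V_space S" "w \<in> V_space S"
  shows "B S (\<lambda>x. \<Sum>i\<in>A. c i *\<^sub>R u i x) v w = (\<Sum>i\<in>A. c i * B S (u i) v w)"
  using assms
proof (induction rule: finite_ne_induct)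
  case (singleton i)
  then show ?case using B_lincomb1[of "u i" "u i" v w "c i" 0] by simp
next
  case (insert i A)
  then show ?case
    using B_lincomb1[of "u i" "\<lambda>x. \<Sum>i\<in>A. c i *\<^sub>R u i x" v w "c i" 1] by (simp add: V_sum)
qed

lemma B_sum2:
  assumes "finite A" "A \<noteq> {}" and "\<And>i. i \<in> A \<Longrightarrow> v i \<in> V_space S" and "u \<in> V_space S" "w \<in> V_space S"
  shows "B S u (\<lambda>x. \<Sum>i\<in>A. c i *\<^sub>R v i x) w = (\<Sum>i\<in>A. c i * B S u (v i) w)"
  using assms
proof (induction rule: finite_ne_induct)
  case (singleton i)
  then show ?case using B_lincomb2[of u "v i" "v i" w "c i" 0] by simp
next
  case (insert i A)
  then show ?case
    using B_lincomb2[of u "v i" "\<lambda>x. \<Sum>i\<in>A. c i *\<^sub>R v i x" w "c i" 1] by (simp add: V_sum)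
qed

lemma B_sum3:
  assumes "finite A" "A \<noteq> {}" and "\<And>i. i \<in> A \<Longrightarrow> w i \<in> V_space S" and "u \<in> V_space S" "v \<in> V_space S"
  shows "B S u v (\<lambda>x. \<Sum>i\<in>A. c i *\<^sub>R w i x) = (\<Sum>i\<in>A. c i * B S u v (w i))"
  using assms
proof (induction rule: finite_ne_induct)
  case (singleton i)
  then show ?case using B_lincomb3[of u v "w i" "w i" "c i" 0] by simp
next
  case (insert i A)
  then show ?case
    using B_lincomb3[of u v "w i" "\<lambda>x. \<Sum>i\<in>A. c i *\<^sub>R w i x" "c i" 1] by (simp add: V_sum)
qed

text \<open>Pointwise the integrand is half the divergence of \<open>\<phi>\<close> times its
  squared length, minus half that squared length times the divergence of \<open>\<phi>\<close>. The
  latter divergence is 0, and the former integrates to 0 because \<open>p j\<close> is again a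
  scalar test.\<close>

lemma B_test_fields_eq_0:
  assumes \<phi>: "\<phi> \<in> test_fields S"
  shows "B S \<phi> \<phi> \<phi> = 0"
proof -
  have s: "smooth \<phi>" using \<phi> by (rule test_fields_smooth)
  define p where "p j x = \<phi> x $ j * (norm (\<phi> x))\<^sup>2" for j x
  have pT: "p j \<in> scalar_tests S" for j
    unfolding p_def by (intro scalar_tests_mult test_fields_component scalar_tests_norm_square \<phi>)
  have sg: "smooth (\<lambda>x. (norm (\<phi> x))\<^sup>2)" by (rule scalar_tests_smooth[OF scalar_tests_norm_square[OF \<phi>]])
  have dp: "pderiv_at j (p j) x = \<phi> x $ j * (2 * (\<phi> x \<bullet> pderiv_at j \<phi> x)) + pderiv_at j \<phi> x $ j * (norm (\<phi> x))\<^sup>2" for j x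
    unfolding p_def
    by (simp add: pderiv_at_bilinear[OF bounded_bilinear_mult smooth_vec_nth[OF s] sg] pderiv_at_norm_square[OF s]
        pderiv_at_vec_nth[OF s])
  have pointwise: "(\<Sum>j\<in>UNIV. (\<phi> x $ j *\<^sub>R pderiv_at j \<phi> x) \<bullet> \<phi> x) = (\<Sum>j\<in>UNIV. 1/2 * pderiv_at j (p j) x)" for x
  proof -
    have "(\<Sum>j\<in>UNIV. 1/2 * pderiv_at j (p j) x) =
        (\<Sum>j\<in>UNIV. (\<phi> x $ j *\<^sub>R pderiv_at j \<phi> x) \<bullet> \<phi> x) + 1/2 * (norm (\<phi> x))\<^sup>2 * divergence \<phi> x"
      by (simp add: dp divergence_def sum_2 inner_commute algebra_simps)
    then show ?thesis using test_fields_divergence[OF \<phi>] by simp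
  qed
  have \<phi>V: "\<phi> \<in> V_space S" by (rule test_fields_V[OF \<phi>])
  have L: "pderiv_at j \<phi> \<in> L2 \<Omega>" for j
    by (intro continuous_imp_L2 smooth_imp_continuous_on smooth_pderiv_at s)
  note int = convection_integrable(1)[OF \<phi>V \<phi>V]
  have "B S \<phi> \<phi> \<phi> = (\<Sum>j\<in>UNIV. LINT x|M. (\<phi> x $ j *\<^sub>R pderiv_at j \<phi> x) \<bullet> \<phi> x)"
    unfolding B_eq_sum[OF \<phi>V \<phi>V \<phi>V]
  proof (intro sum.cong refl integral_cong_AE)
    fix j
    show "AE x in M. (\<phi> x $ j *\<^sub>R weak_pderiv \<Omega> j \<phi> x) \<bullet> \<phi> x = (\<phi> x $ j *\<^sub>R pderiv_at j \<phi> x) \<bullet> \<phi> x"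
      using smooth_imp_H1(2)[OF s, of j] by eventually_elim simp
  qed (rule borel_measurable_integrable, rule int, intro L weak_pderiv_spec V_imp_H1 \<phi>V)+
  also have "\<dots> = (LINT x|M. (\<Sum>j\<in>UNIV. (\<phi> x $ j *\<^sub>R pderiv_at j \<phi> x) \<bullet> \<phi> x))"
    by (intro Bochner_Integration.integral_sum[symmetric] int L)
  also have "\<dots> = (LINT x|M. (\<Sum>j\<in>UNIV. 1/2 * pderiv_at j (p j) x))"
    by (simp only: pointwise)
  also have "\<dots> = (\<Sum>j\<in>UNIV. LINT x|M. 1/2 * pderiv_at j (p j) x)"
    by (intro Bochner_Integration.integral_sum continuous_imp_integrable continuous_intros smooth_imp_continuous_on
        smooth_pderiv_at scalar_tests_smooth[OF pT])
  also have "\<dots> = 0" by (simp add: integral_pderiv_scalar_tests_eq_0[OF pT])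
  finally show ?thesis .
qed

lemma B_diff1: "u \<in> V_space S \<Longrightarrow> u' \<in> V_space S \<Longrightarrow> v \<in> V_space S \<Longrightarrow> w \<in> V_space S \<Longrightarrow>
    B S (\<lambda>x. u x - u' x) v w = B S u v w - B S u' v w"
  using B_lincomb1[of u u' v w 1 "-1"] by simp

lemma B_diff2: "u \<in> V_space S \<Longrightarrow> v \<in> V_space S \<Longrightarrow> v' \<in> V_space S \<Longrightarrow> w \<in> V_space S \<Longrightarrow>
    B S u (\<lambda>x. v x - v' x) w = B S u v w - B S u v' w"
  using B_lincomb2[of u v v' w 1 "-1"] by simp

lemma B_diff3: "u \<in> V_space S \<Longrightarrow> v \<in> V_space S \<Longrightarrow> w \<in> V_space S \<Longrightarrow> w' \<in> V_space S \<Longrightarrow>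
    B S u v (\<lambda>x. w x - w' x) = B S u v w - B S u v w'"
  using B_lincomb3[of u v w w' 1 "-1"] by simp

text \<open>Approximation by test fields, for which the form vanishes; the trilinear bound controls
  the error.\<close>

lemma B_self_eq_0:
  assumes v: "v \<in> V_space S"
  shows "B S v v v = 0"
proof -
  obtain C where C: "C \<ge> 0" "\<And>u v w. u \<in> V_space S \<Longrightarrow> v \<in> V_space S \<Longrightarrow> w \<in> V_space S \<Longrightarrow>
    \<bar>B S u v w\<bar> \<le> C * (h1_norm \<Omega> u * h1_norm \<Omega> v * h1_norm \<Omega> w)" using B_bound by blast
  obtain \<phi> where \<phi>: "\<And>n. \<phi> n \<in> test_fields S" "(\<lambda>n. h1_norm \<Omega> (\<lambda>x. \<phi> n x - v x)) \<longlonglongrightarrow> 0"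
    using V_approx[OF v] by blast
  note \<phi>V = test_fields_V[OF \<phi>(1)]
  note lim = h1_norm_tendsto(3)[OF test_fields_H1[OF \<phi>(1)] V_imp_H1[OF v] \<phi>(2)]
  define d where "d n x = \<phi> n x - v x" for n x
  have dV: "d n \<in> V_space S" for n unfolding d_def by (rule V_diff[OF \<phi>V v])
  let ?h = "h1_norm \<Omega>"
  have "\<bar>B S v v v\<bar> \<le> C * (?h (d n) * ?h v * ?h v) + C * (?h (\<phi> n) * ?h (d n) * ?h v) + C * (?h (\<phi> n) * ?h (\<phi> n) * ?h (d n))" for n
  proof -
    \<comment> \<open>The arguments are replaced one at a time, so that each summand contains one
      difference \<open>d n\<close> and the sum telescopes.\<close>
    have "B S (d n) v v + B S (\<phi> n) (d n) v + B S (\<phi> n) (\<phi> n) (d n) = B S (\<phi> n) (\<phi> n) (\<phi> n) - B S v v v"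
      unfolding d_def by (simp add: B_diff1 B_diff2 B_diff3 \<phi>V v)
    then have "B S v v v = - (B S (d n) v v + B S (\<phi> n) (d n) v + B S (\<phi> n) (\<phi> n) (d n))"
      by (simp add: B_test_fields_eq_0[OF \<phi>(1)])
    then show ?thesis
      using C(2)[OF dV[of n] v v] C(2)[OF \<phi>V[of n] dV[of n] v] C(2)[OF \<phi>V[of n] \<phi>V[of n] dV[of n]] by linarith
  qed
  moreover have "(\<lambda>n. C * (?h (d n) * ?h v * ?h v) + C * (?h (\<phi> n) * ?h (d n) * ?h v) + C * (?h (\<phi> n) * ?h (\<phi> n) * ?h (d n)))
      \<longlonglongrightarrow> C * (0 * ?h v * ?h v) + C * (?h v * 0 * ?h v) + C * (?h v * ?h v * 0)"
    by (intro tendsto_intros lim \<phi>(2)[folded d_def])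
  ultimately have "\<bar>B S v v v\<bar> \<le> C * (0 * ?h v * ?h v) + C * (?h v * 0 * ?h v) + C * (?h v * ?h v * 0)"
    by (intro LIMSEQ_le_const) auto
  then show ?thesis by simp
qed

end

subsection \<open>Periodization and the Laplacian\<close>

text \<open>Each coordinate is reduced modulo \<open>L\<close> into the half-open interval from 0 to
  \<open>L\<close>. This makes a periodic test out of one supported in the cell, which links the
  derivatives in the periodic \<open>H2\<close> to \<open>weak_pderiv\<close>.\<close>

definition periodize :: "real \<Rightarrow> (real^2 \<Rightarrow> real) \<Rightarrow> real^2 \<Rightarrow> real" where
  "periodize L \<phi> x = \<phi> (\<chi> k. x $ k - L * of_int \<lfloor>x $ k / L\<rfloor>)"

lemma periodize_eq:
  assumes L: "L > 0" and x: "x \<in> region (Periodic L)"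
  shows "periodize L \<phi> x = \<phi> x"
proof -
  have "0 < x $ k" "x $ k < L" for k using x by auto
  then have "\<lfloor>x $ k / L\<rfloor> = 0" for k using L by (simp add: floor_eq_iff less_imp_le)
  then show ?thesis by (simp add: periodize_def)
qed

lemma periodize_periodic:
  assumes L: "L > 0" shows "periodize L \<phi> (x + axis i L) = periodize L \<phi> x"
proof -
  have "(x + axis i L) $ k - L * of_int \<lfloor>(x + axis i L) $ k / L\<rfloor> = x $ k - L * of_int \<lfloor>x $ k / L\<rfloor>" for k
  proof (cases "k = i")
    case True
    then have "(x + axis i L) $ k / L = x $ k / L + 1" using L by (simp add: field_simps)
    then have "\<lfloor>(x + axis i L) $ k / L\<rfloor> = \<lfloor>x $ k / L\<rfloor> + 1" using floor_add_int[of "x $ k / L" 1] by simp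
    then show ?thesis using True by (simp add: algebra_simps)
  qed (simp add: axis_def)
  then show ?thesis by (simp only: periodize_def)
qed

text \<open>
  Near the lattice lines both the periodization and a translate of \<open>\<phi>\<close> vanish, because the support
  of \<open>\<phi>\<close> keeps the distance \<open>d\<close> from the boundary of the cell.
\<close>

lemma smooth_periodize:
  assumes L: "L > 0" and \<phi>: "smooth \<phi>" and d: "d > 0"
    and margin: "\<And>x k. \<phi> x \<noteq> 0 \<Longrightarrow> d \<le> x $ k \<and> x $ k \<le> L - d"
  shows "smooth (periodize L \<phi>)"
proof (rule smooth_local)
  fix x :: "real^2"
  define e where "e = min d L"
  have e: "e > 0" "e \<le> d" "e \<le> L" using L d by (auto simp: e_def)
  define m where "m k = real_of_int \<lfloor>x $ k / L\<rfloor>" for k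
  have m: "L * m k \<le> x $ k" "x $ k < L * m k + L" for k
  proof -
    have "m k \<le> x $ k / L" "x $ k / L < m k + 1" unfolding m_def by linarith+
    then show "L * m k \<le> x $ k" "x $ k < L * m k + L" using L by (auto simp: field_simps)
  qed
  define g where "g y = \<phi> (y + (\<chi> k. - (L * m k)))" for y
  have "smooth g"
    unfolding g_def using smooth_compose_affine[OF \<phi> bounded_linear_ident] by simp
  moreover have "periodize L \<phi> y = g y" if y: "y \<in> ball x e" for y
  proof -
    define n where "n k = real_of_int \<lfloor>y $ k / L\<rfloor>" for k
    have near: "\<bar>y $ k - x $ k\<bar> < e" for k
      using component_le_norm_cart[of "y - x" k] y by (simp add: dist_norm norm_minus_commute)
    have n: "L * n k \<le> y $ k" "y $ k < L * n k + L" for k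
    proof -
      have "n k \<le> y $ k / L" "y $ k / L < n k + 1" unfolding n_def by linarith+
      then show "L * n k \<le> y $ k" "y $ k < L * n k + L" using L by (auto simp: field_simps)
    qed
    have p: "periodize L \<phi> y = \<phi> (\<chi> k. y $ k - L * n k)" by (simp add: periodize_def n_def)
    have g: "g y = \<phi> (\<chi> k. y $ k - L * m k)"
      unfolding g_def by (rule arg_cong[of _ _ \<phi>]) (simp add: vec_eq_iff)
    show ?thesis
    proof (cases "\<forall>k. n k = m k")
      case True
      then show ?thesis by (simp add: p g)
    next
      case False
      then obtain k where k: "n k \<noteq> m k" by blast
      have step: "n k \<ge> m k + 1 \<or> n k \<le> m k - 1"
      proof -
        have "\<lfloor>y $ k / L\<rfloor> \<ge> \<lfloor>x $ k / L\<rfloor> + 1 \<or> \<lfloor>y $ k / L\<rfloor> \<le> \<lfloor>x $ k / L\<rfloor> - 1"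
          using k by (auto simp: n_def m_def)
        then show ?thesis unfolding n_def m_def by linarith
      qed
      have "\<phi> (\<chi> k. y $ k - L * m k) = 0"
      proof (rule ccontr)
        assume "\<phi> (\<chi> k. y $ k - L * m k) \<noteq> 0"
        from margin[OF this, of k] have r: "d \<le> y $ k - L * m k" "y $ k - L * m k \<le> L - d" by simp_all
        from step show False
        proof
          assume "n k \<ge> m k + 1"
          then have "L * (m k + 1) \<le> L * n k" using L by (intro mult_left_mono) auto
          then show False using n(1)[of k] r d by (simp add: algebra_simps)
        next
          assume "n k \<le> m k - 1"
          then have "L * n k \<le> L * (m k - 1)" using L by (intro mult_left_mono) auto
          then show False using n(2)[of k] r d by (simp add: algebra_simps)
        qed
      qed
      \<comment> \<open>Now \<open>y\<close> is viewed in its own cell. As \<open>x\<close> lies in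
        a different cell in direction \<open>k\<close> and is closer than \<open>d\<close>, the
        point \<open>y\<close> is closer than \<open>d\<close> to a face, inside the margin where
        \<open>\<phi>\<close> vanishes.\<close>
      moreover have "\<phi> (\<chi> k. y $ k - L * n k) = 0"
      proof (rule ccontr)
        assume "\<phi> (\<chi> k. y $ k - L * n k) \<noteq> 0"
        from margin[OF this, of k] have r: "d \<le> y $ k - L * n k" "y $ k - L * n k \<le> L - d" by simp_all
        from step show False
        proof
          assume "n k \<ge> m k + 1"
          then have "L * (m k + 1) \<le> L * n k" using L by (intro mult_left_mono) auto
          then show False using m(2)[of k] near[of k] r e by (simp add: algebra_simps)
        next
          assume "n k \<le> m k - 1"
          then have "L * n k \<le> L * (m k - 1)" using L by (intro mult_left_mono) auto
          then show False using m(1)[of k] near[of k] r e by (simp add: algebra_simps)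
        qed
      qed
      ultimately show ?thesis by (simp add: p g)
    qed
  qed
  ultimately show "\<exists>U g. open U \<and> x \<in> U \<and> smooth g \<and> (\<forall>y\<in>U. periodize L \<phi> y = g y)"
    using e by (intro exI[of _ "ball x e"] exI[of _ g]) auto
qed

lemma test_function_margin:
  assumes L: "L > 0" and \<phi>: "\<phi> \<in> test_functions (region (Periodic L))"
  obtains d where "d > 0" "\<And>x k. \<phi> x \<noteq> 0 \<Longrightarrow> d \<le> x $ k \<and> x $ k \<le> L - d"
proof -
  let ?K = "closure {x. \<phi> x \<noteq> 0}"
  have K: "compact ?K" "?K \<subseteq> region (Periodic L)"
    using \<phi> by (auto simp: test_functions_def compact_support_in_def simp del: region.simps)
  have "open (region (Periodic L))" unfolding region_Periodic by (rule open_box)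
  then have cl: "closed (- region (Periodic L))" by (rule closed_Compl)
  have disj: "?K \<inter> - region (Periodic L) = {}" using K(2) by blast
  obtain d where d: "d > 0" "\<And>x y. x \<in> ?K \<Longrightarrow> y \<in> - region (Periodic L) \<Longrightarrow> d \<le> dist x y"
    using separate_compact_closed[OF K(1) cl disj] by blast
  have "d \<le> x $ k \<and> x $ k \<le> L - d" if "\<phi> x \<noteq> 0" for x k
  proof -
    have xK: "x \<in> ?K"
      by (rule subsetD[OF closure_subset]) (use that in simp)
    have "x \<in> region (Periodic L)" by (rule subsetD[OF K(2) xK])
    then have x: "0 < x $ k" "x $ k < L" by auto
    \<comment> \<open>Moving \<open>x\<close> in direction \<open>k\<close> to the face at 0 or at
      \<open>L\<close> leaves the open cell, so the distance of the support from the complement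
      bounds the distance to that face.\<close>
    define y where "y c = (\<chi> j. if j = k then c else x $ j)" for c
    have dist: "dist x (y c) = \<bar>x $ k - c\<bar>" for c
    proof -
      have "x - y c = axis k (x $ k - c)" by (simp add: y_def axis_def vec_eq_iff)
      then show ?thesis by (simp add: dist_norm norm_eq_sqrt_inner inner_axis_axis)
    qed
    have "y 0 \<in> - region (Periodic L)" "y L \<in> - region (Periodic L)"
      by (auto simp: y_def intro!: exI[of _ k])
    from this[THEN d(2)[OF xK]] show ?thesis using x by (simp add: dist)
  qed
  with d(1) show ?thesis by (rule that)
qed

context bounded_domain
begin

lemma l2_inner_tendsto_right:
  assumes p: "p \<in> L2 \<Omega>" and q: "\<And>n. q n \<in> L2 \<Omega>" and r: "r \<in> L2 \<Omega>"
    and lim: "(\<lambda>n. l2_norm \<Omega> (\<lambda>x. q n x - r x)) \<longlonglongrightarrow> 0"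
  shows "(\<lambda>n. l2_inner \<Omega> p (q n)) \<longlonglongrightarrow> l2_inner \<Omega> p r"
proof (rule LIM_zero_cancel, rule tendsto_rabs_zero_cancel,
    rule tendsto_sandwich[OF always_eventually always_eventually tendsto_const])
  show "\<forall>n. \<bar>l2_inner \<Omega> p (q n) - l2_inner \<Omega> p r\<bar> \<le> l2_norm \<Omega> p * l2_norm \<Omega> (\<lambda>x. q n x - r x)"
    using l2_Cauchy_Schwarz[OF p L2_diff[OF q r]] by (simp add: l2_inner_diff_right p q r)
  show "(\<lambda>n. l2_norm \<Omega> p * l2_norm \<Omega> (\<lambda>x. q n x - r x)) \<longlonglongrightarrow> 0"
    using tendsto_mult_right_zero[OF lim] .
qed simp

end

context flow_domain
begin

text \<open>Only the periodic case needs an argument. The periodization of a compactly supported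
  test is a periodic test, and on \<Omega> the two have the same values and derivatives.\<close>

lemma scalar_tests_imp_test_functions:
  assumes u: "has_weak_pderiv (scalar_tests S) \<Omega> i u g"
  shows "has_weak_pderiv (test_functions \<Omega>) \<Omega> i u g"
proof (cases S)
  case (No_Slip D)
  then show ?thesis using u by simp
next
  case (Periodic L)
  have L: "L > 0" using admissible Periodic by simp
  show ?thesis
    unfolding has_weak_pderiv_def
  proof
    fix \<phi> assume \<phi>: "\<phi> \<in> test_functions \<Omega>"
    obtain d where d: "d > 0" "\<And>x k. \<phi> x \<noteq> 0 \<Longrightarrow> d \<le> x $ k \<and> x $ k \<le> L - d"
      using test_function_margin[OF L \<phi>[unfolded Periodic]] by blast
    let ?p = "periodize L \<phi>"
    have s: "smooth \<phi>" using \<phi> by (rule test_functions_smooth)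
    have "?p \<in> scalar_tests S"
      using smooth_periodize[OF L s d] periodize_periodic[OF L]
      by (simp add: Periodic periodic_test_functions_def)
    from has_weak_pderivD[OF u this]
    have *: "(LINT x|M. pderiv_at i ?p x *\<^sub>R u x) = - (LINT x|M. ?p x *\<^sub>R g x)" .
    have eq: "?p x = \<phi> x" if "x \<in> \<Omega>" for x
      using periodize_eq[OF L] that Periodic by simp
    have deq: "pderiv_at i ?p x = pderiv_at i \<phi> x" if x: "x \<in> \<Omega>" for x
    proof -
      have "(?p has_derivative frechet_derivative \<phi> (at x)) (at x)"
        by (rule has_derivative_transform_within_open[OF smooth_imp_has_derivative[OF s] \<Omega>_open x])
          (simp add: eq)
      from pderiv_at_eqI[OF this] show ?thesis by (simp add: pderiv_at_def)
    qed
    have "(LINT x|M. pderiv_at i ?p x *\<^sub>R u x) = (LINT x|M. pderiv_at i \<phi> x *\<^sub>R u x)"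
      by (intro Bochner_Integration.integral_cong refl) (simp add: deq space_restrict_space)
    moreover have "(LINT x|M. ?p x *\<^sub>R g x) = (LINT x|M. \<phi> x *\<^sub>R g x)"
      by (intro Bochner_Integration.integral_cong refl) (simp add: eq space_restrict_space)
    ultimately show "(LINT x|M. pderiv_at i \<phi> x *\<^sub>R u x) = - (LINT x|M. \<phi> x *\<^sub>R g x)"
      using * by simp
  qed
qed

text \<open>\<open>H2\<close> provides some derivatives with respect to the scalar tests. They are
  also weak derivatives in the sense of \<open>H1\<close>, so uniqueness transfers the stronger
  property to the chosen \<open>weak_pderiv\<close>.\<close>

lemma H2_weak_pderivs:
  assumes v: "v \<in> H2 S"
  shows "has_weak_pderiv (scalar_tests S) \<Omega> i v (weak_pderiv \<Omega> i v)"
    and "weak_pderiv \<Omega> i v \<in> H1 \<Omega>"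
    and "has_weak_pderiv (scalar_tests S) \<Omega> j (weak_pderiv \<Omega> i v) (weak_pderiv \<Omega> j (weak_pderiv \<Omega> i v))"
proof -
  have vL: "v \<in> L2 \<Omega>" using v by (simp add: H2_eq sobolev2_def)
  obtain g where g: "g \<in> L2 \<Omega>" "has_weak_pderiv (scalar_tests S) \<Omega> i v g"
    and ex: "\<And>j. \<exists>k\<in>L2 \<Omega>. has_weak_pderiv (scalar_tests S) \<Omega> j g k"
    using v unfolding H2_eq sobolev2_def by blast
  let ?D = "weak_pderiv \<Omega> i v"
  have D: "?D \<in> L2 \<Omega>" "AE x in M. ?D x = g x"
    using weak_pderiv_eq[OF g(1) scalar_tests_imp_test_functions[OF g(2)]] by auto
  then have D': "AE x in M. g x = ?D x" by (auto elim: eventually_mono)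
  show "has_weak_pderiv (scalar_tests S) \<Omega> i v ?D"
    by (rule has_weak_pderiv_cong_AE[OF scalar_tests_smooth vL vL g(1) D(1) _ D' g(2)]) auto
  have k: "\<exists>k\<in>L2 \<Omega>. has_weak_pderiv (scalar_tests S) \<Omega> j ?D k" for j
  proof -
    obtain k where k: "k \<in> L2 \<Omega>" "has_weak_pderiv (scalar_tests S) \<Omega> j g k" using ex by blast
    have "has_weak_pderiv (scalar_tests S) \<Omega> j ?D k"
      by (rule has_weak_pderiv_cong_AE[OF scalar_tests_smooth g(1) D(1) k(1) k(1) D' _ k(2)]) auto
    then show ?thesis using k(1) by blast
  qed
  then have "\<exists>k\<in>L2 \<Omega>. has_weak_pderiv (test_functions \<Omega>) \<Omega> j ?D k" for j
    using scalar_tests_imp_test_functions by blast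
  then show DH1: "?D \<in> H1 \<Omega>" using D(1) by (auto simp: H1_def)
  obtain k where kk: "k \<in> L2 \<Omega>" "has_weak_pderiv (scalar_tests S) \<Omega> j ?D k" using k by blast
  have "weak_pderiv \<Omega> j ?D \<in> L2 \<Omega>" "AE x in M. weak_pderiv \<Omega> j ?D x = k x"
    using weak_pderiv_eq[OF kk(1) scalar_tests_imp_test_functions[OF kk(2)]] by auto
  then have "weak_pderiv \<Omega> j ?D \<in> L2 \<Omega>" "AE x in M. k x = weak_pderiv \<Omega> j ?D x"
    by (auto elim: eventually_mono)
  then show "has_weak_pderiv (scalar_tests S) \<Omega> j ?D (weak_pderiv \<Omega> j ?D)"
    by (intro has_weak_pderiv_cong_AE[OF scalar_tests_smooth D(1) D(1) kk(1) _ _ _ kk(2)]) auto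
qed

lemma laplacian_L2: "v \<in> H2 S \<Longrightarrow> laplacian \<Omega> v \<in> L2 \<Omega>"
  unfolding laplacian_def by (intro L2_sum weak_pderiv_spec H2_weak_pderivs(2))

text \<open>Weak derivatives are tested with scalar functions. Testing with the component
  \<open>k\<close> of \<open>\<phi>\<close>, reading off the component \<open>k\<close> of the
  identity and summing gives the pairing with a field.\<close>

lemma weak_pderiv_vector_test:
  assumes u: "u \<in> L2 \<Omega>" and g: "g \<in> L2 \<Omega>" and w: "has_weak_pderiv (scalar_tests S) \<Omega> i u g"
    and \<phi>: "\<phi> \<in> test_fields S"
  shows "l2_inner \<Omega> u (pderiv_at i \<phi>) = - l2_inner \<Omega> g \<phi>"
proof -
  have s: "smooth \<phi>" using \<phi> by (rule test_fields_smooth)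
  have int: "integrable M (\<lambda>x. \<psi> x *\<^sub>R v x)" if "smooth \<psi>" "v \<in> L2 \<Omega>" for \<psi> and v :: field
    using that by (intro L2_imp_integrable L2_mult_continuous smooth_imp_continuous_on)
  have comp: "(LINT x|M. \<psi> x *\<^sub>R v x) $ k = (LINT x|M. \<psi> x * v x $ k)"
    and comp_int: "integrable M (\<lambda>x. \<psi> x * v x $ k)" if "smooth \<psi>" "v \<in> L2 \<Omega>" for \<psi> and v :: field and k
    using integral_bounded_linear[OF bounded_linear_vec_nth int[OF that], of k]
      integrable_bounded_linear[OF bounded_linear_vec_nth int[OF that], of k] by simp_all
  have dp: "pderiv_at i (\<lambda>x. \<phi> x $ k) x = pderiv_at i \<phi> x $ k" for k x by (rule pderiv_at_vec_nth[OF s])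
  have sk: "smooth (\<lambda>x. \<phi> x $ k)" "smooth (\<lambda>x. pderiv_at i \<phi> x $ k)" for k
    by (intro smooth_vec_nth smooth_pderiv_at s)+
  have "(LINT x|M. pderiv_at i \<phi> x $ k * u x $ k) = - (LINT x|M. \<phi> x $ k * g x $ k)" for k
  proof -
    have "(LINT x|M. pderiv_at i \<phi> x $ k *\<^sub>R u x) $ k = (- (LINT x|M. \<phi> x $ k *\<^sub>R g x)) $ k"
      using has_weak_pderivD[OF w test_fields_component[OF \<phi>, of k]] by (simp only: dp)
    then show ?thesis by (simp add: comp sk u g)
  qed
  then have "(\<Sum>k\<in>UNIV. LINT x|M. pderiv_at i \<phi> x $ k * u x $ k) = - (\<Sum>k\<in>UNIV. LINT x|M. \<phi> x $ k * g x $ k)"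
    by (simp add: sum_negf)
  moreover have "l2_inner \<Omega> u (pderiv_at i \<phi>) = (\<Sum>k\<in>UNIV. LINT x|M. pderiv_at i \<phi> x $ k * u x $ k)"
    using Bochner_Integration.integral_sum[of UNIV M "\<lambda>k x. pderiv_at i \<phi> x $ k * u x $ k", OF comp_int[OF sk(2) u]]
    by (simp add: l2_inner_def inner_vec_def mult.commute)
  moreover have "l2_inner \<Omega> g \<phi> = (\<Sum>k\<in>UNIV. LINT x|M. \<phi> x $ k * g x $ k)"
    using Bochner_Integration.integral_sum[of UNIV M "\<lambda>k x. \<phi> x $ k * g x $ k", OF comp_int[OF sk(1) g]]
    by (simp add: l2_inner_def inner_vec_def mult.commute)
  ultimately show ?thesis by simp
qed

text \<open>Green's formula. Periodic test fields do not vanish near the boundary of the cell, so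
  the integration by parts needs second derivatives tested against periodic functions, which
  \<open>H2\<close> supplies. Both sides are continuous in \<open>w\<close> for the H1 norm, and
  test fields are dense in V.\<close>

lemma laplacian_inner:
  assumes v: "v \<in> H2 S" and vV: "v \<in> V_space S" and w: "w \<in> V_space S"
  shows "l2_inner \<Omega> (laplacian \<Omega> v) w = - dirichlet_inner \<Omega> v w"
proof -
  let ?D = "weak_pderiv \<Omega>"
  have DL: "?D j v \<in> L2 \<Omega>" "?D j (?D j v) \<in> L2 \<Omega>" for j
    using weak_pderiv_spec(1)[OF V_imp_H1[OF vV]] weak_pderiv_spec(1)[OF H2_weak_pderivs(2)[OF v]] by auto
  have test: "l2_inner \<Omega> (laplacian \<Omega> v) \<phi> = - dirichlet_inner \<Omega> v \<phi>" if \<phi>: "\<phi> \<in> test_fields S" for \<phi>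
  proof -
    have "l2_inner \<Omega> (laplacian \<Omega> v) \<phi> = (\<Sum>j\<in>UNIV. 1 * l2_inner \<Omega> (?D j (?D j v)) \<phi>)"
      unfolding laplacian_def
      using l2_inner_sum_left[of UNIV "\<lambda>j. ?D j (?D j v)" \<phi> "\<lambda>_. 1"] DL test_fields_L2[OF \<phi>] by simp
    also have "\<dots> = (\<Sum>j\<in>UNIV. - l2_inner \<Omega> (?D j v) (pderiv_at j \<phi>))"
      using weak_pderiv_vector_test[OF DL(1) DL(2) H2_weak_pderivs(3)[OF v] \<phi>] by simp
    also have "\<dots> = (\<Sum>j\<in>UNIV. - l2_inner \<Omega> (?D j v) (?D j \<phi>))"
    proof (intro sum.cong refl arg_cong[of _ _ uminus])
      fix j
      have "l2_inner \<Omega> (?D j \<phi>) (?D j v) = l2_inner \<Omega> (pderiv_at j \<phi>) (?D j v)"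
        by (intro l2_inner_cong_AE weak_pderiv_spec test_fields_H1 \<phi> DL smooth_imp_H1 test_fields_smooth
            continuous_imp_L2 smooth_imp_continuous_on smooth_pderiv_at)
      then show "l2_inner \<Omega> (?D j v) (pderiv_at j \<phi>) = l2_inner \<Omega> (?D j v) (?D j \<phi>)"
        by (simp add: l2_inner_commute[of "?D j v"])
    qed
    also have "\<dots> = - dirichlet_inner \<Omega> v \<phi>"
      by (simp add: dirichlet_inner_eq_sum V_imp_H1[OF vV] test_fields_H1[OF \<phi>] sum_negf)
    finally show ?thesis .
  qed
  obtain \<phi> where \<phi>: "\<And>n. \<phi> n \<in> test_fields S" "(\<lambda>n. h1_norm \<Omega> (\<lambda>x. \<phi> n x - w x)) \<longlonglongrightarrow> 0"
    using V_approx[OF w] by blast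
  note H1s = test_fields_H1[OF \<phi>(1)] V_imp_H1[OF w] V_imp_H1[OF vV]
  note lim = h1_norm_tendsto[OF H1s(1,2) \<phi>(2)]
  have "(\<lambda>n. l2_inner \<Omega> (laplacian \<Omega> v) (\<phi> n)) \<longlonglongrightarrow> l2_inner \<Omega> (laplacian \<Omega> v) w"
    by (intro l2_inner_tendsto_right laplacian_L2 v test_fields_L2 \<phi> V_imp_L2 w lim(1))
  moreover have "(\<lambda>n. - dirichlet_inner \<Omega> v (\<phi> n)) \<longlonglongrightarrow> - dirichlet_inner \<Omega> v w"
    unfolding dirichlet_inner_eq_sum[OF H1s(3) H1s(1)] dirichlet_inner_eq_sum[OF H1s(3) H1s(2)]
    by (intro tendsto_minus tendsto_sum l2_inner_tendsto_right DL weak_pderiv_spec H1s lim(2))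
  ultimately show ?thesis
    unfolding test[OF \<phi>(1)] by (rule LIMSEQ_unique)
qed

section \<open>The space H\<close>

lemma H_imp_L2: "u \<in> H_space S \<Longrightarrow> u \<in> L2 \<Omega>"
  by (simp add: H_space_def)

lemma V_imp_H:
  assumes v: "v \<in> V_space S" shows "v \<in> H_space S"
proof -
  have "\<exists>\<phi>\<in>test_fields S. l2_norm \<Omega> (\<lambda>x. v x - \<phi> x) < e" if e: "e > 0" for e
  proof -
    obtain \<phi> where "\<phi> \<in> test_fields S" "h1_norm \<Omega> (\<lambda>x. v x - \<phi> x) < e"
      using v e unfolding V_space_def by blast
    then show ?thesis
      by (intro bexI[of _ \<phi>] order.strict_trans1[OF l2_norm_le_h1_norm])
  qed
  then show ?thesis using V_imp_L2[OF v] by (simp add: H_space_def)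
qed

lemma H_approx:
  assumes u: "u \<in> H_space S"
  obtains \<phi> where "\<And>n. \<phi> n \<in> test_fields S" "(\<lambda>n. l2_norm \<Omega> (\<lambda>x. \<phi> n x - u x)) \<longlonglongrightarrow> 0"
proof -
  have "\<forall>n. \<exists>\<phi>\<in>test_fields S. l2_norm \<Omega> (\<lambda>x. u x - \<phi> x) < 1 / Suc n"
    using u by (auto simp: H_space_def)
  then obtain \<phi> where \<phi>: "\<And>n. \<phi> n \<in> test_fields S" "\<And>n. l2_norm \<Omega> (\<lambda>x. u x - \<phi> n x) < 1 / Suc n"
    by metis
  have "(\<lambda>n. l2_norm \<Omega> (\<lambda>x. \<phi> n x - u x)) \<longlonglongrightarrow> 0"
  proof (rule tendsto_sandwich[OF always_eventually always_eventually tendsto_const])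
    show "\<forall>n. l2_norm \<Omega> (\<lambda>x. \<phi> n x - u x) \<le> 1 / Suc n"
      using \<phi>(2) by (simp add: l2_norm_minus_commute[of "\<phi> _" u] less_imp_le)
    show "(\<lambda>n. 1 / real (Suc n)) \<longlonglongrightarrow> 0" by (rule LIMSEQ_Suc[OF lim_1_over_n])
  qed simp
  with \<phi>(1) show ?thesis by (rule that)
qed

lemma H_closed:
  assumes u: "u \<in> L2 \<Omega>" and h: "\<And>n. h n \<in> H_space S" and lim: "(\<lambda>n. l2_norm \<Omega> (\<lambda>x. h n x - u x)) \<longlonglongrightarrow> 0"
  shows "u \<in> H_space S"
proof -
  have "\<exists>\<psi>\<in>test_fields S. l2_norm \<Omega> (\<lambda>x. u x - \<psi> x) < e" if e: "e > 0" for e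
  proof -
    have "e / 2 > 0" using e by simp
    from order_tendstoD(2)[OF lim this] obtain n where n: "l2_norm \<Omega> (\<lambda>x. h n x - u x) < e / 2"
      by (auto simp: eventually_sequentially)
    obtain \<psi> where \<psi>: "\<psi> \<in> test_fields S" "l2_norm \<Omega> (\<lambda>x. h n x - \<psi> x) < e / 2"
      using h[of n] e unfolding H_space_def by (auto dest!: spec[of _ "e / 2"])
    have "l2_norm \<Omega> (\<lambda>x. u x - \<psi> x) \<le> l2_norm \<Omega> (\<lambda>x. u x - h n x) + l2_norm \<Omega> (\<lambda>x. h n x - \<psi> x)"
      using l2_norm_triangle[OF L2_diff[OF u H_imp_L2[OF h]] L2_diff[OF H_imp_L2[OF h] test_fields_L2[OF \<psi>(1)]], of n n]
      by simp
    also have "\<dots> < e" using n \<psi>(2) l2_norm_minus_commute[of u "h n"] by simp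
    finally show ?thesis using \<psi>(1) by blast
  qed
  then show ?thesis using u by (auto simp: H_space_def)
qed

lemma test_fields_H: "\<phi> \<in> test_fields S \<Longrightarrow> \<phi> \<in> H_space S"
  by (intro V_imp_H test_fields_V)

lemma H_lincomb:
  assumes u: "u \<in> H_space S" and v: "v \<in> H_space S"
  shows "(\<lambda>x. a *\<^sub>R u x + b *\<^sub>R v x) \<in> H_space S"
proof -
  obtain \<phi> where \<phi>: "\<And>n. \<phi> n \<in> test_fields S" "(\<lambda>n. l2_norm \<Omega> (\<lambda>x. \<phi> n x - u x)) \<longlonglongrightarrow> 0"
    using H_approx[OF u] by blast
  obtain \<psi> where \<psi>: "\<And>n. \<psi> n \<in> test_fields S" "(\<lambda>n. l2_norm \<Omega> (\<lambda>x. \<psi> n x - v x)) \<longlonglongrightarrow> 0"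
    using H_approx[OF v] by blast
  show ?thesis
    by (rule H_closed[where h = "\<lambda>n x. a *\<^sub>R \<phi> n x + b *\<^sub>R \<psi> n x"])
      (intro L2_lincomb H_imp_L2 u v test_fields_H test_fields_lincomb l2_norm_tendsto_lincomb test_fields_L2 \<phi> \<psi>)+
qed

lemma H_diff: "u \<in> H_space S \<Longrightarrow> v \<in> H_space S \<Longrightarrow> (\<lambda>x. u x - v x) \<in> H_space S"
  using H_lincomb[of u v 1 "-1"] by simp

end

subsection \<open>Zeros of coercive maps\<close>

text \<open>Normalisation to the unit sphere. Points of \<open>nsphere n\<close> are sequences that
  vanish beyond coordinate \<open>n\<close>, hence the cut.\<close>

definition radial :: "nat \<Rightarrow> (nat \<Rightarrow> real) \<Rightarrow> nat \<Rightarrow> real" where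
  "radial n y = (\<lambda>i. if i \<le> n then y i / sqrt (\<Sum>j\<le>n. (y j)\<^sup>2) else 0)"

lemma nsphere_eq: "nsphere n = top_of_set {x. (\<Sum>i\<le>n. (x i)\<^sup>2) = 1 \<and> (\<forall>i>n. x i = 0)}"
  by (simp add: nsphere euclidean_product_topology)

text \<open>A continuous family that misses the origin becomes a homotopy of maps into the sphere
  after normalisation. It suffices to control the first n + 1 coordinates.\<close>

lemma homotopic_radial:
  fixes k :: "real \<times> (nat \<Rightarrow> real) \<Rightarrow> nat \<Rightarrow> real"
  assumes cont: "\<And>i. i \<le> n \<Longrightarrow> continuous_on UNIV (\<lambda>z. k z i)"
    and nz: "\<And>t x. 0 \<le> t \<Longrightarrow> t \<le> 1 \<Longrightarrow> (\<Sum>i\<le>n. (x i)\<^sup>2) = 1 \<Longrightarrow> \<exists>i\<le>n. k (t, x) i \<noteq> 0"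
  shows "homotopic_with (\<lambda>_. True) (nsphere n) (nsphere n) (\<lambda>x. radial n (k (0, x))) (\<lambda>x. radial n (k (1, x)))"
proof -
  define T where "T = {x. (\<Sum>i\<le>n. (x i)\<^sup>2) = (1::real) \<and> (\<forall>i>n. x i = 0)}"
  have pos: "0 < (\<Sum>j\<le>n. (k (t, x) j)\<^sup>2)" if t: "0 \<le> t" "t \<le> 1" and x: "x \<in> T" for t x
  proof -
    obtain i where "i \<le> n" "k (t, x) i \<noteq> 0" using nz[OF t, of x] x by (auto simp: T_def)
    then show ?thesis by (intro sum_pos2[of _ i]) auto
  qed
  have "continuous_on ({0..1} \<times> T) (\<lambda>z. radial n (k z))"
    unfolding radial_def
  proof (intro continuous_on_coordinatewise_then_product)
    fix i
    show "continuous_on ({0..1} \<times> T) (\<lambda>z. if i \<le> n then k z i / sqrt (\<Sum>j\<le>n. (k z j)\<^sup>2) else 0)"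
    proof (cases "i \<le> n")
      case True
      have "continuous_on ({0..1} \<times> T) (\<lambda>z. k z i / sqrt (\<Sum>j\<le>n. (k z j)\<^sup>2))"
        using pos True
        by (intro continuous_intros continuous_on_subset[OF cont]) (auto simp: less_le)
      then show ?thesis using True by simp
    qed simp
  qed
  moreover have "radial n (k (t, x)) \<in> T" if t: "0 \<le> t" "t \<le> 1" and x: "x \<in> T" for t x
    using pos[OF t x] by (simp add: T_def radial_def power_divide flip: sum_divide_distrib)
  ultimately show ?thesis
    unfolding homotopic_with_def nsphere_eq T_def[symmetric]
    by (intro exI[of _ "\<lambda>z. radial n (k z)"]) (auto simp: prod_topology_subtopology_eu)
qed

text \<open>
  On the sphere the straight line from \<open>x\<close> to \<open>F (R x)\<close> avoids the origin by coercivity, so a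
  nowhere vanishing \<open>F\<close> would give a contraction of the sphere through \<open>F ((1 - t) R x)\<close>.
\<close>

lemma coercive_has_zero:
  fixes F :: "(nat \<Rightarrow> real) \<Rightarrow> nat \<Rightarrow> real"
  assumes cont: "\<And>i. i \<le> n \<Longrightarrow> continuous_on UNIV (\<lambda>x. F x i)" and R: "R > 0"
    and coercive: "\<And>x. (\<Sum>i\<le>n. (x i)\<^sup>2) = R\<^sup>2 \<Longrightarrow> 0 < (\<Sum>i\<le>n. F x i * x i)"
  shows "\<exists>x. \<forall>i\<le>n. F x i = 0"
proof (rule ccontr)
  assume "\<not> ?thesis"
  then have nz: "\<exists>i\<le>n. F x i \<noteq> 0" for x by blast
  have coord: "continuous_on UNIV (\<lambda>z::real \<times> (nat \<Rightarrow> real). snd z i)" for i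
    by (rule continuous_on_compose2[OF continuous_on_product_coordinates continuous_on_snd[OF continuous_on_id]]) auto
  have scale: "continuous_on UNIV (\<lambda>z::real \<times> (nat \<Rightarrow> real). (\<lambda>i. c (fst z) * snd z i))" if "continuous_on UNIV c" for c
  proof (rule continuous_on_coordinatewise_then_product)
    fix i
    have "continuous_on UNIV (\<lambda>z::real \<times> (nat \<Rightarrow> real). c (fst z))"
      by (rule continuous_on_compose2[OF that continuous_on_fst[OF continuous_on_id]]) auto
    then show "continuous_on UNIV (\<lambda>z::real \<times> (nat \<Rightarrow> real). c (fst z) * snd z i)"
      using coord[of i] by (rule continuous_on_mult)
  qed
  define k1 where "k1 z i = (1 - fst z) * snd z i + fst z * F (\<lambda>i. R * snd z i) i" for z i
  define k2 where "k2 z i = F (\<lambda>i. ((1 - fst z) * R) * snd z i) i" for z i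
  have 1: "homotopic_with (\<lambda>_. True) (nsphere n) (nsphere n) (\<lambda>x. radial n (k1 (0, x))) (\<lambda>x. radial n (k1 (1, x)))"
  proof (rule homotopic_radial)
    show "continuous_on UNIV (\<lambda>z. k1 z i)" if "i \<le> n" for i
    proof -
      have "continuous_on UNIV (\<lambda>z::real \<times> (nat \<Rightarrow> real). F (\<lambda>i. R * snd z i) i)"
        by (rule continuous_on_compose2[OF cont[OF that] scale[of "\<lambda>_. R"]]) auto
      moreover have "continuous_on UNIV (\<lambda>z::real \<times> (nat \<Rightarrow> real). fst z)"
        by (rule continuous_on_fst[OF continuous_on_id])
      ultimately show ?thesis
        unfolding k1_def by (intro continuous_on_add continuous_on_mult continuous_on_diff continuous_on_const coord)
    qed
    fix t :: real and x :: "nat \<Rightarrow> real"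
    assume t: "0 \<le> t" "t \<le> 1" and x: "(\<Sum>i\<le>n. (x i)\<^sup>2) = 1"
    have "(\<Sum>i\<le>n. (R * x i)\<^sup>2) = R\<^sup>2"
      using x by (simp add: power_mult_distrib flip: sum_distrib_left)
    from coercive[OF this] have "0 < R * (\<Sum>i\<le>n. F (\<lambda>i. R * x i) i * x i)"
      by (simp add: sum_distrib_left ac_simps)
    then have p: "0 < (\<Sum>i\<le>n. F (\<lambda>i. R * x i) i * x i)" using R by (simp add: zero_less_mult_iff)
    have "(\<Sum>i\<le>n. k1 (t, x) i * x i) = (1 - t) * (\<Sum>i\<le>n. (x i)\<^sup>2) + t * (\<Sum>i\<le>n. F (\<lambda>i. R * x i) i * x i)"
      by (simp add: k1_def sum_distrib_left sum.distrib[symmetric] power2_eq_square algebra_simps)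
    also have "\<dots> > 0"
      using t p x by (cases "t = 0") (auto intro: add_nonneg_pos)
    finally show "\<exists>i\<le>n. k1 (t, x) i \<noteq> 0"
      by (rule contrapos_pp) (simp add: sum.neutral)
  qed
  have 2: "homotopic_with (\<lambda>_. True) (nsphere n) (nsphere n) (\<lambda>x. radial n (k2 (0, x))) (\<lambda>x. radial n (k2 (1, x)))"
  proof (rule homotopic_radial)
    show "continuous_on UNIV (\<lambda>z. k2 z i)" if "i \<le> n" for i
      unfolding k2_def
      by (rule continuous_on_compose2[OF cont[OF that] scale[of "\<lambda>s. (1 - s) * R"]])
        (auto intro!: continuous_intros)
    show "\<exists>i\<le>n. k2 (t, x) i \<noteq> 0" for t x
      using nz[of "\<lambda>i. ((1 - t) * R) * x i"] by (simp add: k2_def)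
  qed
  have eq: "(\<lambda>x. radial n (k1 (1, x))) = (\<lambda>x. radial n (k2 (0, x)))"
    by (simp add: k1_def k2_def fun_eq_iff radial_def)
  have h: "homotopic_with (\<lambda>_. True) (nsphere n) (nsphere n) (\<lambda>x. radial n (k1 (0, x))) (\<lambda>x. radial n (k2 (1, x)))"
    using 2 unfolding eq[symmetric] by (rule homotopic_with_trans[OF 1])
  \<comment> \<open>The first homotopy starts at the identity because \<open>radial\<close> fixes
    unit vectors of the sphere; the second ends at the normalised value of \<open>F\<close> at the
    origin, which does not depend on \<open>x\<close>.\<close>
  have "homotopic_with (\<lambda>_. True) (nsphere n) (nsphere n) id (\<lambda>x. radial n (k2 (1, \<lambda>_. 0)))"
  proof (rule homotopic_with_eq[OF h])
    show "id x = radial n (k1 (0, x))" if "x \<in> topspace (nsphere n)" for x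
      using that by (auto simp: nsphere_eq radial_def k1_def fun_eq_iff)
    have "k2 (1, x) = k2 (1, \<lambda>_. 0)" for x by (simp add: k2_def fun_eq_iff)
    then show "radial n (k2 (1, \<lambda>_. 0)) = radial n (k2 (1, x))" if "x \<in> topspace (nsphere n)" for x
      by metis
  qed simp
  then have "contractible_space (nsphere n)"
    unfolding contractible_space_def by blast
  then show False using non_contractible_space_nsphere by blast
qed

subsection \<open>Leray projection and Stokes operator in the eigenbasis\<close>

context bounded_domain
begin

lemma dirichlet_inner_lincomb_left:
  assumes u: "u \<in> H1 \<Omega>" and v: "v \<in> H1 \<Omega>" and z: "z \<in> H1 \<Omega>"
  shows "dirichlet_inner \<Omega> (\<lambda>x. a *\<^sub>R u x + b *\<^sub>R v x) z = a * dirichlet_inner \<Omega> u z + b * dirichlet_inner \<Omega> v z"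
proof -
  let ?D = "weak_pderiv \<Omega>"
  have "l2_inner \<Omega> (?D j (\<lambda>x. a *\<^sub>R u x + b *\<^sub>R v x)) (?D j z) =
      a * l2_inner \<Omega> (?D j u) (?D j z) + b * l2_inner \<Omega> (?D j v) (?D j z)" for j
    using l2_inner_cong_AE[OF weak_pderiv_spec(1)[OF H1_lincomb(1)[OF u v]] _ weak_pderiv_spec(1)[OF z] H1_lincomb(2)[OF u v]]
    by (simp add: L2_lincomb weak_pderiv_spec u v z l2_inner_lincomb_left)
  then show ?thesis
    by (simp add: dirichlet_inner_eq_sum H1_lincomb u v z sum.distrib sum_distrib_left)
qed

end

context flow_domain
begin

lemma H2_lincomb:
  assumes u: "u \<in> H2 S" and v: "v \<in> H2 S"
  shows "(\<lambda>x. a *\<^sub>R u x + b *\<^sub>R v x) \<in> H2 S"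
proof -
  have L: "u \<in> L2 \<Omega>" "v \<in> L2 \<Omega>" using u v by (auto simp: H2_eq sobolev2_def)
  let ?D = "weak_pderiv \<Omega>"
  note D = H1_imp_L2[OF H2_weak_pderivs(2)[OF u]] H1_imp_L2[OF H2_weak_pderivs(2)[OF v]]
  note DD = weak_pderiv_spec(1)[OF H2_weak_pderivs(2)[OF u]] weak_pderiv_spec(1)[OF H2_weak_pderivs(2)[OF v]]
  have 1: "has_weak_pderiv (scalar_tests S) \<Omega> i (\<lambda>x. a *\<^sub>R u x + b *\<^sub>R v x) (\<lambda>x. a *\<^sub>R ?D i u x + b *\<^sub>R ?D i v x)" for i
    by (intro has_weak_pderiv_lincomb H2_weak_pderivs(1) scalar_tests_smooth L D u v)
  have 2: "has_weak_pderiv (scalar_tests S) \<Omega> j (\<lambda>x. a *\<^sub>R ?D i u x + b *\<^sub>R ?D i v x)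
      (\<lambda>x. a *\<^sub>R ?D j (?D i u) x + b *\<^sub>R ?D j (?D i v) x)" for i j
    by (intro has_weak_pderiv_lincomb H2_weak_pderivs(3) scalar_tests_smooth D DD u v)
  have "\<exists>g\<in>L2 \<Omega>. has_weak_pderiv (scalar_tests S) \<Omega> i (\<lambda>x. a *\<^sub>R u x + b *\<^sub>R v x) g \<and>
      (\<forall>j. \<exists>k\<in>L2 \<Omega>. has_weak_pderiv (scalar_tests S) \<Omega> j g k)" for i
  proof (rule bexI[of _ "\<lambda>x. a *\<^sub>R ?D i u x + b *\<^sub>R ?D i v x"], rule conjI[OF 1], rule allI)
    show "\<exists>k\<in>L2 \<Omega>. has_weak_pderiv (scalar_tests S) \<Omega> j (\<lambda>x. a *\<^sub>R ?D i u x + b *\<^sub>R ?D i v x) k" for j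
      using 2[of j i] L2_lincomb[OF DD] by blast
  qed (rule L2_lincomb[OF D])
  then show ?thesis using L2_lincomb[OF L] by (simp add: H2_eq sobolev2_def)
qed

end

locale stokes_basis = flow_domain +
  fixes w :: "nat \<Rightarrow> field" and lam :: "nat \<Rightarrow> real"
  assumes basis: "stokes_eigenbasis S w lam"
begin

definition comb :: "nat \<Rightarrow> (nat \<Rightarrow> real) \<Rightarrow> field" where
  "comb N a = (\<lambda>x. \<Sum>j=1..N. a j *\<^sub>R w j x)"

lemma w_H2: "j \<ge> 1 \<Longrightarrow> w j \<in> H2 S" and w_V: "j \<ge> 1 \<Longrightarrow> w j \<in> V_space S"
  using basis by (simp_all add: stokes_eigenbasis_def stokes_domain_def)

lemma w_L2: "j \<ge> 1 \<Longrightarrow> w j \<in> L2 \<Omega>" and w_H: "j \<ge> 1 \<Longrightarrow> w j \<in> H_space S"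
  using w_V V_imp_L2 V_imp_H by auto

lemma w_stokes: "j \<ge> 1 \<Longrightarrow> AE x in M. stokes S (w j) x = lam j *\<^sub>R w j x"
  using basis by (simp add: stokes_eigenbasis_def)

lemma w_orthonormal: "i \<ge> 1 \<Longrightarrow> j \<ge> 1 \<Longrightarrow> l2_inner \<Omega> (w i) (w j) = (if i = j then 1 else 0)"
  using basis by (simp add: stokes_eigenbasis_def)

lemma galerkin_eq_comb: "galerkin_dual w N l = comb N (\<lambda>j. l (w j))"
  by (simp add: galerkin_dual_def comb_def)

lemma galerkin_tendsto:
  "g \<in> H_space S \<Longrightarrow> (\<lambda>N. l2_norm \<Omega> (\<lambda>x. g x - comb N (\<lambda>j. l2_inner \<Omega> g (w j)) x)) \<longlonglongrightarrow> 0"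
  using basis by (simp add: stokes_eigenbasis_def galerkin_def galerkin_eq_comb)

lemma comb_cong: "(\<And>j. 1 \<le> j \<Longrightarrow> j \<le> N \<Longrightarrow> a j = b j) \<Longrightarrow> comb N a = comb N b"
  by (simp add: comb_def)

lemma comb_Suc: "comb (Suc N) a = (\<lambda>x. 1 *\<^sub>R comb N a x + a (Suc N) *\<^sub>R w (Suc N) x)"
  by (simp add: comb_def)

text \<open>The zero field is written as a combination of eigenvectors so that the closure lemmas
  for linear combinations also settle the base case of inductions on \<open>N\<close>.\<close>

lemma comb_0: "comb 0 a = (\<lambda>x. 0 *\<^sub>R w 1 x + 0 *\<^sub>R w 1 x)"
  by (simp add: comb_def)

lemma comb_V: "comb N a \<in> V_space S"
proof (induction N)
  case 0
  show ?case unfolding comb_0 by (intro V_lincomb w_V) auto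
next
  case (Suc N)
  show ?case unfolding comb_Suc by (intro V_lincomb w_V Suc.IH) auto
qed

lemma comb_H2: "comb N a \<in> H2 S"
proof (induction N)
  case 0
  show ?case unfolding comb_0 by (intro H2_lincomb w_H2) auto
next
  case (Suc N)
  show ?case unfolding comb_Suc by (intro H2_lincomb w_H2 Suc.IH) auto
qed

lemma comb_H: "comb N a \<in> H_space S" and comb_L2: "comb N a \<in> L2 \<Omega>"
  using comb_V V_imp_H V_imp_L2 by auto

lemma comb_inner: "g \<in> L2 \<Omega> \<Longrightarrow> l2_inner \<Omega> (comb N a) g = (\<Sum>j=1..N. a j * l2_inner \<Omega> (w j) g)"
  unfolding comb_def by (rule l2_inner_sum_left) (auto intro: w_L2)

lemma comb_inner_right: "g \<in> L2 \<Omega> \<Longrightarrow> l2_inner \<Omega> g (comb N a) = (\<Sum>j=1..N. a j * l2_inner \<Omega> g (w j))"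
  unfolding comb_def by (rule l2_inner_sum_right) (auto intro: w_L2)

lemma comb_inner_w: "k \<ge> 1 \<Longrightarrow> l2_inner \<Omega> (comb N a) (w k) = (if k \<le> N then a k else 0)"
  by (simp add: comb_inner w_L2 w_orthonormal if_distrib[of "\<lambda>c. _ * c"] sum.delta cong: if_cong sum.cong_simp)

lemma comb_inner_comb: "l2_inner \<Omega> (comb N a) (comb N b) = (\<Sum>j=1..N. a j * b j)"
proof -
  have "l2_inner \<Omega> (comb N a) (comb N b) = (\<Sum>j=1..N. b j * l2_inner \<Omega> (comb N a) (w j))"
    by (rule comb_inner_right[OF comb_L2])
  also have "\<dots> = (\<Sum>j=1..N. a j * b j)" by (intro sum.cong) (auto simp: comb_inner_w)
  finally show ?thesis .
qed

lemma comb_norm: "(l2_norm \<Omega> (comb N a))\<^sup>2 = (\<Sum>j=1..N. (a j)\<^sup>2)"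
  by (simp only: l2_norm_power2 comb_inner_comb) (simp add: power2_eq_square)

lemma comb_diff: "n \<le> m \<Longrightarrow> (\<lambda>x. comb m a x - comb n a x) = comb m (\<lambda>j. if n < j then a j else 0)"
proof
  fix x assume nm: "n \<le> m"
  have "comb n a x = (\<Sum>j=1..m. (if n < j then 0 else a j) *\<^sub>R w j x)"
    unfolding comb_def using nm by (intro sum.mono_neutral_cong_left) auto
  then show "comb m a x - comb n a x = comb m (\<lambda>j. if n < j then a j else 0) x"
    by (simp add: comb_def sum_subtractf[symmetric] if_distrib[of "\<lambda>c. c *\<^sub>R _"] cong: if_cong)
      (intro sum.cong, auto)
qed

lemma Bessel:
  assumes g: "g \<in> L2 \<Omega>"
  shows "(\<Sum>j=1..N. (l2_inner \<Omega> g (w j))\<^sup>2) \<le> (l2_norm \<Omega> g)\<^sup>2"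
proof -
  let ?c = "\<lambda>j. l2_inner \<Omega> g (w j)"
  have "0 \<le> l2_inner \<Omega> (\<lambda>x. g x - comb N ?c x) (\<lambda>x. g x - comb N ?c x)"
    by (simp flip: l2_norm_power2)
  also have "\<dots> = l2_inner \<Omega> g g - 2 * l2_inner \<Omega> g (comb N ?c) + l2_inner \<Omega> (comb N ?c) (comb N ?c)"
    by (simp add: l2_inner_diff_left l2_inner_diff_right L2_diff g comb_L2 l2_inner_commute[of "comb N ?c" g])
  also have "\<dots> = (l2_norm \<Omega> g)\<^sup>2 - (\<Sum>j=1..N. (?c j)\<^sup>2)"
    by (simp only: comb_inner_right[OF g] comb_inner_comb l2_norm_power2) (simp add: power2_eq_square)
  finally show ?thesis by simp
qed

text \<open>The completeness of the eigenvectors in H gives the projection explicitly as the series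
  of \<open>l2_inner \<Omega> g (w j)\<close> times \<open>w j\<close>, which converges by Bessel's
  inequality and completeness of \<open>L2\<close>.\<close>

lemma L2_projection:
  assumes g: "g \<in> L2 \<Omega>"
  obtains p where "p \<in> H_space S" "\<And>\<phi>. \<phi> \<in> H_space S \<Longrightarrow> l2_inner \<Omega> (\<lambda>x. g x - p x) \<phi> = 0"
proof -
  define c where "c j = l2_inner \<Omega> g (w j)" for j
  define s where "s N = comb N c" for N
  have sH: "s N \<in> H_space S" and sL: "s N \<in> L2 \<Omega>" for N by (simp_all add: s_def comb_H comb_L2)
  have "summable (\<lambda>j. (c (Suc j))\<^sup>2)"
  proof (rule bounded_imp_summable)
    show "(\<Sum>k\<le>n. (c (Suc k))\<^sup>2) \<le> (l2_norm \<Omega> g)\<^sup>2" for n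
      using Bessel[OF g, of "Suc n"] by (simp only: c_def One_nat_def sum.atLeast1_atMost_eq lessThan_Suc_atMost)
  qed simp
  then have conv: "convergent (\<lambda>n. \<Sum>j<n. (c (Suc j))\<^sup>2)" by (simp add: summable_iff_convergent)
  define t where "t n = (\<Sum>j=1..n. (c j)\<^sup>2)" for n
  have "Cauchy t"
    using conv convergent_Cauchy unfolding t_def by (simp add: sum.atLeast1_atMost_eq)
  \<comment> \<open>By orthonormality the squared distance of two partial sums is an increment of
    \<open>t\<close>, so the partial sums inherit the Cauchy property.\<close>
  have st: "(l2_norm \<Omega> (\<lambda>x. s m x - s n x))\<^sup>2 = t m - t n" if "n \<le> m" for m n
  proof -
    have "(l2_norm \<Omega> (\<lambda>x. s m x - s n x))\<^sup>2 = (\<Sum>j=1..m. (if n < j then c j else 0)\<^sup>2)"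
      using that by (simp add: s_def comb_diff comb_norm)
    also have "\<dots> = (\<Sum>j=1..m. (c j)\<^sup>2 - (if n < j then 0 else (c j)\<^sup>2))"
      by (intro sum.cong) auto
    also have "\<dots> = t m - (\<Sum>j=1..m. if n < j then 0 else (c j)\<^sup>2)"
      by (simp add: sum_subtractf t_def)
    also have "(\<Sum>j=1..m. if n < j then 0 else (c j)\<^sup>2) = t n"
      unfolding t_def using that by (intro sum.mono_neutral_cong_right) auto
    finally show ?thesis .
  qed
  have cauchy: "\<exists>N. \<forall>m\<ge>N. \<forall>n\<ge>N. l2_norm \<Omega> (\<lambda>x. s m x - s n x) \<le> e" if e: "e > 0" for e
  proof -
    obtain N where N: "\<And>m n. m \<ge> N \<Longrightarrow> n \<ge> N \<Longrightarrow> \<bar>t m - t n\<bar> < e\<^sup>2"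
      using CauchyD[OF \<open>Cauchy t\<close>, of "e\<^sup>2"] e by auto
    have "l2_norm \<Omega> (\<lambda>x. s m x - s n x) \<le> e" if "m \<ge> N" "n \<ge> N" for m n
    proof (rule power2_le_imp_le)
      show "(l2_norm \<Omega> (\<lambda>x. s m x - s n x))\<^sup>2 \<le> e\<^sup>2"
      proof (cases "n \<le> m")
        case True
        then show ?thesis using st[OF True] N[OF that] by simp
      next
        case False
        then show ?thesis using st[of m n] N[OF that] l2_norm_minus_commute[of "s m" "s n"] by simp
      qed
    qed (use e in simp)
    then show ?thesis by blast
  qed
  obtain p where p: "p \<in> L2 \<Omega>" "(\<lambda>n. l2_norm \<Omega> (\<lambda>x. s n x - p x)) \<longlonglongrightarrow> 0"
    using L2_complete[of s, OF sL cauchy] by blast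
  have gp: "(\<lambda>x. g x - p x) \<in> L2 \<Omega>" by (rule L2_diff[OF g p(1)])
  \<comment> \<open>The remainder is orthogonal to every eigenvector, hence to the Galerkin sums of
    any element of H, and in the limit to that element.\<close>
  have w0: "l2_inner \<Omega> (\<lambda>x. g x - p x) (w j) = 0" if j: "j \<ge> 1" for j
  proof -
    have "(\<lambda>n. l2_inner \<Omega> (w j) (s n)) \<longlonglongrightarrow> l2_inner \<Omega> (w j) p"
      by (rule l2_inner_tendsto_right[OF w_L2[OF j] sL p])
    moreover have "(\<lambda>n. l2_inner \<Omega> (w j) (s n)) \<longlonglongrightarrow> c j"
      using j by (intro tendsto_eventually)
        (auto simp: eventually_sequentially l2_inner_commute[of "w j"] s_def comb_inner_w intro!: exI[of _ j])
    ultimately have "l2_inner \<Omega> (w j) p = c j" by (rule LIMSEQ_unique)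
    then show ?thesis
      by (simp add: l2_inner_diff_left g p w_L2[OF j] c_def l2_inner_commute[of p])
  qed
  show ?thesis
  proof (rule that)
    show "p \<in> H_space S" by (rule H_closed[OF p(1) sH p(2)])
    fix \<phi> assume \<phi>: "\<phi> \<in> H_space S"
    let ?g = "\<lambda>N. comb N (\<lambda>j. l2_inner \<Omega> \<phi> (w j))"
    have "(\<lambda>N. l2_inner \<Omega> (\<lambda>x. g x - p x) (?g N)) \<longlonglongrightarrow> l2_inner \<Omega> (\<lambda>x. g x - p x) \<phi>"
      by (rule l2_inner_tendsto_right[OF gp comb_L2 H_imp_L2[OF \<phi>]])
        (use galerkin_tendsto[OF \<phi>] in \<open>simp add: l2_norm_minus_commute[of _ \<phi>]\<close>)
    moreover have "l2_inner \<Omega> (\<lambda>x. g x - p x) (?g N) = 0" for N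
      by (simp add: comb_inner_right[OF gp] w0)
    ultimately show "l2_inner \<Omega> (\<lambda>x. g x - p x) \<phi> = 0" by (simp add: LIMSEQ_const_iff)
  qed
qed

lemma leray_spec:
  assumes g: "g \<in> L2 \<Omega>"
  shows "leray S g \<in> H_space S" and "\<phi> \<in> H_space S \<Longrightarrow> l2_inner \<Omega> (leray S g) \<phi> = l2_inner \<Omega> g \<phi>"
proof -
  let ?P = "\<lambda>p. p \<in> H_space S \<and> (\<forall>\<phi>\<in>H_space S. l2_inner \<Omega> (\<lambda>x. g x - p x) \<phi> = 0)"
  obtain p where p: "p \<in> H_space S" "\<And>\<phi>. \<phi> \<in> H_space S \<Longrightarrow> l2_inner \<Omega> (\<lambda>x. g x - p x) \<phi> = 0"
    using L2_projection[OF g] by blast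
  then have "?P p" by blast
  from someI[of ?P p, OF this] have P: "?P (leray S g)" unfolding leray_def .
  then show H: "leray S g \<in> H_space S" by (rule conjunct1)
  show "l2_inner \<Omega> (leray S g) \<phi> = l2_inner \<Omega> g \<phi>" if \<phi>: "\<phi> \<in> H_space S"
  proof -
    have "l2_inner \<Omega> (\<lambda>x. g x - leray S g x) \<phi> = 0" using P \<phi> by blast
    then show ?thesis
      using l2_inner_diff_left[OF g H_imp_L2[OF H] H_imp_L2[OF \<phi>]] by simp
  qed
qed

section \<open>The Stokes operator on combinations of eigenvectors\<close>

lemma stokes_H: "v \<in> stokes_domain S \<Longrightarrow> stokes S v \<in> H_space S"
  using H_lincomb[OF leray_spec(1) leray_spec(1), OF laplacian_L2 laplacian_L2, of v v "-1" 0]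
  by (simp add: stokes_def stokes_domain_def)

lemma stokes_inner:
  assumes v: "v \<in> stokes_domain S" and \<phi>: "\<phi> \<in> V_space S"
  shows "l2_inner \<Omega> (stokes S v) \<phi> = dirichlet_inner \<Omega> v \<phi>"
proof -
  have vH2: "v \<in> H2 S" and vV: "v \<in> V_space S" using v by (auto simp: stokes_domain_def)
  have "l2_inner \<Omega> (stokes S v) \<phi> = - l2_inner \<Omega> (leray S (laplacian \<Omega> v)) \<phi>"
    unfolding stokes_def by (rule l2_inner_minus_left)
  then show ?thesis
    by (simp add: leray_spec(2)[OF laplacian_L2[OF vH2] V_imp_H[OF \<phi>]] laplacian_inner[OF vH2 vV \<phi>])
qed

lemma comb_stokes_domain: "comb N a \<in> stokes_domain S"
  by (simp add: stokes_domain_def comb_V comb_H2)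

lemma dirichlet_inner_comb:
  assumes \<phi>: "\<phi> \<in> V_space S"
  shows "dirichlet_inner \<Omega> (comb N a) \<phi> = (\<Sum>j=1..N. a j * dirichlet_inner \<Omega> (w j) \<phi>)"
proof (induction N)
  case 0
  show ?case unfolding comb_0
    using dirichlet_inner_lincomb_left[OF V_imp_H1[OF w_V] V_imp_H1[OF w_V] V_imp_H1[OF \<phi>], of 1 1 0 0] by simp
next
  case (Suc N)
  have "dirichlet_inner \<Omega> (comb (Suc N) a) \<phi> = 1 * dirichlet_inner \<Omega> (comb N a) \<phi> + a (Suc N) * dirichlet_inner \<Omega> (w (Suc N)) \<phi>"
    unfolding comb_Suc by (intro dirichlet_inner_lincomb_left V_imp_H1 comb_V w_V \<phi>) simp
  then show ?case by (simp add: Suc.IH)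
qed

text \<open>Linearity of \<open>stokes\<close> is hidden behind the choices in its definition, so
  both sides are compared weakly. Their difference lies in H and is orthogonal to V, which is dense
  in H, hence it is orthogonal to itself.\<close>

lemma stokes_comb: "AE x in M. stokes S (comb N a) x = comb N (\<lambda>j. lam j * a j) x"
proof -
  let ?z = "\<lambda>x. stokes S (comb N a) x - comb N (\<lambda>j. lam j * a j) x"
  have sL: "stokes S (comb N a) \<in> L2 \<Omega>" by (intro H_imp_L2 stokes_H comb_stokes_domain)
  have zL: "?z \<in> L2 \<Omega>" by (intro L2_diff sL comb_L2)
  have test: "l2_inner \<Omega> ?z \<phi> = 0" if \<phi>: "\<phi> \<in> V_space S" for \<phi>
  proof -
    have \<phi>L: "\<phi> \<in> L2 \<Omega>" by (rule V_imp_L2[OF \<phi>])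
    have "l2_inner \<Omega> (stokes S (comb N a)) \<phi> = (\<Sum>j=1..N. a j * dirichlet_inner \<Omega> (w j) \<phi>)"
      by (simp add: stokes_inner comb_stokes_domain \<phi> dirichlet_inner_comb)
    also have "\<dots> = (\<Sum>j=1..N. (lam j * a j) * l2_inner \<Omega> (w j) \<phi>)"
    proof (intro sum.cong refl)
      fix j assume "j \<in> {1..N}"
      then have j: "j \<ge> 1" by simp
      have wd: "w j \<in> stokes_domain S" using w_H2[OF j] w_V[OF j] by (simp add: stokes_domain_def)
      have "dirichlet_inner \<Omega> (w j) \<phi> = l2_inner \<Omega> (stokes S (w j)) \<phi>"
        by (rule stokes_inner[OF wd \<phi>, symmetric])
      also have "\<dots> = l2_inner \<Omega> (\<lambda>x. lam j *\<^sub>R w j x) \<phi>"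
        by (intro l2_inner_cong_AE H_imp_L2 stokes_H wd L2_scaleR w_L2 w_stokes j V_imp_L2 \<phi>)
      also have "\<dots> = lam j * l2_inner \<Omega> (w j) \<phi>" by (rule l2_inner_scaleR_left)
      finally show "a j * dirichlet_inner \<Omega> (w j) \<phi> = (lam j * a j) * l2_inner \<Omega> (w j) \<phi>" by simp
    qed
    also have "\<dots> = l2_inner \<Omega> (comb N (\<lambda>j. lam j * a j)) \<phi>" by (simp add: comb_inner \<phi>L)
    finally show ?thesis by (simp add: l2_inner_diff_left sL comb_L2 \<phi>L)
  qed
  have zH: "?z \<in> H_space S" by (intro H_diff stokes_H comb_stokes_domain comb_H)
  obtain \<phi> where \<phi>: "\<And>n. \<phi> n \<in> test_fields S" "(\<lambda>n. l2_norm \<Omega> (\<lambda>x. \<phi> n x - ?z x)) \<longlonglongrightarrow> 0"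
    using H_approx[OF zH] by blast
  have "(\<lambda>n. l2_inner \<Omega> ?z (\<phi> n)) \<longlonglongrightarrow> l2_inner \<Omega> ?z ?z"
    by (rule l2_inner_tendsto_right[OF zL test_fields_L2[OF \<phi>(1)] zL \<phi>(2)])
  then have "l2_inner \<Omega> ?z ?z = 0"
    by (simp add: test test_fields_V \<phi>(1) LIMSEQ_const_iff)
  then have "l2_norm \<Omega> ?z = 0" by (simp add: l2_norm_def)
  from l2_norm_eq_0_imp_AE[OF zL this] show ?thesis by simp
qed

text \<open>This links the diagonal form of the viscous term in coordinates with the norm that
  measures the interpolation error.\<close>

lemma dirichlet_norm_comb: "(dirichlet_norm \<Omega> (comb N a))\<^sup>2 = (\<Sum>j=1..N. lam j * (a j)\<^sup>2)"
proof -
  have "(dirichlet_norm \<Omega> (comb N a))\<^sup>2 = dirichlet_inner \<Omega> (comb N a) (comb N a)"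
    using dirichlet_norm_power2[OF V_imp_H1[OF comb_V]] dirichlet_inner_eq_sum[OF V_imp_H1[OF comb_V] V_imp_H1[OF comb_V]]
    by (simp add: l2_norm_power2)
  also have "\<dots> = l2_inner \<Omega> (stokes S (comb N a)) (comb N a)"
    by (rule stokes_inner[OF comb_stokes_domain comb_V, symmetric])
  also have "\<dots> = l2_inner \<Omega> (comb N (\<lambda>j. lam j * a j)) (comb N a)"
    by (intro l2_inner_cong_AE H_imp_L2 stokes_H comb_stokes_domain comb_L2 stokes_comb comb_H)
  also have "\<dots> = (\<Sum>j=1..N. lam j * (a j)\<^sup>2)"
    by (simp add: comb_inner_comb power2_eq_square mult.assoc)
  finally show ?thesis .
qed

lemma comb_in_galerkin_space: "comb N a \<in> galerkin_space S w N"
proof -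
  have "galerkin S w N (comb N a) = comb N a"
    unfolding galerkin_def galerkin_eq_comb by (rule comb_cong) (simp add: comb_inner_w)
  then show ?thesis using comb_H by (auto simp: galerkin_space_def intro!: bexI[of _ "comb N a"])
qed

text \<open>In coordinates the nonlinearity is a quadratic polynomial, which gives the continuity
  needed to find a zero.\<close>

lemma B_comb:
  assumes N: "N \<ge> 1" and z: "z \<in> V_space S"
  shows "B S (comb N a) (comb N a) z = (\<Sum>k=1..N. \<Sum>l=1..N. a k * (a l * B S (w k) (w l) z))"
proof -
  have ne: "finite {1..N}" "{1..N} \<noteq> {}" using N by auto
  have "B S (comb N a) (comb N a) z = (\<Sum>k=1..N. a k * B S (w k) (comb N a) z)"
    using B_sum1[OF ne, of w "comb N a" z a] comb_V z w_V by (simp add: comb_def)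
  also have "\<dots> = (\<Sum>k=1..N. a k * (\<Sum>l=1..N. a l * B S (w k) (w l) z))"
    using B_sum2[OF ne, of w _ z a] z w_V by (intro sum.cong refl) (simp add: comb_def)
  finally show ?thesis by (simp add: sum_distrib_left)
qed

lemma B_comb_eq_0:
  assumes N: "N \<ge> 1"
  shows "(\<Sum>j=1..N. a j * B S (comb N a) (comb N a) (w j)) = 0"
proof -
  have ne: "finite {1..N}" "{1..N} \<noteq> {}" using N by auto
  have "B S (comb N a) (comb N a) (comb N a) = (\<Sum>j=1..N. a j * B S (comb N a) (comb N a) (w j))"
    using B_sum3[OF ne, of w "comb N a" "comb N a" a] comb_V w_V by (simp add: comb_def)
  then show ?thesis using B_self_eq_0[OF comb_V] by simp
qed

end

subsection \<open>The implicit Euler step\<close>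

context flow_domain
begin

lemma interpolant_L2: "interpolant S c\<^sub>0 h I \<Longrightarrow> \<phi> \<in> H1 \<Omega> \<Longrightarrow> I \<phi> \<in> L2 \<Omega>"
  by (auto simp: interpolant_def)

lemma interpolant_outside: "interpolant S c\<^sub>0 h I \<Longrightarrow> \<phi> \<notin> H1 \<Omega> \<Longrightarrow> I \<phi> = undefined"
  unfolding interpolant_def by (blast intro: PiE_arb)

lemma interpolant_inner_lincomb:
  assumes I: "interpolant S c\<^sub>0 h I" and \<phi>: "\<phi> \<in> H1 \<Omega>" and \<psi>: "\<psi> \<in> H1 \<Omega>" and z: "z \<in> L2 \<Omega>"
  shows "l2_inner \<Omega> (I (\<lambda>y. a *\<^sub>R \<phi> y + b *\<^sub>R \<psi> y)) z = a * l2_inner \<Omega> (I \<phi>) z + b * l2_inner \<Omega> (I \<psi>) z"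
proof -
  note L = interpolant_L2[OF I]
  have "AE x in M. I (\<lambda>y. a *\<^sub>R \<phi> y + b *\<^sub>R \<psi> y) x = a *\<^sub>R I \<phi> x + b *\<^sub>R I \<psi> x"
    using I \<phi> \<psi> unfolding interpolant_def by blast
  then have "l2_inner \<Omega> (I (\<lambda>y. a *\<^sub>R \<phi> y + b *\<^sub>R \<psi> y)) z = l2_inner \<Omega> (\<lambda>x. a *\<^sub>R I \<phi> x + b *\<^sub>R I \<psi> x) z"
    by (intro l2_inner_cong_AE L L2_lincomb H1_lincomb \<phi> \<psi> z)
  then show ?thesis by (simp add: l2_inner_lincomb_left L \<phi> \<psi> z)
qed

text \<open>
  With \<open>s = \<surd>c\<^sub>0 h\<close> the quadratic form below is at least
  \<open>\<beta> (|v|\<^sup>2 - s |v| \<parallel>v\<parallel> + s\<^sup>2 \<parallel>v\<parallel>\<^sup>2)\<close>, which is nonnegative.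
\<close>

lemma interpolant_coercive:
  assumes I: "interpolant S c\<^sub>0 h I" and v: "v \<in> V_space S"
    and pos: "c\<^sub>0 > 0" "\<beta> > 0" and small: "c\<^sub>0 * \<beta> * h\<^sup>2 \<le> \<nu>"
  shows "0 \<le> \<beta> * l2_inner \<Omega> (I v) v + \<nu> * (dirichlet_norm \<Omega> v)\<^sup>2"
proof -
  define s where "s = sqrt c\<^sub>0 * h"
  let ?n = "l2_norm \<Omega> v" and ?D = "dirichlet_norm \<Omega> v"
  have vH1: "v \<in> H1 \<Omega>" and vL: "v \<in> L2 \<Omega>" and IL: "I v \<in> L2 \<Omega>"
    using V_imp_H1[OF v] V_imp_L2[OF v] interpolant_L2[OF I] by auto
  \<comment> \<open>As \<open>v\<close> belongs to V, the approximation property bounds the error by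
    the Dirichlet norm, the very norm supplied by the viscous term.\<close>
  have "l2_norm \<Omega> (\<lambda>x. v x - I v x) \<le> s * ?D"
    using I vH1 v unfolding interpolant_def s_def by auto
  then have "l2_norm \<Omega> (\<lambda>x. v x - I v x) * ?n \<le> s * ?D * ?n"
    by (rule mult_right_mono) simp
  moreover have "l2_inner \<Omega> (\<lambda>x. v x - I v x) v \<le> l2_norm \<Omega> (\<lambda>x. v x - I v x) * ?n"
    using l2_Cauchy_Schwarz[OF L2_diff[OF vL IL] vL] by simp
  moreover have "l2_inner \<Omega> (\<lambda>x. v x - I v x) v = ?n\<^sup>2 - l2_inner \<Omega> (I v) v"
    by (simp add: l2_inner_diff_left vL IL l2_norm_power2)
  ultimately have "?n\<^sup>2 - s * ?D * ?n \<le> l2_inner \<Omega> (I v) v" by linarith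
  then have 1: "\<beta> * (?n\<^sup>2 - s * ?D * ?n) \<le> \<beta> * l2_inner \<Omega> (I v) v"
    using pos by (intro mult_left_mono) auto
  have "\<beta> * s\<^sup>2 \<le> \<nu>" using small pos by (simp add: s_def power_mult_distrib mult.commute mult.left_commute)
  then have 2: "\<beta> * s\<^sup>2 * ?D\<^sup>2 \<le> \<nu> * ?D\<^sup>2" by (rule mult_right_mono) simp
  have "0 \<le> ?n\<^sup>2 - s * ?D * ?n + (s * ?D)\<^sup>2"
  proof -
    have "?n\<^sup>2 - s * ?D * ?n + (s * ?D)\<^sup>2 = (?n - s * ?D / 2)\<^sup>2 + 3 / 4 * (s * ?D)\<^sup>2"
      by (simp add: power2_eq_square field_simps)
    then show ?thesis by simp
  qed
  then have "0 \<le> \<beta> * (?n\<^sup>2 - s * ?D * ?n + (s * ?D)\<^sup>2)" using pos by simp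
  also have "\<dots> = \<beta> * (?n\<^sup>2 - s * ?D * ?n) + \<beta> * s\<^sup>2 * ?D\<^sup>2"
    by (simp add: power_mult_distrib algebra_simps)
  finally show ?thesis using 1 2 by linarith
qed

end

context stokes_basis
begin

lemma interpolant_comb_inner:
  assumes I: "interpolant S c\<^sub>0 h I" and z: "z \<in> L2 \<Omega>"
  shows "l2_inner \<Omega> (I (comb N a)) z = (\<Sum>k=1..N. a k * l2_inner \<Omega> (I (w k)) z)"
proof (induction N)
  case 0
  show ?case unfolding comb_0
    using interpolant_inner_lincomb[OF I V_imp_H1[OF w_V] V_imp_H1[OF w_V] z, of 1 1 0 0] by simp
next
  case (Suc N)
  show ?case unfolding comb_Suc
    using interpolant_inner_lincomb[OF I V_imp_H1[OF comb_V] V_imp_H1[OF w_V] z, of "Suc N" 1 N a "a (Suc N)"]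
    by (simp add: Suc.IH)
qed

text \<open>
  If \<open>p\<close> is not in \<open>H\<^sup>1\<close>, neither is any \<open>v - p\<close>, and the feedback term is the constant \<open>undefined\<close>.
\<close>

lemma feedback_affine:
  assumes I: "interpolant S c\<^sub>0 h I" and pos: "c\<^sub>0 > 0" "\<beta> > 0" "\<nu> > 0" and small: "c\<^sub>0 * \<beta> * h\<^sup>2 \<le> \<nu>"
  obtains m d where
    "\<And>a i. 1 \<le> i \<Longrightarrow> l2_inner \<Omega> (leray S (I (\<lambda>y. comb N a y - p y))) (w i) = (\<Sum>k=1..N. a k * m k i) - d i"
    "\<And>a. 0 \<le> \<beta> * (\<Sum>i=1..N. (\<Sum>k=1..N. a k * m k i) * a i) + \<nu> * (dirichlet_norm \<Omega> (comb N a))\<^sup>2"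
proof (cases "p \<in> H1 \<Omega>")
  case True
  show ?thesis
  proof (rule that[of "\<lambda>k i. l2_inner \<Omega> (I (w k)) (w i)" "\<lambda>i. l2_inner \<Omega> (I p) (w i)"])
    fix a i assume i: "1 \<le> (i::nat)"
    have vp: "(\<lambda>y. comb N a y - p y) \<in> H1 \<Omega>" by (intro H1_diff V_imp_H1 comb_V True)
    have "l2_inner \<Omega> (leray S (I (\<lambda>y. comb N a y - p y))) (w i) = l2_inner \<Omega> (I (\<lambda>y. comb N a y - p y)) (w i)"
      by (intro leray_spec(2) interpolant_L2[OF I vp] w_H i)
    also have "\<dots> = l2_inner \<Omega> (I (comb N a)) (w i) - l2_inner \<Omega> (I p) (w i)"
      using interpolant_inner_lincomb[OF I V_imp_H1[OF comb_V] True w_L2[OF i], of 1 N a "-1"] by simp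
    finally show "l2_inner \<Omega> (leray S (I (\<lambda>y. comb N a y - p y))) (w i) =
        (\<Sum>k=1..N. a k * l2_inner \<Omega> (I (w k)) (w i)) - l2_inner \<Omega> (I p) (w i)"
      by (simp add: interpolant_comb_inner[OF I w_L2[OF i]])
  next
    fix a
    have "l2_inner \<Omega> (I (comb N a)) (comb N a) = (\<Sum>i=1..N. a i * l2_inner \<Omega> (I (comb N a)) (w i))"
      by (rule comb_inner_right[OF interpolant_L2[OF I V_imp_H1[OF comb_V]]])
    also have "\<dots> = (\<Sum>i=1..N. (\<Sum>k=1..N. a k * l2_inner \<Omega> (I (w k)) (w i)) * a i)"
      by (intro sum.cong refl) (simp add: interpolant_comb_inner[OF I w_L2] mult.commute)
    finally show "0 \<le> \<beta> * (\<Sum>i=1..N. (\<Sum>k=1..N. a k * l2_inner \<Omega> (I (w k)) (w i)) * a i) +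
        \<nu> * (dirichlet_norm \<Omega> (comb N a))\<^sup>2"
      using interpolant_coercive[OF I comb_V pos(1,2) small, of N a] by simp
  qed
next
  case False
  have "(\<lambda>y. comb N a y - p y) \<notin> H1 \<Omega>" for a
  proof
    assume "(\<lambda>y. comb N a y - p y) \<in> H1 \<Omega>"
    from H1_diff(1)[OF V_imp_H1[OF comb_V[of N a]] this] show False using False by simp
  qed
  then have "I (\<lambda>y. comb N a y - p y) = undefined" for a
    by (rule interpolant_outside[OF I])
  \<comment> \<open>With the matrix 0 the quadratic form is just the viscous term, which is
    nonnegative.\<close>
  then show ?thesis
    using pos by (intro that[of "\<lambda>_ _. 0" "\<lambda>i. - l2_inner \<Omega> (leray S undefined) (w i)"]) auto
qed

text \<open>The equation for the coordinates of the new iterate, obtained by testing with the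
  eigenvectors: \<open>b\<close> holds the old coordinates and \<open>p\<close> is the observed
  state at the new time. All terms free of the unknown are collected in \<open>e\<close>, so a
  solution is a zero of \<open>G\<close>.\<close>

lemma implicit_step:
  assumes I: "interpolant S c\<^sub>0 h I" and pos: "c\<^sub>0 > 0" "\<beta> > 0" "\<nu> > 0" "\<tau> > 0" and small: "c\<^sub>0 * \<beta> * h\<^sup>2 \<le> \<nu>"
    and N: "N \<ge> 1"
  shows "\<exists>a. \<forall>i\<in>{1..N}. (1 / \<tau>) * (a i - b i) + \<nu> * (lam i * a i) + B S (comb N a) (comb N a) (w i) =
    q i - \<beta> * l2_inner \<Omega> (leray S (I (\<lambda>y. comb N a y - p y))) (w i)"
proof -
  obtain m d where m: "\<And>a i. 1 \<le> i \<Longrightarrow>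
      l2_inner \<Omega> (leray S (I (\<lambda>y. comb N a y - p y))) (w i) = (\<Sum>k=1..N. a k * m k i) - d i"
    and coercive: "\<And>a. 0 \<le> \<beta> * (\<Sum>i=1..N. (\<Sum>k=1..N. a k * m k i) * a i) + \<nu> * (dirichlet_norm \<Omega> (comb N a))\<^sup>2"
    using feedback_affine[OF I pos(1,2,3) small] by blast
  define e where "e i = b i / \<tau> + q i + \<beta> * d i" for i
  define G where "G a i = a i / \<tau> + \<nu> * (lam i * a i) + B S (comb N a) (comb N a) (w i) +
      \<beta> * (\<Sum>k=1..N. a k * m k i) - e i" for a i
  define E where "E = sqrt (\<Sum>i=1..N. (e i)\<^sup>2)"
  \<comment> \<open>On the sphere of radius \<open>R\<close> the pairing of \<open>G a\<close> with
    \<open>a\<close> is at least R^2 / \<tau> - E R = R (R / \<tau> - E), and this choice makes the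
    bracket equal to 1.\<close>
  define R where "R = \<tau> * (E + 1)"
  have E: "0 \<le> E" by (simp add: E_def sum_nonneg)
  have R: "R > 0" using E pos by (simp add: R_def)
  have G_pos: "0 < (\<Sum>i=1..N. G a i * a i)" if a: "(\<Sum>i=1..N. (a i)\<^sup>2) = R\<^sup>2" for a
  proof -
    have "(\<Sum>i=1..N. G a i * a i) = (\<Sum>i=1..N. (a i)\<^sup>2) / \<tau> + \<nu> * (\<Sum>i=1..N. lam i * (a i)\<^sup>2) +
        (\<Sum>i=1..N. a i * B S (comb N a) (comb N a) (w i)) +
        \<beta> * (\<Sum>i=1..N. (\<Sum>k=1..N. a k * m k i) * a i) - (\<Sum>i=1..N. e i * a i)"
      by (simp add: G_def algebra_simps power2_eq_square sum.distrib sum_subtractf sum_distrib_left sum_divide_distrib)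
    also have "\<dots> = R\<^sup>2 / \<tau> + (\<beta> * (\<Sum>i=1..N. (\<Sum>k=1..N. a k * m k i) * a i) +
        \<nu> * (dirichlet_norm \<Omega> (comb N a))\<^sup>2) - (\<Sum>i=1..N. e i * a i)"
      unfolding a B_comb_eq_0[OF N] dirichlet_norm_comb by simp
    finally have 1: "(\<Sum>i=1..N. G a i * a i) \<ge> R\<^sup>2 / \<tau> - (\<Sum>i=1..N. e i * a i)"
      using coercive[of a] by linarith
    have "(\<Sum>i=1..N. e i * a i)\<^sup>2 \<le> (\<Sum>i=1..N. (e i)\<^sup>2) * (\<Sum>i=1..N. (a i)\<^sup>2)"
      by (rule Cauchy_Schwarz_ineq_sum)
    also have "\<dots> = (E * R)\<^sup>2" unfolding a by (simp add: E_def power_mult_distrib sum_nonneg)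
    finally have "\<bar>\<Sum>i=1..N. e i * a i\<bar> \<le> E * R"
      using E R by (simp flip: abs_le_square_iff)
    moreover have "R\<^sup>2 / \<tau> - E * R = R" using pos by (simp add: R_def power2_eq_square field_simps)
    ultimately show ?thesis using 1 R by linarith
  qed
  obtain n where n: "N = Suc n" using N by (cases N) auto
  have shift: "(\<Sum>i\<le>n. f (Suc i)) = (\<Sum>i=1..N. f i)" for f :: "nat \<Rightarrow> real"
    by (simp add: n sum.atLeast1_atMost_eq flip: lessThan_Suc_atMost)
  \<comment> \<open>\<open>coercive_has_zero\<close> numbers its n + 1 coordinates from 0, the
    eigenvectors are numbered from 1. So N = n + 1, and coordinate \<open>j\<close> of the field is
    \<open>x (j - 1)\<close>.\<close>
  have "\<exists>x. \<forall>i\<le>n. G (\<lambda>j. x (j - 1)) (Suc i) = 0"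
  proof (rule coercive_has_zero[OF _ R])
    show "continuous_on UNIV (\<lambda>x. G (\<lambda>j. x (j - 1)) (Suc i))" for i
    proof -
      have coord: "continuous_on UNIV (\<lambda>x::nat \<Rightarrow> real. x j)" for j
        by (rule continuous_on_product_coordinates)
      show ?thesis
        unfolding G_def B_comb[OF N w_V[of "Suc i", simplified]] using pos
        by (intro continuous_on_add continuous_on_diff continuous_on_mult continuous_on_sum continuous_on_divide
            continuous_on_const coord) auto
    qed
    show "0 < (\<Sum>i\<le>n. G (\<lambda>j. x (j - 1)) (Suc i) * x i)" if "(\<Sum>i\<le>n. (x i)\<^sup>2) = R\<^sup>2" for x
      using G_pos[of "\<lambda>j. x (j - 1)"] that
        shift[of "\<lambda>i. G (\<lambda>j. x (j - 1)) i * x (i - 1)"] shift[of "\<lambda>i. (x (i - 1))\<^sup>2"] by simp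
  qed
  then obtain x where x: "\<And>i. i \<le> n \<Longrightarrow> G (\<lambda>j. x (j - 1)) (Suc i) = 0" by blast
  let ?a = "\<lambda>j. x (j - 1)"
  show ?thesis
  proof (intro exI[of _ ?a] ballI)
    fix i assume i: "i \<in> {1..N}"
    then have "i - 1 \<le> n" "Suc (i - 1) = i" using n by auto
    with x[of "i - 1"] have "G ?a i = 0" by simp
    moreover have "(1 / \<tau>) * (?a i - b i) = ?a i / \<tau> - b i / \<tau>" by (simp add: diff_divide_distrib)
    moreover have feedback: "l2_inner \<Omega> (leray S (I (\<lambda>y. comb N ?a y - p y))) (w i) = (\<Sum>k=1..N. ?a k * m k i) - d i"
      using i by (intro m) simp
    ultimately show "(1 / \<tau>) * (?a i - b i) + \<nu> * (lam i * ?a i) + B S (comb N ?a) (comb N ?a) (w i) =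
        q i - \<beta> * l2_inner \<Omega> (leray S (I (\<lambda>y. comb N ?a y - p y))) (w i)"
      unfolding feedback by (simp add: G_def e_def algebra_simps)
  qed
qed

end

theorem proposition3p2:
  fixes S :: flow_setting
    and w :: "nat \<Rightarrow> field" and lam :: "nat \<Rightarrow> real"
    and f :: field and u :: "real \<Rightarrow> field"
    and I\<^sub>h :: "field \<Rightarrow> field"
    and \<nu> c\<^sub>0 h \<beta> \<tau> :: real and N :: nat
    and v\<^sub>0 :: field
  assumes "admissible S"
    and "stokes_eigenbasis S w lam"
    and "\<nu> > 0"
    and "f \<in> H_space S"
    and "navier_stokes_solution S \<nu> f u"
    and "c\<^sub>0 > 0" and "h > 0"
    and "interpolant S c\<^sub>0 h I\<^sub>h"
    and "\<tau> > 0" and "N \<ge> 1"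
    and "\<beta> > 0" and "c\<^sub>0 * \<beta> * h\<^sup>2 \<le> \<nu>"
    and "v\<^sub>0 \<in> galerkin_space S w N"
  shows "\<exists>v :: nat \<Rightarrow> field.
    (\<forall>k. v k \<in> galerkin_space S w N) \<and> v 0 = v\<^sub>0 \<and>
    (\<forall>k. AE x in lebesgue_on (region S).
       (1 / \<tau>) *\<^sub>R (v (k + 1) x - v k x) + \<nu> *\<^sub>R stokes S (v (k + 1)) x
         + galerkin_dual w N (B S (v (k + 1)) (v (k + 1))) x
       = galerkin S w N f x
         - \<beta> *\<^sub>R galerkin S w N
             (leray S (I\<^sub>h (\<lambda>y. v (k + 1) y - u (real (k + 1) * \<tau>) y))) x)"
proof -
  interpret stokes_basis S w lam
    by unfold_locales (use assms in auto)
  define q where "q j = l2_inner \<Omega> f (w j)" for j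
  define feedback where "feedback a k j =
    l2_inner \<Omega> (leray S (I\<^sub>h (\<lambda>y. comb N a y - u (real (k + 1) * \<tau>) y))) (w j)" for a k j
  \<comment> \<open>Equality of the coefficients of each eigenvector in the scheme, with
    \<open>b\<close> for the old and \<open>a\<close> for the new coordinates. Time index
    \<open>k\<close> enters only through the observation at time (k + 1) \<tau>.\<close>
  define step where "step a k b \<longleftrightarrow> (\<forall>i\<in>{1..N}. (1 / \<tau>) * (a i - b i) + \<nu> * (lam i * a i) +
    B S (comb N a) (comb N a) (w i) = q i - \<beta> * feedback a k i)" for a k and b :: "nat \<Rightarrow> real"
  have ex: "\<exists>a. step a k b" for k b
    unfolding step_def feedback_def
    using implicit_step[OF assms(8,6,11,3,9,12,10)] .
  obtain g where g: "AE x in M. v\<^sub>0 x = comb N (\<lambda>j. l2_inner \<Omega> g (w j)) x"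
    using assms(13) by (auto simp: galerkin_space_def galerkin_def galerkin_eq_comb)
  \<comment> \<open>Existence is what is known about a step, so the recursion chooses a solution
    each time.\<close>
  define c where "c = rec_nat (\<lambda>j. l2_inner \<Omega> g (w j)) (\<lambda>k b. SOME a. step a k b)"
  have c0: "c 0 = (\<lambda>j. l2_inner \<Omega> g (w j))" by (simp add: c_def)
  have c_step: "step (c (Suc k)) k (c k)" for k
    using someI_ex[OF ex[of k "c k"]] by (simp add: c_def)
  \<comment> \<open>The initial field agrees with a combination of eigenvectors only almost
    everywhere, but \<open>v 0\<close> has to be \<open>v\<^sub>0\<close> itself. The recursion
    therefore runs on coordinates, and index 0 is treated separately.\<close>
  define v where "v k = (if k = 0 then v\<^sub>0 else comb N (c k))" for k
  have v_AE: "AE x in M. v k x = comb N (c k) x" for k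
    using g by (cases "k = 0") (simp_all add: v_def c0)
  show ?thesis
  proof (intro exI[of _ v] conjI allI)
    show "v k \<in> galerkin_space S w N" for k
      using assms(13) comb_in_galerkin_space by (simp add: v_def)
    show "v 0 = v\<^sub>0" by (simp add: v_def)
    fix k
    have v1: "v (k + 1) = comb N (c (Suc k))" by (simp add: v_def)
    show "AE x in M. (1 / \<tau>) *\<^sub>R (v (k + 1) x - v k x) + \<nu> *\<^sub>R stokes S (v (k + 1)) x
         + galerkin_dual w N (B S (v (k + 1)) (v (k + 1))) x
       = galerkin S w N f x
         - \<beta> *\<^sub>R galerkin S w N
             (leray S (I\<^sub>h (\<lambda>y. v (k + 1) y - u (real (k + 1) * \<tau>) y))) x"
      \<comment> \<open>Only the old iterate and the Stokes term are known up to null sets. The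
        other terms are pointwise combinations of the first \<open>N\<close> eigenvectors, so off
        these null sets comparing coefficients is enough.\<close>
      using v_AE[of k] stokes_comb[of N "c (Suc k)"]
    proof eventually_elim
      case (elim x)
      let ?a = "c (Suc k)"
      have "(1 / \<tau>) *\<^sub>R (v (k + 1) x - v k x) + \<nu> *\<^sub>R stokes S (v (k + 1)) x
         + galerkin_dual w N (B S (v (k + 1)) (v (k + 1))) x =
        (1 / \<tau>) *\<^sub>R (comb N ?a x - comb N (c k) x) + \<nu> *\<^sub>R comb N (\<lambda>j. lam j * ?a j) x
         + comb N (\<lambda>j. B S (comb N ?a) (comb N ?a) (w j)) x"
        unfolding v1 elim galerkin_eq_comb ..
      also have "\<dots> = (\<Sum>j=1..N. ((1 / \<tau>) * (?a j - c k j) + \<nu> * (lam j * ?a j) +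
          B S (comb N ?a) (comb N ?a) (w j)) *\<^sub>R w j x)"
        unfolding comb_def by (simp only: scaleR_sum_right sum_subtractf[symmetric] sum.distrib[symmetric])
          (intro sum.cong refl, simp add: algebra_simps)
      also have "\<dots> = (\<Sum>j=1..N. (q j - \<beta> * feedback ?a k j) *\<^sub>R w j x)"
        using c_step[of k] unfolding step_def by (intro sum.cong refl) simp
      also have "\<dots> = comb N q x - \<beta> *\<^sub>R comb N (feedback ?a k) x"
        unfolding comb_def by (simp add: scaleR_sum_right sum_subtractf[symmetric] algebra_simps)
      also have "\<dots> = galerkin S w N f x
         - \<beta> *\<^sub>R galerkin S w N (leray S (I\<^sub>h (\<lambda>y. v (k + 1) y - u (real (k + 1) * \<tau>) y))) x"
        unfolding galerkin_def galerkin_eq_comb v1 q_def feedback_def ..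
      finally show ?case .
    qed
  qed
qed

end
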